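(* Let $\mathcal G$ be a connected noncompact metric graph with no terminal point, not satisfying Assumption (H), and having more than one halfline, and consider the critical energy ($p=6$). If $\mu_{\mathcal G}<\mu_{\mathbb R}$, then $-\infty<\mathcal E_{\mathcal G}(\mu)<0$ for every $\mu\in(\mu_{\mathcal G},\mu_{\mathbb R}]$, and $\mathcal E_{\mathcal G}(\mu)$ is attained if and only if $\mu\in[\mu_{\mathcal G},\mu_{\mathbb R}]$.
   Context: Metric graphs have finitely many edges and vertices, bounded edges identified with $[0,\ell_e]$ and halflines with $[0,\infty)$ (far endpoints: vertices at infinity). A terminal point is a vertex of degree one that is not a vertex at infinity. A trail is a path of adjacent edges traversing each edge exactly once. Assumption (H): every point of $\mathcal G$ lies on a trail containing two halflines (equivalently, after identifying all vertices at infinity, $\mathcal G$ admits a covering by cycles). $H^1_\mu(\mathcal G)$: continuous functions, $H^1$ on each edge, $\|u\|_2^2=\mu$. $E(u,\mathcal G)=\frac12\int|u'|^2-\frac16\int|u|^6$, $\mathcal E_{\mathcal G}(\mu)=\inf_{H^1_\mu(\mathcal G)}E(\cdot,\mathcal G)$, defined for $\mu>0$. For a graph $X$, $K_X=\sup_{u\in H^1(X),u\ne0}\frac{\|u\|_6^6}{\|u\|_2^4\|u'\|_2^2}$ and $\mu_X=\sqrt{3/K_X}$; $\mu_{\mathbb R}=\pi\sqrt3/2$. *)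

theory Defs
  imports "HOL-Analysis.Analysis"
begin

text \<open>A metric graph with finitely many vertices and edges.  The set hlines
  consists of the halflines (identified with [0,\<infinity>), the point 0 being the
  vertex src e, the far end being a vertex at infinity, which is NOT an element
  of verts).  Every other edge e is bounded, identified with [0, len e], the
  point 0 being src e and the point len e being tgt e.  Self-loops and
  multiple edges are allowed.\<close>

record ('v, 'e) mgraph =
  verts  :: "'v set"
  edges  :: "'e set"
  hlines :: "'e set"
  len    :: "'e \<Rightarrow> real"
  src    :: "'e \<Rightarrow> 'v"
  tgt    :: "'e \<Rightarrow> 'v"

definition metric_graph :: "('v, 'e) mgraph \<Rightarrow> bool" where
  "metric_graph G \<longleftrightarrow> finite (verts G) \<and> finite (edges G) \<and> hlines G \<subseteq> edges G \<and>
     (\<forall>e\<in>edges G. src G e \<in> verts G) \<and>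
     (\<forall>e\<in>edges G - hlines G. tgt G e \<in> verts G \<and> len G e > 0)"

text \<open>Degree of a vertex (a self-loop counts twice); vertices at infinity are not in verts.\<close>
definition deg :: "('v, 'e) mgraph \<Rightarrow> 'v \<Rightarrow> nat" where
  "deg G v = card {e\<in>edges G. src G e = v} + card {e\<in>edges G - hlines G. tgt G e = v}"

definition terminal_point :: "('v, 'e) mgraph \<Rightarrow> 'v \<Rightarrow> bool" where
  "terminal_point G v \<longleftrightarrow> v \<in> verts G \<and> deg G v = 1"

text \<open>Connectedness of the metric graph (halflines hang off vertices, so the
  graph is connected iff the vertex set is connected through bounded edges).\<close>
definition connected_mgraph :: "('v, 'e) mgraph \<Rightarrow> bool" where
  "connected_mgraph G \<longleftrightarrow>
     (\<forall>v\<in>verts G. \<forall>w\<in>verts G.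
        (v, w) \<in> {(a, b). \<exists>e\<in>edges G - hlines G. {src G e, tgt G e} = {a, b}}\<^sup>*)"

definition noncompact :: "('v, 'e) mgraph \<Rightarrow> bool" where
  "noncompact G \<longleftrightarrow> hlines G \<noteq> {}"

text \<open>A trail containing two halflines: it enters along halfline h1 (from its
  vertex at infinity) to vertex hd vs, traverses the distinct bounded edges es
  through the vertices vs, and leaves along the halfline h2 from last vs.\<close>
definition trail2 :: "('v, 'e) mgraph \<Rightarrow> 'e \<Rightarrow> 'v list \<Rightarrow> 'e list \<Rightarrow> 'e \<Rightarrow> bool" where
  "trail2 G h1 vs es h2 \<longleftrightarrow>
     h1 \<in> hlines G \<and> h2 \<in> hlines G \<and> h1 \<noteq> h2 \<and>
     length vs = Suc (length es) \<and> set es \<subseteq> edges G - hlines G \<and> distinct es \<and>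
     src G h1 = hd vs \<and> src G h2 = last vs \<and>
     (\<forall>i<length es. {src G (es ! i), tgt G (es ! i)} = {vs ! i, vs ! Suc i})"

text \<open>Assumption (H): every point of G (every vertex and every point of every edge)
  lies on a trail containing two halflines.\<close>
definition assumption_H :: "('v, 'e) mgraph \<Rightarrow> bool" where
  "assumption_H G \<longleftrightarrow>
     (\<forall>e\<in>edges G. \<exists>h1 vs es h2. trail2 G h1 vs es h2 \<and> e \<in> insert h1 (insert h2 (set es))) \<and>
     (\<forall>v\<in>verts G. \<exists>h1 vs es h2. trail2 G h1 vs es h2 \<and> v \<in> set vs)"

text \<open>The interval an edge is identified with.\<close>
definition edom :: "('v, 'e) mgraph \<Rightarrow> 'e \<Rightarrow> real set" where
  "edom G e = (if e \<in> hlines G then {0..} else {0..len G e})"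

text \<open>H^1 on an edge, with (continuous representative) f and weak derivative g:
  f, g \<in> L^2 and f(x) = f(0) + \<integral>_0^x g.\<close>
definition edge_H1 :: "('v, 'e) mgraph \<Rightarrow> 'e \<Rightarrow> (real \<Rightarrow> real) \<Rightarrow> (real \<Rightarrow> real) \<Rightarrow> bool" where
  "edge_H1 G e f g \<longleftrightarrow>
     set_borel_measurable lborel (edom G e) g \<and>
     set_integrable lborel (edom G e) (\<lambda>x. (g x)\<^sup>2) \<and>
     set_integrable lborel (edom G e) (\<lambda>x. (f x)\<^sup>2) \<and>
     (\<forall>x\<in>edom G e. f x = f 0 + (LINT t:{0..x}|lborel. g t))"

text \<open>u \<in> H^1(G) with derivative g: H^1 on each edge and continuous at vertices.\<close>
definition H1 :: "('v, 'e) mgraph \<Rightarrow> ('e \<Rightarrow> real \<Rightarrow> real) \<Rightarrow> ('e \<Rightarrow> real \<Rightarrow> real) \<Rightarrow> bool" where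
  "H1 G u g \<longleftrightarrow> (\<forall>e\<in>edges G. edge_H1 G e (u e) (g e)) \<and>
     (\<exists>\<phi>. \<forall>e\<in>edges G. u e 0 = \<phi> (src G e) \<and>
                        (e \<notin> hlines G \<longrightarrow> u e (len G e) = \<phi> (tgt G e)))"

definition gint :: "('v, 'e) mgraph \<Rightarrow> ('e \<Rightarrow> real \<Rightarrow> real) \<Rightarrow> real" where
  "gint G f = (\<Sum>e\<in>edges G. LINT x:edom G e|lborel. f e x)"

definition mass :: "('v, 'e) mgraph \<Rightarrow> ('e \<Rightarrow> real \<Rightarrow> real) \<Rightarrow> real" where
  "mass G u = gint G (\<lambda>e x. (u e x)\<^sup>2)"

definition kin :: "('v, 'e) mgraph \<Rightarrow> ('e \<Rightarrow> real \<Rightarrow> real) \<Rightarrow> real" where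
  "kin G g = gint G (\<lambda>e x. (g e x)\<^sup>2)"

definition L6 :: "('v, 'e) mgraph \<Rightarrow> ('e \<Rightarrow> real \<Rightarrow> real) \<Rightarrow> real" where
  "L6 G u = gint G (\<lambda>e x. (u e x) ^ 6)"

text \<open>Critical NLS energy E(u,G) = 1/2 \<parallel>u'\<parallel>_2^2 - 1/6 \<parallel>u\<parallel>_6^6.\<close>
definition energy :: "('v, 'e) mgraph \<Rightarrow> ('e \<Rightarrow> real \<Rightarrow> real) \<Rightarrow> ('e \<Rightarrow> real \<Rightarrow> real) \<Rightarrow> real" where
  "energy G u g = kin G g / 2 - L6 G u / 6"

definition H1_mass :: "('v, 'e) mgraph \<Rightarrow> real \<Rightarrow> (('e \<Rightarrow> real \<Rightarrow> real) \<times> ('e \<Rightarrow> real \<Rightarrow> real)) set" where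
  "H1_mass G \<mu> = {(u, g). H1 G u g \<and> mass G u = \<mu>}"

text \<open>Ground state energy level, possibly -\<infinity>.\<close>
definition Elev :: "('v, 'e) mgraph \<Rightarrow> real \<Rightarrow> ereal" where
  "Elev G \<mu> = (INF p\<in>H1_mass G \<mu>. ereal (energy G (fst p) (snd p)))"

definition attained :: "('v, 'e) mgraph \<Rightarrow> real \<Rightarrow> bool" where
  "attained G \<mu> \<longleftrightarrow> (\<exists>p\<in>H1_mass G \<mu>. ereal (energy G (fst p) (snd p)) = Elev G \<mu>)"

text \<open>Gagliardo--Nirenberg constant K_G and critical mass \<mu>_G = sqrt(3/K_G).\<close>
definition KG :: "('v, 'e) mgraph \<Rightarrow> ereal" where
  "KG G = (SUP p\<in>{(u, g). H1 G u g \<and> (\<exists>e\<in>edges G. \<exists>x\<in>edom G e. u e x \<noteq> 0)}.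
             ereal (L6 G (fst p) / ((mass G (fst p))\<^sup>2 * kin G (snd p))))"

definition mu_crit :: "('v, 'e) mgraph \<Rightarrow> real" where
  "mu_crit G = sqrt (3 / real_of_ereal (KG G))"

definition mu_R :: real where
  "mu_R = pi * sqrt 3 / 2"

end

theory Submission
  imports Defs "HOL-Complex_Analysis.Great_Picard"
begin

text \<open>
  The key is a calibration. Let \<open>\<theta>' = \<kappa> u\<^sup>2\<close> along an edge, with \<open>\<theta>\<close> in \<open>(0, \<pi>)\<close>. Expanding the square
  \<open>(u' - (\<kappa>/2) cot \<theta> u\<^sup>3)\<^sup>2 \<ge> 0\<close> gives
  \<open>u'\<^sup>2 - (\<kappa>\<^sup>2/4) u\<^sup>6 \<ge> ((\<kappa>/4) cot \<theta> u\<^sup>4)'\<close>. For \<open>\<kappa> = 2/\<surd>3\<close> the left-hand side is twice the energy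
  density, and the mass \<open>\<mu>\<^sub>R\<close> corresponds exactly to the phase \<open>\<pi>\<close>.

  On a halfline carrying mass \<open>m < \<mu>\<^sub>R\<close> with boundary value \<open>a\<close> the energy is therefore at least
  \<open>(\<kappa>/8) cot (\<kappa> m) a\<^sup>4\<close>, and a piece of soliton attains this value. At a vertex with at least two
  incident edge ends, whose phases sum to at most \<open>\<pi>\<close>, the cotangents sum to a nonnegative number. Cutting
  every bounded edge inside a piece of small mass, this gives \<open>2E \<ge> (\<tau>/\<mu>\<^sub>R) \<parallel>u'\<parallel>\<^sup>2 - C \<surd>\<tau>\<close>, where
  \<open>\<tau>\<close> is the mass outside the cut-out stars plus \<open>\<mu>\<^sub>R - \<mu>\<close>: sequences of negative energy that do not
  tend to zero are bounded in \<open>H\<^sup>1\<close>.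

  Hence a minimizing sequence converges uniformly on the compact core (Arzela--Ascoli), and on each
  halfline it can be replaced by the soliton tail with the limiting mass and boundary value; a loss of
  mass is harmless because scaling up a function of negative energy decreases the energy. At
  \<open>\<mu> = \<mu>\<^sub>G\<close> one takes functions of negative energy with masses decreasing to \<open>\<mu>\<^sub>G\<close>; their limit is not
  zero, since two halflines and total mass below \<open>\<mu>\<^sub>R\<close> force a nonnegative energy once the function is
  small on the core.
\<close>

section \<open>Absolutely continuous functions\<close>

text \<open>The delicate case is mass close to \<open>mu_R\<close>, where the phases have almost no
  room. Then k^2/4 = l/3 with l >= 1 + \<open>\<tau>\<close>/mu_R, so a multiple l - 1 of the
  kinetic energy is left over, and E <= 0 gives l E <= E. Bounded edges must be cut because an uncut
  calibration contributes cotangents of pi - th and th + k m at its two ends. These phases sum to pi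
  + k m, which leaves nothing for the rest of the graph. After a cut, each end of an edge carries
  only the phase of its own piece plus a padding \<open>eta\<close>, and the price is about f^4/eta
  at the cut points. The padding can only be proportional to \<open>\<tau>\<close>, while the mass r
  discarded between the cuts is at most \<open>\<tau>\<close>. An error of order sqrt
  \<open>\<tau>\<close> therefore requires f^4 = O(r^(3/2)) at the cuts, which is the origin of the
  exponent 3/4 and of the fourth roots in the choice of cut points.\<close>

definition ac_on :: "real \<Rightarrow> real \<Rightarrow> (real \<Rightarrow> real) \<Rightarrow> (real \<Rightarrow> real) \<Rightarrow> bool" where
  "ac_on a b F p \<longleftrightarrow> set_integrable lborel {a..b} p \<and> (\<forall>x\<in>{a..b}. F x = F a + integral {a..x} p)"

lemma ac_on_set_integrable: "ac_on a b F p \<Longrightarrow> set_integrable lborel {a..b} p"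
  unfolding ac_on_def by (rule conjunct1)

lemma ac_on_set_integrable': "ac_on a b F p \<Longrightarrow> x \<le> b \<Longrightarrow> set_integrable lborel {a..x} p"
  by (rule set_integrable_subset[OF ac_on_set_integrable]) auto

lemma ac_on_eq: "ac_on a b F p \<Longrightarrow> a \<le> x \<Longrightarrow> x \<le> b \<Longrightarrow> integral {a..x} p = F x - F a"
  using bspec[OF conjunct2[OF ac_on_def[THEN iffD1]], of a b F p x] by simp

lemma ac_on_integrable:
  assumes "ac_on a b F p"
  shows "p integrable_on {a..b}"
  by (rule set_borel_integral_eq_integral(1)[OF ac_on_set_integrable[OF assms]])

lemma ac_on_diff:
  assumes "ac_on a b F p" "a \<le> x" "x \<le> y" "y \<le> b"
  shows "F y - F x = integral {x..y} p"
proof -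
  have "integral {a..x} p + integral {x..y} p = integral {a..y} p"
    by (rule Henstock_Kurzweil_Integration.integral_combine)
      (use assms(2-4) integrable_on_subinterval[OF ac_on_integrable[OF assms(1)]] in auto)
  then show ?thesis
    using assms(2-4) ac_on_eq[OF assms(1), of x] ac_on_eq[OF assms(1), of y] by simp
qed

lemma ac_on_subinterval:
  assumes "ac_on a b F p" "a \<le> c" "d \<le> b"
  shows "ac_on c d F p"
proof -
  have "set_integrable lborel {c..d} p"
    using assms(2,3) by (intro set_integrable_subset[OF ac_on_set_integrable[OF assms(1)]]) auto
  moreover have "F x = F c + integral {c..x} p" if "x \<in> {c..d}" for x
    using ac_on_diff[OF assms(1), of c x] that assms(2,3) by simp
  ultimately show ?thesis
    unfolding ac_on_def by (intro conjI ballI)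
qed

lemma ac_on_continuous:
  assumes "ac_on a b F p"
  shows "continuous_on {a..b} F"
proof -
  have "continuous_on {a..b} (\<lambda>x. F a + integral {a..x} p)"
    by (intro continuous_intros indefinite_integral_continuous_1 ac_on_integrable[OF assms])
  then show ?thesis
    by (rule continuous_on_eq) (simp add: ac_on_eq[OF assms])
qed

lemma ac_on_C1:
  assumes "\<And>x. x \<in> {a..b} \<Longrightarrow> (c has_real_derivative c' x) (at x within {a..b})"
    and "continuous_on {a..b} c'"
  shows "ac_on a b c c'"
  unfolding ac_on_def
proof (intro conjI ballI)
  show "set_integrable lborel {a..b} c'"
    by (rule borel_integrable_atLeastAtMost'[OF assms(2)])
  fix x assume x: "x \<in> {a..b}"
  have "(c' has_integral (c x - c a)) {a..x}"
  proof (rule fundamental_theorem_of_calculus)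
    fix y assume "y \<in> {a..x}"
    then show "(c has_vector_derivative c' y) (at y within {a..x})"
      using x DERIV_subset[OF assms(1)[of y], of "{a..x}"]
      by (simp add: has_real_derivative_iff_has_vector_derivative)
  qed (use x in auto)
  then show "c x = c a + integral {a..x} c'"
    by (simp add: integral_unique)
qed

lemma set_integrable_mult_continuous:
  fixes p F :: "real \<Rightarrow> real"
  assumes "set_integrable lborel {a..b} p" "continuous_on {a..b} F"
  shows "set_integrable lborel {a..b} (\<lambda>x. p x * F x)"
proof -
  have "compact (F ` {a..b})" using assms(2) compact_continuous_image by blast
  then obtain B where B: "\<And>x. x \<in> {a..b} \<Longrightarrow> \<bar>F x\<bar> \<le> B"
    by (metis (mono_tags) bounded_iff compact_imp_bounded imageI real_norm_def)
  have m: "set_borel_measurable lborel {a..b} F"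
    using borel_measurable_continuous_on_indicator[OF _ assms(2)] unfolding set_borel_measurable_def by simp
  have "set_integrable lborel {a..b} (\<lambda>x. B * p x)" using assms(1) by simp
  moreover have "set_borel_measurable lborel {a..b} (\<lambda>x. p x * F x)"
  proof -
    have "(\<lambda>x. (indicator {a..b} x *\<^sub>R p x) * (indicator {a..b} x *\<^sub>R F x)) \<in> borel_measurable lborel"
      using m assms(1) unfolding set_borel_measurable_def set_integrable_def by (intro borel_measurable_times) auto
    also have "(\<lambda>x. (indicator {a..b} x *\<^sub>R p x) * (indicator {a..b} x *\<^sub>R F x)) =
               (\<lambda>x. indicator {a..b} x *\<^sub>R (p x * F x))"
      by (auto simp: indicator_def)
    finally show ?thesis unfolding set_borel_measurable_def .
  qed
  ultimately show ?thesis
  proof (rule set_integrable_bound)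
    show "AE x in lborel. x \<in> {a..b} \<longrightarrow> norm (p x * F x) \<le> norm (B * p x)"
    proof (intro always_eventually allI impI)
      fix x assume "x \<in> {a..b}"
      then have "\<bar>F x\<bar> \<le> \<bar>B\<bar>" using B by fastforce
      then show "norm (p x * F x) \<le> norm (B * p x)"
        by (simp add: abs_mult mult.commute mult_right_mono)
    qed
  qed
qed

text \<open>Fubini on the square: the integral of p(s) q(t) over [a,b]^2 is (F b - F a)(G b - G a).
  Cutting the square along the diagonal s = t turns it into the integrals of q (F - F a) and p (G -
  G a). Pointwise differentiability never enters.\<close>

lemma integral_product_rule:
  assumes F: "ac_on a b F p" and G: "ac_on a b G q" and ab: "a \<le> b"
  shows "F b * G b - F a * G a = integral {a..b} (\<lambda>x. p x * G x + q x * F x)"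
proof -
  define P where "P s = indicator {a..b} s * p s" for s
  define Q where "Q s = indicator {a..b} s * q s" for s
  have iP: "integrable lborel P" and iQ: "integrable lborel Q"
    using F[THEN ac_on_set_integrable] G[THEN ac_on_set_integrable] unfolding set_integrable_def P_def Q_def by auto
  have [measurable]: "P \<in> borel_measurable borel" "Q \<in> borel_measurable borel"
    using iP iQ by (auto dest: borel_measurable_integrable)
  have iPQ: "integrable (lborel \<Otimes>\<^sub>M lborel) (\<lambda>(s,t). P s * Q t)"
  proof (rule lborel_pair.Fubini_integrable)
    show "(\<lambda>(s, t). P s * Q t) \<in> borel_measurable (lborel \<Otimes>\<^sub>M lborel)" by measurable
  qed (use iP iQ in \<open>auto simp: abs_mult\<close>)
  define I1 where "I1 = (\<lambda>(s::real,t::real). if s \<le> t then P s * Q t else 0)"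
  define I2 where "I2 = (\<lambda>(s::real,t::real). if s \<le> t then 0 else P s * Q t)"
  have i1: "integrable (lborel \<Otimes>\<^sub>M lborel) I1"
    by (rule Bochner_Integration.integrable_bound[OF iPQ]) (auto simp: I1_def)
  have i2: "integrable (lborel \<Otimes>\<^sub>M lborel) I2"
    by (rule Bochner_Integration.integrable_bound[OF iPQ]) (auto simp: I2_def)
  have P_part: "(\<integral>s. (if s \<le> t then P s else 0) \<partial>lborel) = F t - F a" if "t \<in> {a..b}" for t
  proof -
    have "(\<integral>s. (if s \<le> t then P s else 0) \<partial>lborel) = (LINT s:{a..t}|lborel. p s)"
      unfolding set_lebesgue_integral_def by (rule Bochner_Integration.integral_cong) (use that in \<open>auto simp: P_def indicator_def\<close>)
    also have "\<dots> = integral {a..t} p"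
      by (rule set_borel_integral_eq_integral(2)) (use that in \<open>auto intro: ac_on_set_integrable'[OF F]\<close>)
    finally show ?thesis using ac_on_eq[OF F] that by auto
  qed
  have Q_part: "(\<integral>t. (if s \<le> t then 0 else Q t) \<partial>lborel) = G s - G a" if "s \<in> {a..b}" for s
  proof -
    have "(\<integral>t. (if s \<le> t then 0 else Q t) \<partial>lborel) = (LINT t:{a..s}|lborel. q t)"
      unfolding set_lebesgue_integral_def
    proof (rule integral_cong_AE)
      have "AE t in lborel. t \<noteq> s" by (rule AE_lborel_singleton)
      then show "AE t in lborel. (if s \<le> t then 0 else Q t) = indicator {a..s} t *\<^sub>R q t"
        by eventually_elim (use that in \<open>auto simp: Q_def indicator_def\<close>)
      have "set_integrable lborel {a..s} q" using that by (auto intro: ac_on_set_integrable'[OF G])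
      then show "(\<lambda>t. indicator {a..s} t *\<^sub>R q t) \<in> borel_measurable lborel" by (auto simp: set_integrable_def)
    qed measurable
    also have "\<dots> = integral {a..s} q"
      by (rule set_borel_integral_eq_integral(2)) (use that in \<open>auto intro: ac_on_set_integrable'[OF G]\<close>)
    finally show ?thesis using ac_on_eq[OF G] that by auto
  qed
  have cF: "continuous_on {a..b} F" and cG: "continuous_on {a..b} G"
    using F G ac_on_continuous by auto
  have sF: "set_integrable lborel {a..b} (\<lambda>x. q x * (F x - F a))"
    and sG: "set_integrable lborel {a..b} (\<lambda>x. p x * (G x - G a))"
    using cF cG by (auto intro!: set_integrable_mult_continuous continuous_intros ac_on_set_integrable[OF F] ac_on_set_integrable[OF G])
  have "integral\<^sup>L (lborel \<Otimes>\<^sub>M lborel) I1 = (\<integral>t. (\<integral>s. I1 (s,t) \<partial>lborel) \<partial>lborel)"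
    using lborel_pair.integral_snd[of "\<lambda>s t. I1 (s,t)"] i1 by simp
  also have "\<dots> = (LINT t:{a..b}|lborel. q t * (F t - F a))"
    unfolding set_lebesgue_integral_def
  proof (rule Bochner_Integration.integral_cong)
    fix t
    have "(\<integral>s. I1 (s,t) \<partial>lborel) = (\<integral>s. Q t * (if s \<le> t then P s else 0) \<partial>lborel)"
      by (rule Bochner_Integration.integral_cong) (auto simp: I1_def)
    then show "(\<integral>s. I1 (s,t) \<partial>lborel) = indicator {a..b} t *\<^sub>R (q t * (F t - F a))"
      using P_part[of t] by (auto simp: Q_def indicator_def)
  qed auto
  also have "\<dots> = integral {a..b} (\<lambda>t. q t * (F t - F a))"
    by (rule set_borel_integral_eq_integral(2)[OF sF])
  finally have e1: "integral\<^sup>L (lborel \<Otimes>\<^sub>M lborel) I1 = \<dots>" .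
  have "integral\<^sup>L (lborel \<Otimes>\<^sub>M lborel) I2 = (\<integral>s. (\<integral>t. I2 (s,t) \<partial>lborel) \<partial>lborel)"
    using lborel_pair.integral_fst[of "\<lambda>s t. I2 (s,t)"] i2 by simp
  also have "\<dots> = (LINT s:{a..b}|lborel. p s * (G s - G a))"
    unfolding set_lebesgue_integral_def
  proof (rule Bochner_Integration.integral_cong)
    fix s
    have "(\<integral>t. I2 (s,t) \<partial>lborel) = (\<integral>t. P s * (if s \<le> t then 0 else Q t) \<partial>lborel)"
      by (rule Bochner_Integration.integral_cong) (auto simp: I2_def)
    then show "(\<integral>t. I2 (s,t) \<partial>lborel) = indicator {a..b} s *\<^sub>R (p s * (G s - G a))"
      using Q_part[of s] by (auto simp: P_def indicator_def)
  qed auto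
  also have "\<dots> = integral {a..b} (\<lambda>t. p t * (G t - G a))"
    by (rule set_borel_integral_eq_integral(2)[OF sG])
  finally have e2: "integral\<^sup>L (lborel \<Otimes>\<^sub>M lborel) I2 = \<dots>" .
  have "integral\<^sup>L (lborel \<Otimes>\<^sub>M lborel) I1 + integral\<^sup>L (lborel \<Otimes>\<^sub>M lborel) I2 =
        integral\<^sup>L (lborel \<Otimes>\<^sub>M lborel) (\<lambda>x. I1 x + I2 x)"
    using i1 i2 by simp
  also have "\<dots> = integral\<^sup>L (lborel \<Otimes>\<^sub>M lborel) (\<lambda>(s,t). P s * Q t)"
    by (rule Bochner_Integration.integral_cong) (auto simp: I1_def I2_def)
  also have "\<dots> = (\<integral>s. (\<integral>t. P s * Q t \<partial>lborel) \<partial>lborel)"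
    using lborel_pair.integral_fst[OF iPQ] by simp
  also have "\<dots> = (\<integral>s. P s \<partial>lborel) * (\<integral>t. Q t \<partial>lborel)"
    by simp
  also have "(\<integral>s. P s \<partial>lborel) = F b - F a"
  proof -
    have "(\<integral>s. P s \<partial>lborel) = (\<integral>s. (if s \<le> b then P s else 0) \<partial>lborel)"
      by (rule Bochner_Integration.integral_cong) (auto simp: P_def indicator_def)
    then show ?thesis using P_part[of b] ab by simp
  qed
  also have "(\<integral>t. Q t \<partial>lborel) = G b - G a"
  proof -
    have "(\<integral>s. Q s \<partial>lborel) = (LINT t:{a..b}|lborel. q t)"
      unfolding set_lebesgue_integral_def by (simp add: Q_def)
    also have "\<dots> = integral {a..b} q"
      by (rule set_borel_integral_eq_integral(2)) (rule ac_on_set_integrable[OF G])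
    finally show ?thesis using ac_on_eq[OF G] ab by auto
  qed
  finally have *: "integral {a..b} (\<lambda>t. q t * (F t - F a)) + integral {a..b} (\<lambda>t. p t * (G t - G a))
      = (F b - F a) * (G b - G a)"
    using e1 e2 by simp
  have ip: "p integrable_on {a..b}" and iq: "q integrable_on {a..b}"
    using F G ac_on_integrable by auto
  have "integral {a..b} (\<lambda>x. p x * G x + q x * F x) =
     integral {a..b} (\<lambda>x. (q x * (F x - F a) + p x * (G x - G a)) + (F a * q x + G a * p x))"
    by (rule integral_cong) (simp add: algebra_simps)
  also have "\<dots> = (F b - F a) * (G b - G a) + (F a * integral {a..b} q + G a * integral {a..b} p)"
    using * set_borel_integral_eq_integral(1)[OF sF] set_borel_integral_eq_integral(1)[OF sG] ip iq
    by (simp add: integral_add integrable_add integrable_on_mult_right)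
  also have "\<dots> = F b * G b - F a * G a"
    unfolding ac_on_eq[OF F ab order_refl] ac_on_eq[OF G ab order_refl] by (simp add: algebra_simps)
  finally show ?thesis by simp
qed

lemma ac_on_mult:
  assumes F: "ac_on a b F p" and G: "ac_on a b G q"
  shows "ac_on a b (\<lambda>x. F x * G x) (\<lambda>x. p x * G x + q x * F x)"
proof -
  have "set_integrable lborel {a..b} (\<lambda>x. p x * G x + q x * F x)"
    using set_integrable_mult_continuous[OF ac_on_set_integrable[OF F] ac_on_continuous[OF G]]
      set_integrable_mult_continuous[OF ac_on_set_integrable[OF G] ac_on_continuous[OF F]]
    by (rule set_integral_add(1))
  moreover have "F x * G x = F a * G a + integral {a..x} (\<lambda>x. p x * G x + q x * F x)" if x: "x \<in> {a..b}" for x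
  proof -
    from x have "ac_on a x F p" "ac_on a x G q"
      using ac_on_subinterval[OF F, of a x] ac_on_subinterval[OF G, of a x] by auto
    from integral_product_rule[OF this] x show ?thesis
      by (simp add: algebra_simps)
  qed
  ultimately show ?thesis
    unfolding ac_on_def by (intro conjI ballI)
qed

section \<open>The calibration\<close>

lemma cot_diff_eq:
  fixes x y :: real
  assumes "sin x \<noteq> 0" "sin y \<noteq> 0"
  shows "cot x - cot y = sin (y - x) / (sin x * sin y)"
  using assms by (simp add: cot_def sin_diff field_simps)

lemma cot_antimono:
  fixes x y :: real
  assumes "0 < x" "x \<le> y" "y < pi"
  shows "cot y \<le> cot x"
proof -
  have "0 < sin x" "0 < sin y" "0 \<le> sin (y - x)"
    using assms by (auto intro!: sin_gt_zero sin_ge_zero)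
  then have "0 \<le> sin (y - x) / (sin x * sin y)" by simp
  then show ?thesis
    using cot_diff_eq[of x y] \<open>0 < sin x\<close> \<open>0 < sin y\<close> by simp
qed

lemma cot_pi_minus: "cot (pi - x) = - cot (x::real)"
  by (simp add: cot_def)

lemma cot_add_cot_nonneg:
  fixes x y :: real
  assumes "0 < x" "0 < y" "x + y \<le> pi"
  shows "0 \<le> cot x + cot y"
  using cot_antimono[of x "pi - y"] assms by (simp add: cot_pi_minus)

lemma cot_nonneg: "0 < x \<Longrightarrow> x \<le> pi / 2 \<Longrightarrow> 0 \<le> cot (x::real)"
  using cot_add_cot_nonneg[of x x] by simp

lemma cot_le_inverse:
  fixes x :: real
  assumes "0 < x" "x < pi"
  shows "cot x \<le> 1 / x"
proof -
  \<comment> \<open>sin t - t cos t vanishes at 0 and has derivative t sin t, nonnegative on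
    [0, pi]; hence x cos x <= sin x.\<close>
  have "sin 0 - 0 * cos 0 \<le> sin x - x * cos x"
  proof (rule DERIV_nonneg_imp_nondecreasing[where f = "\<lambda>t. sin t - t * cos t"])
    fix t assume "0 \<le> t" "t \<le> x"
    then have "0 \<le> t * sin t" using assms by (intro mult_nonneg_nonneg sin_ge_zero) auto
    moreover have "((\<lambda>t. sin t - t * cos t) has_real_derivative t * sin t) (at t)"
      by (auto intro!: derivative_eq_intros)
    ultimately show "\<exists>y. ((\<lambda>t. sin t - t * cos t) has_real_derivative y) (at t) \<and> 0 \<le> y" by blast
  qed (use assms in auto)
  moreover have "0 < sin x" using assms by (intro sin_gt_zero) auto
  ultimately show ?thesis using assms by (simp add: cot_def field_simps)
qed

text \<open>The perfect-square argument, integrated. The parameter \<open>k\<close> stays free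
  because coercivity uses it slightly above \<open>om\<close>, and the initial phase
  \<open>th\<close> stays free so that pieces of an edge can start wherever the cut
  requires.\<close>

lemma calibration:
  assumes f: "ac_on a b f g" and g2: "(\<lambda>x. (g x)\<^sup>2) integrable_on {a..b}" and ab: "a \<le> b"
    and k: "0 \<le> k" and th: "0 < th" "th + k * integral {a..b} (\<lambda>x. (f x)\<^sup>2) < pi"
  shows "k / 4 * (cot (th + k * integral {a..b} (\<lambda>x. (f x)\<^sup>2)) * f b ^ 4 - cot th * f a ^ 4)
    \<le> integral {a..b} (\<lambda>x. (g x)\<^sup>2) - k\<^sup>2 / 4 * integral {a..b} (\<lambda>x. f x ^ 6)"
proof -
  define T where "T x = th + k * integral {a..x} (\<lambda>x. (f x)\<^sup>2)" for x
  have cf: "continuous_on {a..b} f" using ac_on_continuous[OF f] .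
  have if2: "(\<lambda>x. (f x)\<^sup>2) integrable_on {a..b}"
    using cf by (intro integrable_continuous_real continuous_intros)
  have dT: "(T has_real_derivative k * (f x)\<^sup>2) (at x within {a..b})" if "x \<in> {a..b}" for x
    unfolding T_def using that cf
    by (auto intro!: derivative_eq_intros integral_has_real_derivative continuous_intros)
  have T_bounds: "0 < T x" "T x < pi" if "x \<in> {a..b}" for x
  proof -
    have "0 \<le> integral {a..x} (\<lambda>x. (f x)\<^sup>2)" by (rule integral_nonneg) (use that if2 in \<open>auto intro: integrable_on_subinterval\<close>)
    then show "0 < T x" using k th(1) by (simp add: T_def add_pos_nonneg)
    have "integral {a..x} (\<lambda>x. (f x)\<^sup>2) \<le> integral {a..b} (\<lambda>x. (f x)\<^sup>2)"
      by (rule integral_subset_le) (use that if2 in \<open>auto intro: integrable_on_subinterval\<close>)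
    then show "T x < pi" using k th(2) mult_left_mono[OF _ k] unfolding T_def by fastforce
  qed
  have sT: "0 < sin (T x)" if "x \<in> {a..b}" for x using T_bounds[OF that] sin_gt_zero by blast
  have cT: "continuous_on {a..b} T"
    using dT by (meson DERIV_continuous_on)
  define c' where "c' x = - inverse ((sin (T x))\<^sup>2) * (k * (f x)\<^sup>2)" for x
  have c: "ac_on a b (\<lambda>x. cot (T x)) c'"
  proof (rule ac_on_C1)
    fix x assume x: "x \<in> {a..b}"
    show "((\<lambda>x. cot (T x)) has_real_derivative c' x) (at x within {a..b})"
      unfolding c'_def using DERIV_chain2[OF DERIV_cot dT[OF x]] sT[OF x] by simp
  next
    show "continuous_on {a..b} c'"
      unfolding c'_def by (intro continuous_intros cT cf) (use sT in force)
  qed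
  note f2 = ac_on_mult[OF f f]
  note f4 = ac_on_mult[OF f2 f2]
  note cf4 = ac_on_mult[OF c f4]
  \<comment> \<open>\<open>?h\<close> is the weak derivative of cot(T) f^4, with f^4 formed as (f
    f)(f f).\<close>
  let ?h = "\<lambda>x. c' x * (f x * f x * (f x * f x)) +
             ((g x * f x + g x * f x) * (f x * f x) + (g x * f x + g x * f x) * (f x * f x)) * cot (T x)"
  have "k / 4 * (cot (T b) * f b ^ 4 - cot (T a) * f a ^ 4) = k / 4 * integral {a..b} ?h"
    unfolding ac_on_eq[OF cf4 ab order_refl] by (simp add: power4_eq_xxxx algebra_simps)
  also have "\<dots> = integral {a..b} (\<lambda>x. k / 4 * ?h x)" by simp
  also have "\<dots> \<le> integral {a..b} (\<lambda>x. (g x)\<^sup>2 - k\<^sup>2 / 4 * f x ^ 6)"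
  proof (rule integral_le)
    show "(\<lambda>x. k / 4 * ?h x) integrable_on {a..b}"
      using ac_on_integrable[OF cf4] by (rule integrable_on_mult_right)
    show "(\<lambda>x. (g x)\<^sup>2 - k\<^sup>2 / 4 * f x ^ 6) integrable_on {a..b}"
      by (rule integrable_diff[OF g2]) (use cf in \<open>intro integrable_continuous_real continuous_intros\<close>)
    fix x assume x: "x \<in> {a..b}"
    define C where "C = cot (T x)"
    \<comment> \<open>With 1/sin^2 = 1 + cot^2 the difference of the two integrands becomes exactly
      the square of g - (k/2) C f^3.\<close>
    have C: "inverse ((sin (T x))\<^sup>2) = 1 + C\<^sup>2"
    proof -
      have "(sin (T x))\<^sup>2 + (cos (T x))\<^sup>2 = 1" by simp
      then show ?thesis unfolding C_def cot_def using sT[OF x]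
        by (simp add: power_divide divide_simps)
    qed
    have "(g x)\<^sup>2 - k\<^sup>2 / 4 * f x ^ 6 - k / 4 * ?h x = (g x - k / 2 * C * f x ^ 3)\<^sup>2"
      unfolding c'_def C C_def[symmetric] by (simp add: power2_eq_square eval_nat_numeral algebra_simps)
    then show "k / 4 * ?h x \<le> (g x)\<^sup>2 - k\<^sup>2 / 4 * f x ^ 6"
      by (smt (verit) zero_le_power2)
  qed
  also have "\<dots> = integral {a..b} (\<lambda>x. (g x)\<^sup>2) - k\<^sup>2 / 4 * integral {a..b} (\<lambda>x. f x ^ 6)"
    using g2 cf by (subst integral_diff) (auto intro!: integrable_continuous_real continuous_intros)
  finally show ?thesis by (simp add: T_def)
qed

lemma integral_Cauchy_Schwarz:
  fixes f g :: "real \<Rightarrow> real"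
  assumes f: "(\<lambda>x. (f x)\<^sup>2) integrable_on S" and g: "(\<lambda>x. (g x)\<^sup>2) integrable_on S"
    and fg: "(\<lambda>x. f x * g x) integrable_on S"
  shows "(integral S (\<lambda>x. f x * g x))\<^sup>2 \<le> integral S (\<lambda>x. (f x)\<^sup>2) * integral S (\<lambda>x. (g x)\<^sup>2)"
proof -
  define A B C where "A = integral S (\<lambda>x. (f x)\<^sup>2)" and "B = integral S (\<lambda>x. (g x)\<^sup>2)"
    and "C = integral S (\<lambda>x. f x * g x)"
  have q: "0 \<le> A * s\<^sup>2 + 2 * s * C + B" for s
  proof -
    have "0 \<le> integral S (\<lambda>x. s\<^sup>2 * (f x)\<^sup>2 + (2 * s) * (f x * g x) + (g x)\<^sup>2)"
    proof (rule integral_nonneg)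
      show "(\<lambda>x. s\<^sup>2 * (f x)\<^sup>2 + (2 * s) * (f x * g x) + (g x)\<^sup>2) integrable_on S"
        using f g fg by (intro integrable_add integrable_on_mult_right)
      fix x
      have "s\<^sup>2 * (f x)\<^sup>2 + (2 * s) * (f x * g x) + (g x)\<^sup>2 = (s * f x + g x)\<^sup>2" by (simp add: power2_eq_square algebra_simps)
      then show "0 \<le> s\<^sup>2 * (f x)\<^sup>2 + (2 * s) * (f x * g x) + (g x)\<^sup>2" by simp
    qed
    also have "\<dots> = s\<^sup>2 * A + (2 * s) * C + B"
      using f g fg unfolding A_def B_def C_def by (simp add: integral_add integrable_add integrable_on_mult_right)
    finally show ?thesis by (simp add: mult.commute)
  qed
  have A: "0 \<le> A" unfolding A_def using f by (intro integral_nonneg) auto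
  have B: "0 \<le> B" unfolding B_def using g by (intro integral_nonneg) auto
  have "C\<^sup>2 \<le> A * B"
  proof (cases "A = 0")
    case True
    have "C = 0"
    proof (rule ccontr)
      assume "C \<noteq> 0"
      \<comment> \<open>For \<open>A = 0\<close> the quadratic degenerates to B + 2 s C, and this
        \<open>s\<close> gives the value -1.\<close>
      then show False using q[of "- (B + 1) / (2 * C)"] True by (simp add: field_simps)
    qed
    then show ?thesis using True by simp
  next
    case False
    have "0 \<le> A * (A * (- C / A)\<^sup>2 + 2 * (- C / A) * C + B)"
      using q[of "- C / A"] A by simp
    also have "\<dots> = A * B - C\<^sup>2" using False by (simp add: field_simps power2_eq_square)
    finally show ?thesis by simp
  qed
  then show ?thesis by (simp add: A_def B_def C_def)
qed

section \<open>Sobolev functions on intervals and halflines\<close>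

text \<open>The content of \<open>edge_H1\<close> for a bare interval, so that the analysis on one
  edge can be done without a graph; \<open>edge_H1_iff\<close> makes the link.\<close>

definition H1_on :: "real set \<Rightarrow> (real \<Rightarrow> real) \<Rightarrow> (real \<Rightarrow> real) \<Rightarrow> bool" where
  "H1_on S f g \<longleftrightarrow>
     set_borel_measurable lborel S g \<and>
     set_integrable lborel S (\<lambda>x. (g x)\<^sup>2) \<and>
     set_integrable lborel S (\<lambda>x. (f x)\<^sup>2) \<and>
     (\<forall>x\<in>S. f x = f 0 + (LINT t:{0..x}|lborel. g t))"

lemma H1_onD:
  assumes "H1_on S f g"
  shows "set_borel_measurable lborel S g" "set_integrable lborel S (\<lambda>x. (g x)\<^sup>2)"
    "set_integrable lborel S (\<lambda>x. (f x)\<^sup>2)" "x \<in> S \<Longrightarrow> f x - f 0 = (LINT t:{0..x}|lborel. g t)"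
  using assms unfolding H1_on_def by (blast, blast, blast, simp)

lemma set_borel_measurable_power:
  assumes "set_borel_measurable M A g"
  shows "set_borel_measurable M A (\<lambda>x. (g x :: real) ^ Suc n)"
proof -
  have "(\<lambda>x. (indicator A x *\<^sub>R g x) ^ Suc n) \<in> borel_measurable M"
    using assms unfolding set_borel_measurable_def by measurable
  also have "(\<lambda>x. (indicator A x *\<^sub>R g x) ^ Suc n) = (\<lambda>x. indicator A x *\<^sub>R g x ^ Suc n)"
    by (auto simp: indicator_def)
  finally show ?thesis unfolding set_borel_measurable_def .
qed

lemma set_integrable_of_square:
  fixes g :: "real \<Rightarrow> real"
  assumes "set_borel_measurable lborel {a..b} g" "set_integrable lborel {a..b} (\<lambda>x. (g x)\<^sup>2)"
  shows "set_integrable lborel {a..b} g"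
proof (rule set_integrable_bound)
  have "set_integrable lborel {a..b} (\<lambda>x. 1::real)"
    by (rule borel_integrable_atLeastAtMost') simp
  then show "set_integrable lborel {a..b} (\<lambda>x. 1 + (g x)\<^sup>2)"
    using assms(2) by (rule set_integral_add(1))
  have "\<bar>y\<bar> \<le> 1 + y\<^sup>2" for y :: real
  proof -
    have "0 \<le> (\<bar>y\<bar> - 1)\<^sup>2" by simp
    then have "2 * \<bar>y\<bar> \<le> 1 + y\<^sup>2" by (simp add: power2_diff)
    then show ?thesis by linarith
  qed
  then have "norm (g x) \<le> norm (1 + (g x)\<^sup>2)" for x by (simp add: abs_of_nonneg)
  then show "AE x in lborel. x \<in> {a..b} \<longrightarrow> norm (g x) \<le> norm (1 + (g x)\<^sup>2)" by simp
qed (use assms in auto)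

lemma set_borel_measurable_lborel_subset:
  fixes g :: "real \<Rightarrow> real"
  assumes "set_borel_measurable lborel S g" "T \<subseteq> S" "T \<in> sets lborel"
  shows "set_borel_measurable lborel T g"
proof -
  have "(\<lambda>x. indicator T x * (indicator S x *\<^sub>R g x)) \<in> borel_measurable lborel"
    using assms(1,3) unfolding set_borel_measurable_def by measurable
  also have "(\<lambda>x. indicator T x * (indicator S x *\<^sub>R g x)) = (\<lambda>x. indicator T x *\<^sub>R g x)"
    using assms(2) by (auto simp: indicator_def fun_eq_iff)
  finally show ?thesis unfolding set_borel_measurable_def .
qed

lemma H1_on_ac:
  assumes "H1_on S f g" "{0..b} \<subseteq> S"
  shows "ac_on 0 b f g"
proof -
  have *: "set_integrable lborel {0..b} g"
  proof (rule set_integrable_of_square)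
    show "set_borel_measurable lborel {0..b} g"
      by (rule set_borel_measurable_lborel_subset[OF H1_onD(1)[OF assms(1)] assms(2)]) simp
    show "set_integrable lborel {0..b} (\<lambda>x. (g x)\<^sup>2)"
      by (rule set_integrable_subset[OF H1_onD(2)[OF assms(1)] _ assms(2)]) simp
  qed
  moreover have "f x = f 0 + integral {0..x} g" if x: "x \<in> {0..b}" for x
  proof -
    have "(LINT t:{0..x}|lborel. g t) = integral {0..x} g"
      by (rule set_borel_integral_eq_integral(2), rule set_integrable_subset[OF *]) (use x in auto)
    then show ?thesis using H1_onD(4)[OF assms(1), of x] x assms(2) by auto
  qed
  ultimately show ?thesis unfolding ac_on_def by (intro conjI ballI)
qed

lemma H1_on_square_integrable:
  assumes "H1_on S f g"
  shows "(\<lambda>x. (g x)\<^sup>2) integrable_on S" "(\<lambda>x. (f x)\<^sup>2) integrable_on S"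
  using set_borel_integral_eq_integral(1)[OF H1_onD(2)[OF assms]]
    set_borel_integral_eq_integral(1)[OF H1_onD(3)[OF assms]] by auto

lemma integral_mono_set:
  fixes f :: "real \<Rightarrow> real"
  assumes "f integrable_on S" "f integrable_on T" "S \<subseteq> T" "\<And>x. 0 \<le> f x"
  shows "integral S f \<le> integral T f"
  by (rule integral_subset_le) (use assms in auto)

text \<open>Cauchy-Schwarz applied to (f^2)' = 2 f f'. No interval length enters, so the bound
  survives the passage to halflines.\<close>

lemma square_diff_bound:
  assumes f: "ac_on a b f g" and g2: "(\<lambda>x. (g x)\<^sup>2) integrable_on {a..b}"
    and xy: "a \<le> x" "x \<le> y" "y \<le> b"
  shows "\<bar>(f y)\<^sup>2 - (f x)\<^sup>2\<bar> \<le> 2 * sqrt (integral {a..b} (\<lambda>x. (f x)\<^sup>2) * integral {a..b} (\<lambda>x. (g x)\<^sup>2))"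
proof -
  have sub: "{x..y} \<subseteq> {a..b}" using xy by auto
  have cf: "continuous_on {a..b} f" using ac_on_continuous[OF f] .
  have f2: "(\<lambda>x. (f x)\<^sup>2) integrable_on {a..b}"
    using cf by (intro integrable_continuous_real continuous_intros)
  have ff: "ac_on a b (\<lambda>x. f x * f x) (\<lambda>x. g x * f x + g x * f x)" by (rule ac_on_mult[OF f f])
  have gf: "(\<lambda>x. g x * f x) integrable_on {x..y}"
    by (rule integrable_on_subinterval[OF set_borel_integral_eq_integral(1)[OF set_integrable_mult_continuous[OF ac_on_set_integrable[OF f] cf]] sub])
  have "(f y)\<^sup>2 - (f x)\<^sup>2 = 2 * integral {x..y} (\<lambda>x. g x * f x)"
    unfolding power2_eq_square ac_on_diff[OF ff xy] integral_add[OF gf gf] by simp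
  then have "\<bar>(f y)\<^sup>2 - (f x)\<^sup>2\<bar> = 2 * sqrt ((integral {x..y} (\<lambda>x. g x * f x))\<^sup>2)" by simp
  also have "\<dots> \<le> 2 * sqrt (integral {x..y} (\<lambda>x. (g x)\<^sup>2) * integral {x..y} (\<lambda>x. (f x)\<^sup>2))"
    using integral_Cauchy_Schwarz[OF integrable_on_subinterval[OF g2 sub] integrable_on_subinterval[OF f2 sub] gf]
    by (intro mult_left_mono real_sqrt_le_mono) auto
  also have "\<dots> \<le> 2 * sqrt (integral {a..b} (\<lambda>x. (g x)\<^sup>2) * integral {a..b} (\<lambda>x. (f x)\<^sup>2))"
    using integrable_on_subinterval[OF g2 sub] integrable_on_subinterval[OF f2 sub] g2 f2 sub
    by (intro mult_left_mono real_sqrt_le_mono mult_mono integral_mono_set integral_nonneg) auto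
  finally show ?thesis by (simp add: mult.commute)
qed

text \<open>Cauchy-Schwarz against the constant 1: Hoelder continuity of exponent 1/2. It yields
  equicontinuity on bounded edges and the oscillation bound on the core.\<close>

lemma ac_diff_bound:
  assumes f: "ac_on a b f g" and g2: "(\<lambda>x. (g x)\<^sup>2) integrable_on {a..b}"
    and xy: "a \<le> x" "x \<le> y" "y \<le> b"
  shows "\<bar>f y - f x\<bar> \<le> sqrt ((y - x) * integral {a..b} (\<lambda>x. (g x)\<^sup>2))"
proof -
  have sub: "{x..y} \<subseteq> {a..b}" using xy by auto
  have ig: "(\<lambda>x. 1 * g x) integrable_on {x..y}"
    using integrable_on_subinterval[OF ac_on_integrable[OF f] sub] by simp
  have "\<bar>f y - f x\<bar> = sqrt ((integral {x..y} (\<lambda>x. 1 * g x))\<^sup>2)"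
    using ac_on_diff[OF f xy] by simp
  also have "\<dots> \<le> sqrt (integral {x..y} (\<lambda>x. 1\<^sup>2) * integral {x..y} (\<lambda>x. (g x)\<^sup>2))"
    by (rule real_sqrt_le_mono, rule integral_Cauchy_Schwarz[OF _ integrable_on_subinterval[OF g2 sub] ig]) auto
  also have "\<dots> \<le> sqrt ((y - x) * integral {a..b} (\<lambda>x. (g x)\<^sup>2))"
    using xy integrable_on_subinterval[OF g2 sub] g2 sub
    by (intro real_sqrt_le_mono mult_mono integral_mono_set integral_nonneg) auto
  finally show ?thesis .
qed

text \<open>At some point f^2 does not exceed its mean; \<open>square_diff_bound\<close> reaches all
  others from there.\<close>

lemma interval_sup_bound:
  assumes f: "ac_on 0 L f g" and g2: "(\<lambda>x. (g x)\<^sup>2) integrable_on {0..L}"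
    and L: "0 < L" and x: "x \<in> {0..L}"
  shows "(f x)\<^sup>2 \<le> integral {0..L} (\<lambda>x. (f x)\<^sup>2) / L +
     2 * sqrt (integral {0..L} (\<lambda>x. (f x)\<^sup>2) * integral {0..L} (\<lambda>x. (g x)\<^sup>2))"
proof -
  have cf: "continuous_on {0..L} f" using ac_on_continuous[OF f] .
  have f2: "(\<lambda>x. (f x)\<^sup>2) integrable_on {0..L}"
    using cf by (intro integrable_continuous_real continuous_intros)
  have "\<exists>y\<in>{0..L}. (f y)\<^sup>2 \<le> integral {0..L} (\<lambda>x. (f x)\<^sup>2) / L"
  proof (rule ccontr)
    assume "\<not> ?thesis"
    then have gt: "integral {0..L} (\<lambda>x. (f x)\<^sup>2) / L < (f y)\<^sup>2" if "y \<in> {0..L}" for y using that by (meson not_le)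
    obtain y0 where y0: "y0 \<in> {0..L}" "\<And>y. y \<in> {0..L} \<Longrightarrow> (f y0)\<^sup>2 \<le> (f y)\<^sup>2"
      using continuous_attains_inf[of "{0..L}" "\<lambda>x. (f x)\<^sup>2"] cf L by (force intro!: continuous_intros)
    have "L * (f y0)\<^sup>2 = integral {0..L} (\<lambda>x. (f y0)\<^sup>2)" using L by simp
    also have "\<dots> \<le> integral {0..L} (\<lambda>x. (f x)\<^sup>2)"
      using y0 f2 by (intro integral_le) auto
    finally show False using gt[OF y0(1)] L by (simp add: field_simps)
  qed
  then obtain y where y: "y \<in> {0..L}" "(f y)\<^sup>2 \<le> integral {0..L} (\<lambda>x. (f x)\<^sup>2) / L" by blast
  have "\<bar>(f x)\<^sup>2 - (f y)\<^sup>2\<bar> \<le> 2 * sqrt (integral {0..L} (\<lambda>x. (f x)\<^sup>2) * integral {0..L} (\<lambda>x. (g x)\<^sup>2))"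
    using square_diff_bound[OF f g2, of x y] square_diff_bound[OF f g2, of y x] x y
    by (cases "x \<le> y") (auto simp: abs_minus_commute)
  then show ?thesis using y(2) by linarith
qed

lemma halfline_small_values:
  assumes H: "H1_on {0..} f g" and e: "0 < e"
  shows "\<exists>b\<ge>c. (f b)\<^sup>2 \<le> e"
proof (rule ccontr)
  assume "\<not> ?thesis"
  then have gt: "e < (f b)\<^sup>2" if "c \<le> b" for b using that by auto
  let ?A = "integral {0..} (\<lambda>x. (f x)\<^sup>2)"
  define c0 where "c0 = max c 0"
  \<comment> \<open>If f^2 stayed above \<open>e\<close> on [c0, d], the mass there would be at
    least ?A + e, more than the total.\<close>
  define d where "d = c0 + ?A / e + 1"
  have A0: "0 \<le> ?A" by (rule integral_nonneg) (use H1_on_square_integrable[OF H] in auto)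
  have cd: "c0 \<le> d" using A0 e by (simp add: d_def)
  have i: "(\<lambda>x. (f x)\<^sup>2) integrable_on {c0..d}"
    by (rule integrable_on_subinterval[OF H1_on_square_integrable(2)[OF H]]) (auto simp: c0_def)
  have "(d - c0) * e = integral {c0..d} (\<lambda>x. e)" using cd by simp
  also have "\<dots> \<le> integral {c0..d} (\<lambda>x. (f x)\<^sup>2)"
    by (rule integral_le) (use i gt in \<open>auto simp: c0_def intro: less_imp_le\<close>)
  also have "\<dots> \<le> ?A"
    by (rule integral_mono_set[OF i H1_on_square_integrable(2)[OF H]]) (auto simp: c0_def)
  finally have "(d - c0) * e \<le> ?A" .
  moreover have "(d - c0) * e = ?A + e" using e by (simp add: d_def distrib_right)
  ultimately show False using e by simp
qed

text \<open>Comparing with a far point where f is arbitrarily small gives f^2 <= 2 ||f||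
  ||f'||.\<close>

lemma halfline_sup_bound:
  assumes H: "H1_on {0..} f g" and x: "0 \<le> x"
  shows "f x ^ 4 \<le> 4 * (integral {0..} (\<lambda>x. (f x)\<^sup>2) * integral {0..} (\<lambda>x. (g x)\<^sup>2))"
proof -
  let ?S = "sqrt (integral {0..} (\<lambda>x. (f x)\<^sup>2) * integral {0..} (\<lambda>x. (g x)\<^sup>2))"
  note i = H1_on_square_integrable[OF H]
  have n: "0 \<le> integral {0..} (\<lambda>x. (f x)\<^sup>2)" "0 \<le> integral {0..} (\<lambda>x. (g x)\<^sup>2)"
    using i by (auto intro!: integral_nonneg)
  have "(f x)\<^sup>2 \<le> 2 * ?S + e" if e: "0 < e" for e
  proof -
    obtain b where b: "x \<le> b" "(f b)\<^sup>2 \<le> e" using halfline_small_values[OF H e] by blast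
    have sub: "{0..b} \<subseteq> {0..}" by auto
    have ac: "ac_on 0 b f g" by (rule H1_on_ac[OF H sub])
    have ib: "(\<lambda>x. (g x)\<^sup>2) integrable_on {0..b}" "(\<lambda>x. (f x)\<^sup>2) integrable_on {0..b}"
      using i by (auto intro: integrable_on_subinterval)
    have "\<bar>(f b)\<^sup>2 - (f x)\<^sup>2\<bar> \<le> 2 * sqrt (integral {0..b} (\<lambda>x. (f x)\<^sup>2) * integral {0..b} (\<lambda>x. (g x)\<^sup>2))"
      using square_diff_bound[OF ac ib(1) x b(1)] by simp
    also have "\<dots> \<le> 2 * ?S"
      using ib i n by (intro mult_left_mono real_sqrt_le_mono mult_mono integral_mono_set integral_nonneg) auto
    finally show ?thesis using b(2) by linarith
  qed
  then have "(f x)\<^sup>2 \<le> 2 * ?S" by (rule field_le_epsilon)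
  then have "((f x)\<^sup>2)\<^sup>2 \<le> (2 * ?S)\<^sup>2" by (intro power_mono) auto
  then show ?thesis using n by (simp add: power_mult_distrib)
qed

lemma ac_on_all_continuous:
  assumes "\<And>b. ac_on 0 b f g"
  shows "continuous_on {0..} f"
proof -
  have "continuous (at x within {0..}) f" if "0 \<le> x" for x
  proof -
    have "continuous (at x within {0..x+1}) f"
      using ac_on_continuous[OF assms[of "x+1"]] that by (auto simp: continuous_on_eq_continuous_within)
    moreover have "at x within {0..x+1} = at x within {0..}"
      by (rule at_within_nhd[of _ "{..<x+1}"]) auto
    ultimately show ?thesis by simp
  qed
  then show ?thesis by (auto simp: continuous_on_eq_continuous_within)
qed

lemma H1_on_continuous:
  assumes "H1_on S f g" "S = {0..} \<or> S = {0..L}"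
  shows "continuous_on S f"
  using assms(2)
proof
  assume S: "S = {0..}"
  then show ?thesis using ac_on_all_continuous H1_on_ac[OF assms(1)] by auto
next
  assume "S = {0..L}"
  then show ?thesis using ac_on_continuous H1_on_ac[OF assms(1), of L] by auto
qed

lemma halfline_power6_integrable:
  assumes H: "H1_on {0..} f g"
  shows "set_integrable lborel {0..} (\<lambda>x. f x ^ 6)"
proof (rule set_integrable_bound)
  let ?B = "4 * (integral {0..} (\<lambda>x. (f x)\<^sup>2) * integral {0..} (\<lambda>x. (g x)\<^sup>2))"
  show "set_integrable lborel {0..} (\<lambda>x. ?B * (f x)\<^sup>2)" using H1_onD(3)[OF H] by simp
  have "(\<lambda>x. indicator {0..} x *\<^sub>R f x) \<in> borel_measurable lborel"
    using borel_measurable_continuous_on_indicator[OF _ H1_on_continuous[OF H]] by simp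
  then show "set_borel_measurable lborel {0..} (\<lambda>x. f x ^ 6)"
    using set_borel_measurable_power[of lborel "{0..}" f 5] by (simp add: set_borel_measurable_def)
  have "norm (f x ^ 6) \<le> norm (?B * (f x)\<^sup>2)" if "x \<in> {0..}" for x
  proof -
    have "f x ^ 6 = f x ^ 4 * (f x)\<^sup>2" by (simp flip: power_add)
    also have "\<dots> \<le> ?B * (f x)\<^sup>2" using halfline_sup_bound[OF H] that by (intro mult_right_mono) auto
    finally show ?thesis by (simp add: abs_of_nonneg)
  qed
  then show "AE x in lborel. x \<in> {0..} \<longrightarrow> norm (f x ^ 6) \<le> norm (?B * (f x)\<^sup>2)" by simp
qed

lemma le_of_le_add_mult_eps:
  fixes a b K :: real
  assumes "\<And>e. 0 < e \<Longrightarrow> a \<le> b + K * e" "0 \<le> K"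
  shows "a \<le> b"
proof (rule field_le_epsilon)
  fix e :: real assume e: "0 < e"
  have "a \<le> b + K * (e / (K + 1))" using assms(2) e by (intro assms(1)) auto
  also have "K * (e / (K + 1)) \<le> e" using assms(2) e by (simp add: field_simps)
  finally show "a \<le> b + e" by simp
qed

text \<open>Calibrate on [0, b] and let f(b) become small. The padding \<open>eta\<close> keeps the
  phase at \<open>b\<close> at most pi - eta, so the cotangent there is bounded below and its term
  disappears in the limit.\<close>

lemma halfline_calibration:
  assumes H: "H1_on {0..} f g" and k: "0 \<le> k"
    and eta: "0 < eta" "k * integral {0..} (\<lambda>x. (f x)\<^sup>2) + eta < pi"
  shows "k / 4 * (cot (k * integral {0..} (\<lambda>x. (f x)\<^sup>2) + eta) * f 0 ^ 4)
    \<le> integral {0..} (\<lambda>x. (g x)\<^sup>2) - k\<^sup>2 / 4 * integral {0..} (\<lambda>x. f x ^ 6)"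
proof -
  define A B S where "A = integral {0..} (\<lambda>x. (f x)\<^sup>2)" and "B = integral {0..} (\<lambda>x. (g x)\<^sup>2)"
    and "S = integral {0..} (\<lambda>x. f x ^ 6)"
  note i = H1_on_square_integrable[OF H]
  note i6 = halfline_power6_integrable[OF H]
  have A0: "0 \<le> A" unfolding A_def using i by (auto intro!: integral_nonneg)
  have "((\<lambda>b. LINT x:{0..b}|lborel. f x ^ 6) \<longlongrightarrow> (LINT x:{0..}|lborel. f x ^ 6)) at_top"
    by (rule tendsto_set_lebesgue_integral_at_top[OF _ i6]) auto
  moreover have "(LINT x:{0..b}|lborel. f x ^ 6) = integral {0..b} (\<lambda>x. f x ^ 6)" for b
    by (rule set_borel_integral_eq_integral(2), rule set_integrable_subset[OF i6]) auto
  ultimately have lim: "((\<lambda>b. integral {0..b} (\<lambda>x. f x ^ 6)) \<longlongrightarrow> S) at_top"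
    using set_borel_integral_eq_integral(2)[OF i6] by (simp add: S_def)
  \<comment> \<open>The two errors: the boundary term at the far end and the missing tail of the
    sixth power.\<close>
  define K where "K = k / 4 * \<bar>cot eta\<bar> + k\<^sup>2 / 4"
  have K: "0 \<le> K" using k by (simp add: K_def)
  have "k / 4 * (cot (k * A + eta) * f 0 ^ 4) \<le> B - k\<^sup>2 / 4 * S + K * e" if e: "0 < e" for e
  proof -
    have "eventually (\<lambda>b. S - e < integral {0..b} (\<lambda>x. f x ^ 6)) at_top"
      using lim e by (intro order_tendstoD(1)) auto
    then obtain c where c: "\<And>b. c \<le> b \<Longrightarrow> S - e < integral {0..b} (\<lambda>x. f x ^ 6)"
      by (auto simp: eventually_at_top_linorder)
    obtain b where b: "max c 0 \<le> b" "(f b)\<^sup>2 \<le> sqrt e"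
      using halfline_small_values[OF H, of "sqrt e" "max c 0"] e by auto
    have fb: "f b ^ 4 \<le> e"
    proof -
      have "((f b)\<^sup>2)\<^sup>2 \<le> (sqrt e)\<^sup>2" using b by (intro power_mono) auto
      then show ?thesis using e by simp
    qed
    have b0: "0 \<le> b" using b by simp
    have sub: "{0..b} \<subseteq> {0..}" by auto
    have ac: "ac_on 0 b f g" by (rule H1_on_ac[OF H sub])
    have ib: "(\<lambda>x. (g x)\<^sup>2) integrable_on {0..b}" "(\<lambda>x. (f x)\<^sup>2) integrable_on {0..b}"
      using i by (auto intro: integrable_on_subinterval)
    define m where "m = integral {0..b} (\<lambda>x. (f x)\<^sup>2)"
    have m: "0 \<le> m" "m \<le> A" unfolding m_def A_def
      using ib i by (auto intro!: integral_nonneg integral_mono_set)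
    have km: "0 \<le> k * m" "k * m \<le> k * A" using k m by (auto intro: mult_left_mono)
    \<comment> \<open>Started at this phase, the calibration ends at or below pi - eta, and by
      reflection -cot th is the cotangent wanted at 0.\<close>
    define th where "th = pi - k * A - eta"
    have th: "0 < th" "th + k * m < pi" using eta km unfolding th_def A_def[symmetric] by auto
    have "k / 4 * (cot (th + k * m) * f b ^ 4 - cot th * f 0 ^ 4)
      \<le> integral {0..b} (\<lambda>x. (g x)\<^sup>2) - k\<^sup>2 / 4 * integral {0..b} (\<lambda>x. f x ^ 6)"
      using calibration[OF ac ib(1) b0 k, of th] th unfolding m_def by simp
    also have "\<dots> \<le> B - k\<^sup>2 / 4 * (S - e)"
      using c[of b] b ib i unfolding B_def by (intro diff_mono integral_mono_set mult_left_mono) auto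
    finally have *: "k / 4 * (cot (th + k * m) * f b ^ 4 - cot th * f 0 ^ 4) \<le> B - k\<^sup>2 / 4 * (S - e)" .
    have cth: "cot th = - cot (k * A + eta)"
      using cot_pi_minus[of "k * A + eta"] by (simp add: th_def algebra_simps)
    have "cot (pi - eta) \<le> cot (th + k * m)"
      using th km eta by (intro cot_antimono) (auto simp: th_def)
    then have "- \<bar>cot eta\<bar> \<le> cot (th + k * m)" by (simp add: cot_pi_minus)
    then have "- \<bar>cot eta\<bar> * f b ^ 4 \<le> cot (th + k * m) * f b ^ 4" by (rule mult_right_mono) simp
    moreover have "\<bar>cot eta\<bar> * f b ^ 4 \<le> \<bar>cot eta\<bar> * e" using fb by (intro mult_left_mono) auto
    ultimately have "- \<bar>cot eta\<bar> * e + cot (k * A + eta) * f 0 ^ 4 \<le> cot (th + k * m) * f b ^ 4 - cot th * f 0 ^ 4"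
      by (simp add: cth)
    then have "k / 4 * (- \<bar>cot eta\<bar> * e + cot (k * A + eta) * f 0 ^ 4) \<le> B - k\<^sup>2 / 4 * (S - e)"
      using * mult_left_mono[of _ _ "k / 4"] k by (smt (verit) divide_nonneg_nonneg)
    then show ?thesis unfolding K_def by (simp add: field_simps)
  qed
  then have "k / 4 * (cot (k * A + eta) * f 0 ^ 4) \<le> B - k\<^sup>2 / 4 * S"
    using K by (rule le_of_le_add_mult_eps)
  then show ?thesis by (simp add: A_def B_def S_def)
qed

section \<open>Soliton tails\<close>

definition om :: real where "om = 2 / sqrt 3"

lemma om_pos: "0 < om" by (simp add: om_def)
lemma om_square: "om\<^sup>2 = 4 / 3" by (simp add: om_def power_divide)
lemma om_mu_R: "om * mu_R = pi" by (simp add: om_def mu_R_def)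
lemma mu_R_pos: "0 < mu_R" by (simp add: mu_R_def)
text \<open>A crude bound that suffices: 16 = (64/L * (L/8) / 4)^4 is the mass allowed by the search
  for cut points in an interval of length L/8.\<close>

lemma mu_R_less_16: "mu_R < 16"
proof -
  have "pi * sqrt 3 < 4 * 2"
    using pi_less_4 by (intro mult_strict_mono) (auto intro: real_less_lsqrt)
  then show ?thesis by (simp add: mu_R_def)
qed

lemma halfline_FTC:
  fixes \<phi> F :: "real \<Rightarrow> real"
  assumes "continuous_on UNIV \<phi>" "\<And>x. 0 \<le> x \<Longrightarrow> (F has_real_derivative \<phi> x) (at x)"
    and nn: "\<And>x. 0 \<le> x \<Longrightarrow> 0 \<le> \<phi> x" and lim: "(F \<longlongrightarrow> T) at_top"
  shows "set_integrable lborel {0..} \<phi>" "integral {0..} \<phi> = T - F 0"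
proof -
  have [measurable]: "\<phi> \<in> borel_measurable borel"
    using assms(1) by (rule borel_measurable_continuous_onI)
  have nn_int: "(\<integral>\<^sup>+x. ennreal (\<phi> x) * indicator {0..} x \<partial>lborel) = T - F 0"
    by (rule nn_integral_FTC_atLeast) (use assms in auto)
  have TF: "F 0 \<le> T"
  proof (rule tendsto_lowerbound[OF lim])
    have "F 0 \<le> F x" if "0 \<le> x" for x
      by (rule DERIV_nonneg_imp_nondecreasing[OF that]) (use assms nn in blast)
    then show "eventually (\<lambda>x. F 0 \<le> F x) at_top"
      by (auto simp: eventually_at_top_linorder)
  qed simp
  have eq: "(\<integral>\<^sup>+x. ennreal (indicator {0..} x *\<^sub>R \<phi> x) \<partial>lborel) = T - F 0"
  proof -
    have "(\<integral>\<^sup>+x. ennreal (indicator {0..} x *\<^sub>R \<phi> x) \<partial>lborel) = (\<integral>\<^sup>+x. ennreal (\<phi> x) * indicator {0..} x \<partial>lborel)"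
      by (rule nn_integral_cong) (auto simp: indicator_def)
    then show ?thesis using nn_int by simp
  qed
  have "has_bochner_integral lborel (\<lambda>x. indicator {0..} x *\<^sub>R \<phi> x) (T - F 0)"
    by (rule has_bochner_integral_nn_integral) (use eq TF nn in \<open>auto simp: indicator_def\<close>)
  then show i: "set_integrable lborel {0..} \<phi>"
    unfolding set_integrable_def by (auto simp: has_bochner_integral_iff)
  show "integral {0..} \<phi> = T - F 0"
    using \<open>has_bochner_integral lborel (\<lambda>x. indicator {0..} x *\<^sub>R \<phi> x) (T - F 0)\<close>
      set_borel_integral_eq_integral(2)[OF i] by (simp add: set_lebesgue_integral_def has_bochner_integral_iff)
qed

lemma H1_on_C1:
  assumes "S = {0..} \<or> S = {0..L}"
    and "\<And>x. 0 \<le> x \<Longrightarrow> (f has_real_derivative g x) (at x)" "continuous_on UNIV g"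
    and "set_integrable lborel S (\<lambda>x. (g x)\<^sup>2)" "set_integrable lborel S (\<lambda>x. (f x)\<^sup>2)"
  shows "H1_on S f g"
  unfolding H1_on_def
proof (intro conjI ballI)
  have "g \<in> borel_measurable borel" using assms(3) by (rule borel_measurable_continuous_onI)
  moreover have "S \<in> sets borel" using assms(1) by auto
  ultimately show "set_borel_measurable lborel S g"
    unfolding set_borel_measurable_def by measurable
  fix x assume "x \<in> S"
  then have x: "0 \<le> x" using assms(1) by auto
  have ac: "ac_on 0 x f g"
    by (rule ac_on_C1) (use assms(2) continuous_on_subset[OF assms(3)] in \<open>auto intro: has_field_derivative_at_within\<close>)
  show "f x = f 0 + (LINT t:{0..x}|lborel. g t)"
    using ac_on_eq[OF ac x order_refl] set_borel_integral_eq_integral(2)[OF ac_on_set_integrable[OF ac]] by simp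
qed (use assms in auto)

text \<open>The equality case of the calibration: f^2 = A / cosh(k x + y0) with k = om A.
  Prescribing boundary value and mass fixes A and y0. For om m > pi/2 the shift y0 is negative, and
  the peak of the soliton lies inside the halfline.\<close>

lemma soliton_tail:
  assumes a: "a \<noteq> 0" and m: "0 < m" "m < mu_R"
  shows "\<exists>f g. H1_on {0..} f g \<and> f 0 = a \<and> integral {0..} (\<lambda>x. (f x)\<^sup>2) = m \<and>
    integral {0..} (\<lambda>x. (g x)\<^sup>2) - 1 / 3 * integral {0..} (\<lambda>x. f x ^ 6) = om / 4 * (cot (om * m) * a ^ 4)"
proof -
  have omm: "0 < om * m" "om * m < pi" using m om_pos om_mu_R mult_strict_left_mono[OF m(2) om_pos] by auto
  then have sin0: "0 < sin (om * m)" by (intro sin_gt_zero)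
  \<comment> \<open>Chosen with y0 below so that cosh y0 = 1/sin(om m), whence f(0)^2 = a^2, while
    pi/2 - arctan(sinh y0) = om m gives the mass.\<close>
  define A where "A = a\<^sup>2 / sin (om * m)"
  have A: "0 < A" using a sin0 by (simp add: A_def)
  define k where "k = om * A"
  have k: "0 < k" using A om_pos by (simp add: k_def)
  define y0 where "y0 = arsinh (cot (om * m))"
  have sh0: "sinh y0 = cot (om * m)" by (simp add: y0_def)
  have ch0: "cosh y0 = 1 / sin (om * m)"
  proof -
    have "(cosh y0)\<^sup>2 = 1 + (cot (om * m))\<^sup>2" using sh0 by (simp add: cosh_square_eq)
    also have "\<dots> = (1 / sin (om * m))\<^sup>2"
    proof -
      have "(sin (om * m))\<^sup>2 + (cos (om * m))\<^sup>2 = 1" by simp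
      then show ?thesis using sin0 by (simp add: cot_def power_divide divide_simps)
    qed
    finally show ?thesis using sin0 by (simp add: power2_eq_iff_nonneg)
  qed
  have at0: "arctan (sinh y0) = pi / 2 - om * m"
  proof -
    have "sinh y0 = tan (pi / 2 - om * m)" using sh0 by (simp add: tan_cot')
    then show ?thesis using omm by (simp add: arctan_tan)
  qed
  define y where "y x = k * x + y0" for x
  have dy: "(y has_real_derivative k) (at x)" for x
    unfolding y_def by (auto intro!: derivative_eq_intros)
  have cy: "continuous_on UNIV y" unfolding y_def by (intro continuous_intros)
  have ylim: "filterlim y at_top at_top"
    unfolding y_def using k by (auto intro!: filterlim_tendsto_add_at_top filterlim_tendsto_pos_mult_at_top filterlim_ident simp: add.commute)
  have c0: "0 < cosh (t::real)" for t by (rule cosh_real_pos)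
  define f where "f x = sgn a * sqrt (A / cosh (y x))" for x
  define g where "g x = - (k / 2) * (sinh (y x) / cosh (y x)) * f x" for x
  have f2: "(f x)\<^sup>2 = A / cosh (y x)" for x
    using a A c0[of "y x"] by (simp add: f_def power_mult_distrib sgn_if less_imp_le)
  have f6: "f x ^ 6 = A ^ 3 / cosh (y x) ^ 3" for x
  proof -
    have "f x ^ 6 = ((f x)\<^sup>2) ^ 3" by (simp flip: power_mult)
    then show ?thesis by (simp add: f2 power_divide)
  qed
  have shc: "(sinh t)\<^sup>2 = (cosh t)\<^sup>2 - 1" for t :: real by (simp add: cosh_square_eq)
  have g2: "(g x)\<^sup>2 = k\<^sup>2 * A / 4 * (1 / cosh (y x) - 1 / cosh (y x) ^ 3)" for x
  proof -
    have "(g x)\<^sup>2 = k\<^sup>2 / 4 * ((sinh (y x))\<^sup>2 / (cosh (y x))\<^sup>2) * (A / cosh (y x))"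
      by (simp add: g_def power_mult_distrib power_divide f2)
    also have "\<dots> = k\<^sup>2 * A / 4 * (1 / cosh (y x) - 1 / cosh (y x) ^ 3)"
      unfolding shc using c0[of "y x"] by (simp add: field_simps power2_eq_square power3_eq_cube)
    finally show ?thesis .
  qed
  have df: "(f has_real_derivative g x) (at x)" for x
  proof -
    have "((\<lambda>x. A / cosh (y x)) has_real_derivative (- (A * (sinh (y x) * k)) / (cosh (y x))\<^sup>2)) (at x)"
      using c0[of "y x"] by (auto intro!: derivative_eq_intros dy simp: power2_eq_square)
    then have "(f has_real_derivative sgn a * (- (A * (sinh (y x) * k)) / (cosh (y x))\<^sup>2 / (2 * sqrt (A / cosh (y x))))) (at x)"
      unfolding f_def using A c0[of "y x"]
      by (intro DERIV_cmult DERIV_chain2[OF DERIV_real_sqrt, THEN DERIV_cong]) (auto simp: field_simps)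
    moreover have "sgn a * (- (A * (sinh (y x) * k)) / (cosh (y x))\<^sup>2 / (2 * sqrt (A / cosh (y x)))) = g x"
    proof -
      have pos: "0 < A / cosh (y x)" using A c0 by simp
      then have s: "sqrt (A / cosh (y x)) * sqrt (A / cosh (y x)) = A / cosh (y x)" using A by (simp del: real_sqrt_mult_self add: real_sqrt_mult_self[of "A / cosh (y x)"])
      have s0: "0 < sqrt (A / cosh (y x))" using pos by simp
      have "A / (cosh (y x) * sqrt (A / cosh (y x))) = sqrt (A / cosh (y x))"
        using s s0 c0[of "y x"] by (simp add: field_simps)
      then have "sgn a * (- (k / 2) * (sinh (y x) / cosh (y x)) * (A / (cosh (y x) * sqrt (A / cosh (y x))))) = g x"
        by (simp add: g_def f_def)
      then show ?thesis by (simp add: power2_eq_square field_simps)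
    qed
    ultimately show ?thesis by simp
  qed
  have cg: "continuous_on UNIV g"
    unfolding g_def f_def using c0 A by (intro continuous_intros cy) (auto simp: less_imp_neq[symmetric])
  have limat: "((\<lambda>x. arctan (sinh (y x))) \<longlongrightarrow> pi / 2) at_top"
    by (rule filterlim_compose[OF tendsto_arctan_at_top filterlim_compose[OF sinh_real_at_top ylim]])
  have limq: "((\<lambda>x. sinh (y x) / (cosh (y x))\<^sup>2) \<longlongrightarrow> 0) at_top"
  proof (rule Lim_null_comparison)
    have "\<bar>sinh t\<bar> \<le> cosh t" for t :: real
      using abs_le_square_iff[of "sinh t" "cosh t"] c0[of t] by (simp add: shc)
    then have "norm (sinh (y x) / (cosh (y x))\<^sup>2) \<le> inverse (cosh (y x))" for x
      using c0[of "y x"] by (simp add: field_simps power2_eq_square)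
    then show "eventually (\<lambda>x. norm (sinh (y x) / (cosh (y x))\<^sup>2) \<le> inverse (cosh (y x))) at_top" by simp
    show "((\<lambda>x. inverse (cosh (y x))) \<longlongrightarrow> 0) at_top"
      by (rule tendsto_inverse_0_at_top[OF filterlim_compose[OF cosh_real_at_top ylim]])
  qed
  \<comment> \<open>Every integral needed is a combination of two primitives: arctan(sinh y) for
    1/cosh and sinh/cosh^2 for 2/cosh^3 - 1/cosh.\<close>
  have d1: "((\<lambda>x. arctan (sinh (y x))) has_real_derivative (k / cosh (y x))) (at x)" for x
  proof -
    have "1 + (sinh (y x))\<^sup>2 = (cosh (y x))\<^sup>2" by (simp add: shc)
    then have "inverse (1 + (sinh (y x))\<^sup>2) * (cosh (y x) * k) = k / cosh (y x)"
      using c0[of "y x"] by (simp add: field_simps power2_eq_square)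
    then show ?thesis by (auto intro!: derivative_eq_intros dy)
  qed
  have d2: "((\<lambda>x. sinh (y x) / (cosh (y x))\<^sup>2) has_real_derivative (k * (2 / cosh (y x) ^ 3 - 1 / cosh (y x)))) (at x)" for x
  proof -
    define c s where "c = cosh (y x)" and "s = sinh (y x)"
    have s: "s * s = c * c - 1" using shc[of "y x"] by (simp add: c_def s_def power2_eq_square)
    have c: "c \<noteq> 0" using c0[of "y x"] by (simp add: c_def)
    have "((\<lambda>x. sinh (y x) / (cosh (y x))\<^sup>2) has_real_derivative
        (c * k * c\<^sup>2 - s * (2 * c * (s * k))) / (c\<^sup>2 * c\<^sup>2)) (at x)"
      unfolding c_def s_def using c0[of "y x"]
      by (auto intro!: derivative_eq_intros dy)
    also have "(c * k * c\<^sup>2 - s * (2 * c * (s * k))) = c * k * (c * c - 2 * (s * s))"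
      by (simp add: algebra_simps power2_eq_square)
    also have "\<dots> / (c\<^sup>2 * c\<^sup>2) = k * (2 / c ^ 3 - 1 / c)"
      unfolding s using c by (simp add: field_simps power2_eq_square power3_eq_cube)
    finally show ?thesis by (simp add: c_def)
  qed
  have i2: "set_integrable lborel {0..} (\<lambda>x. (f x)\<^sup>2)" "integral {0..} (\<lambda>x. (f x)\<^sup>2) = A / k * (pi / 2) - A / k * arctan (sinh (y 0))"
  proof -
    have p: "continuous_on UNIV (\<lambda>x. (f x)\<^sup>2)" unfolding f2 using c0 by (intro continuous_intros cy) (auto simp: less_imp_neq[symmetric])
    have q: "((\<lambda>x. A / k * arctan (sinh (y x))) has_real_derivative (f x)\<^sup>2) (at x)" for x
      using DERIV_cmult[OF d1, of "A / k" x] k unfolding f2 by simp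
    have r: "((\<lambda>x. A / k * arctan (sinh (y x))) \<longlongrightarrow> A / k * (pi / 2)) at_top"
      by (intro tendsto_intros limat)
    show "set_integrable lborel {0..} (\<lambda>x. (f x)\<^sup>2)" "integral {0..} (\<lambda>x. (f x)\<^sup>2) = A / k * (pi / 2) - A / k * arctan (sinh (y 0))"
      using halfline_FTC[OF p q _ r] by auto
  qed
  have i6: "integral {0..} (\<lambda>x. f x ^ 6) = A ^ 3 / (2 * k) * (pi / 2 + 0) - A ^ 3 / (2 * k) * (arctan (sinh (y 0)) + sinh (y 0) / (cosh (y 0))\<^sup>2)"
  proof -
    have p: "continuous_on UNIV (\<lambda>x. f x ^ 6)" unfolding f6 using c0 by (intro continuous_intros cy) (auto simp: less_imp_neq[symmetric])
    have q: "((\<lambda>x. A ^ 3 / (2 * k) * (arctan (sinh (y x)) + sinh (y x) / (cosh (y x))\<^sup>2)) has_real_derivative f x ^ 6) (at x)" for x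
      using DERIV_cmult[OF DERIV_add[OF d1 d2], of "A ^ 3 / (2 * k)" x] k unfolding f6 by (simp add: field_simps)
    have r: "((\<lambda>x. A ^ 3 / (2 * k) * (arctan (sinh (y x)) + sinh (y x) / (cosh (y x))\<^sup>2)) \<longlongrightarrow> A ^ 3 / (2 * k) * (pi / 2 + 0)) at_top"
      by (intro tendsto_intros limat limq)
    show ?thesis using halfline_FTC(2)[OF p q _ r] by simp
  qed
  have ig: "set_integrable lborel {0..} (\<lambda>x. (g x)\<^sup>2)"
    "integral {0..} (\<lambda>x. (g x)\<^sup>2) = k * A / 8 * (pi / 2 - 0) - k * A / 8 * (arctan (sinh (y 0)) - sinh (y 0) / (cosh (y 0))\<^sup>2)"
  proof -
    have p: "continuous_on UNIV (\<lambda>x. (g x)\<^sup>2)" using cg by (intro continuous_intros)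
    have q: "((\<lambda>x. k * A / 8 * (arctan (sinh (y x)) - sinh (y x) / (cosh (y x))\<^sup>2)) has_real_derivative (g x)\<^sup>2) (at x)" for x
    proof -
      have "k * A / 8 * (k / cosh (y x) - k * (2 / cosh (y x) ^ 3 - 1 / cosh (y x))) = (g x)\<^sup>2"
        unfolding g2 by (simp add: algebra_simps power2_eq_square)
      then show ?thesis using DERIV_cmult[OF DERIV_diff[OF d1 d2], of "k * A / 8" x] by simp
    qed
    have r: "((\<lambda>x. k * A / 8 * (arctan (sinh (y x)) - sinh (y x) / (cosh (y x))\<^sup>2)) \<longlongrightarrow> k * A / 8 * (pi / 2 - 0)) at_top"
      by (intro tendsto_intros limat limq)
    show "set_integrable lborel {0..} (\<lambda>x. (g x)\<^sup>2)"
      "integral {0..} (\<lambda>x. (g x)\<^sup>2) = k * A / 8 * (pi / 2 - 0) - k * A / 8 * (arctan (sinh (y 0)) - sinh (y 0) / (cosh (y 0))\<^sup>2)"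
      using halfline_FTC[OF p q _ r] by auto
  qed
  have y_0: "y 0 = y0" by (simp add: y_def)
  have "H1_on {0..} f g" by (rule H1_on_C1[OF _ df cg ig(1) i2(1)]) simp
  moreover have "f 0 = a"
  proof -
    have "A / cosh y0 = a\<^sup>2" using sin0 by (simp add: A_def ch0)
    then show ?thesis by (simp add: f_def y_0 sgn_mult_abs)
  qed
  moreover have "integral {0..} (\<lambda>x. (f x)\<^sup>2) = m"
    unfolding i2(2) y_0 at0 using A om_pos by (simp add: k_def field_simps)
  moreover have "integral {0..} (\<lambda>x. (g x)\<^sup>2) - 1 / 3 * integral {0..} (\<lambda>x. f x ^ 6) = om / 4 * (cot (om * m) * a ^ 4)"
  proof -
    \<comment> \<open>Thanks to k^2 = 4 A^2/3 the arctan terms of the kinetic part and of one third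
      of the sixth power cancel; only the boundary term sinh/cosh^2 remains.\<close>
    have e: "A ^ 3 / (2 * k) = 3 * k * A / 8"
    proof -
      have "k * k = 4 / 3 * A\<^sup>2" using om_square by (simp add: k_def power2_eq_square algebra_simps)
      then show ?thesis using k by (simp add: field_simps power2_eq_square power3_eq_cube)
    qed
    have "integral {0..} (\<lambda>x. (g x)\<^sup>2) - 1 / 3 * integral {0..} (\<lambda>x. f x ^ 6) = k * A / 4 * (sinh y0 / (cosh y0)\<^sup>2)"
      unfolding i6 ig(2) e y_0 by (simp add: field_simps)
    also have "\<dots> = om / 4 * (cot (om * m) * a ^ 4)"
      unfolding sh0 ch0 k_def A_def using sin0 by (simp add: power_divide field_simps power2_eq_square power4_eq_xxxx)
    finally show ?thesis .
  qed
  ultimately show ?thesis by blast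
qed

section \<open>Bounded edges\<close>

text \<open>At most one phase can exceed pi/2. Paired with any other phase it contributes a
  nonnegative amount, and all remaining cotangents are nonnegative. This is where terminal points
  would do harm: a single large phase has no partner.\<close>

lemma sum_cot_nonneg:
  fixes \<beta> :: "'i \<Rightarrow> real"
  assumes fin: "finite I" and card: "card I \<noteq> 1" and pos: "\<And>i. i \<in> I \<Longrightarrow> 0 < \<beta> i"
    and sum: "(\<Sum>i\<in>I. \<beta> i) \<le> pi"
  shows "0 \<le> (\<Sum>i\<in>I. cot (\<beta> i))"
proof (cases "\<forall>i\<in>I. \<beta> i \<le> pi / 2")
  case True
  then show ?thesis using pos by (intro sum_nonneg cot_nonneg) auto
next
  case False
  then obtain j where j: "j \<in> I" "pi / 2 < \<beta> j" by force
  have "I \<noteq> {j}" using card by auto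
  then obtain l where l: "l \<in> I" "l \<noteq> j" using j by blast
  have fin': "finite (I - {j})" "finite (I - {j} - {l})" using fin by auto
  have split: "(\<Sum>i\<in>I. h i) = h j + h l + (\<Sum>i\<in>I - {j} - {l}. h i)" for h :: "'i \<Rightarrow> real"
    using sum.remove[OF fin j(1), of h] sum.remove[OF fin'(1), of l h] l by simp
  have rest: "0 \<le> (\<Sum>i\<in>I - {j} - {l}. \<beta> i)" using pos by (intro sum_nonneg) (auto intro: less_imp_le)
  have "0 \<le> cot (\<beta> j) + cot (\<beta> l)"
    using pos[OF j(1)] pos[OF l(1)] sum rest split[of \<beta>] by (intro cot_add_cot_nonneg) auto
  moreover have "0 \<le> (\<Sum>i\<in>I - {j} - {l}. cot (\<beta> i))"
  proof (intro sum_nonneg cot_nonneg)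
    fix i assume i: "i \<in> I - {j} - {l}"
    then show "0 < \<beta> i" using pos by auto
    have "\<beta> i \<le> (\<Sum>i\<in>I - {j} - {l}. \<beta> i)"
      by (rule member_le_sum[OF i]) (use pos fin' in \<open>auto intro: less_imp_le\<close>)
    then show "\<beta> i \<le> pi / 2" using sum split[of \<beta>] pos[OF l(1)] j(2) by simp
  qed
  ultimately show ?thesis using split[of "\<lambda>i. cot (\<beta> i)"] by simp
qed

text \<open>If the inequality failed everywhere, the fourth root of the running integral would grow with
  slope above \<open>C / 4\<close>, so it would exceed its final value.\<close>

lemma exists_point_below_integral_power:
  fixes \<phi> :: "real \<Rightarrow> real"
  assumes pq: "p < q" and c: "continuous_on {p..q} \<phi>"
    and phi: "\<And>x. 0 \<le> \<phi> x" and C: "0 \<le> C" "integral {p..q} \<phi> \<le> (C * (q - p) / 4) ^ 4"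
  shows "\<exists>y\<in>{p..q}. \<phi> y \<le> C * root 4 (integral {p..y} \<phi>) ^ 3"
proof (rule ccontr)
  assume "\<not> ?thesis"
  then have gt: "C * root 4 (integral {p..y} \<phi>) ^ 3 < \<phi> y" if "y \<in> {p..q}" for y
    using that by (meson not_le)
  define F where "F x = integral {p..x} \<phi>" for x
  have dF: "(F has_real_derivative \<phi> x) (at x within {p..q})" if "x \<in> {p..q}" for x
    unfolding F_def by (rule integral_has_real_derivative[OF c that])
  have dF': "(F has_real_derivative \<phi> x) (at x)" if "p < x" "x < q" for x
    using dF[of x] that by (simp add: at_within_Icc_at)
  have cF: "continuous_on {p..q} F" using dF by (meson DERIV_continuous_on)
  have F0: "F p = 0" by (simp add: F_def)
  have nn: "0 \<le> F x" if x: "x \<in> {p..q}" for x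
    unfolding F_def using x phi continuous_on_subset[OF c, of "{p..x}"]
    by (intro integral_nonneg integrable_continuous_real) auto
  have pos: "0 < \<phi> y" if "y \<in> {p..q}" for y
  proof -
    have "0 \<le> C * root 4 (F y) ^ 3" using nn[OF that] C(1) by simp
    then show ?thesis using gt[OF that] by (simp add: F_def)
  qed
  have mvt: "\<exists>z>p. z < x \<and> H x - H p = (x - p) * H' z"
    if "p < x" "x \<le> q" "continuous_on {p..q} H" "\<And>z. p < z \<Longrightarrow> z < q \<Longrightarrow> (H has_real_derivative H' z) (at z)"
    for x and H H' :: "real \<Rightarrow> real"
  proof -
    have "\<exists>l z. p < z \<and> z < x \<and> DERIV H z :> l \<and> H x - H p = (x - p) * l"
      by (rule MVT[OF that(1)])
        (use that continuous_on_subset[OF that(3), of "{p..x}"] in \<open>auto simp: real_differentiable_def intro!: exI that(4)\<close>)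
    then show ?thesis using that by (metis DERIV_unique less_le_trans)
  qed
  \<comment> \<open>The fourth root is not differentiable at 0, so its derivative may only be used
    where \<open>F\<close> is positive.\<close>
  have Fpos: "0 < F x" if "p < x" "x \<le> q" for x
  proof -
    from mvt[OF that cF dF'] obtain z where "p < z" "z < x" "F x - F p = (x - p) * \<phi> z"
      by blast
    then show ?thesis using F0 pos[of z] that by simp
  qed
  let ?G = "\<lambda>x. root 4 (F x)"
  have cG: "continuous_on {p..q} ?G" by (intro continuous_on_real_root cF)
  have dG: "(?G has_real_derivative inverse (real 4 * ?G x ^ 3) * \<phi> x) (at x)" if "p < x" "x < q" for x
    using DERIV_chain2[OF DERIV_real_root[of 4 "F x"] dF'[OF that]] Fpos[of x] that by simp
  obtain z where z: "p < z" "z < q" "?G q - ?G p = (q - p) * (inverse (real 4 * ?G z ^ 3) * \<phi> z)"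
    using mvt[OF pq order_refl cG dG] by blast
  have Gz: "0 < ?G z" using Fpos[of z] z by simp
  have "C / 4 < inverse (real 4 * ?G z ^ 3) * \<phi> z"
    using gt[of z] z Gz by (simp add: F_def field_simps)
  then have "(q - p) * (C / 4) < ?G q"
    using z pq F0 by (metis diff_gt_0_iff_gt diff_zero mult_strict_left_mono real_root_zero)
  then have "((q - p) * (C / 4)) ^ 4 < ?G q ^ 4"
    using pq C(1) by (intro power_strict_mono) auto
  then show False using C(2) nn[of q] pq by (simp add: F_def mult.commute)
qed

text \<open>Reflection x -> -x: a middle piece needs one such point on either side of its
  centre.\<close>

lemma exists_point_below_integral_power':
  fixes \<phi> :: "real \<Rightarrow> real"
  assumes pq: "p < q" and c: "continuous_on {p..q} \<phi>" and phi: "\<And>x. 0 \<le> \<phi> x"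
    and C: "0 \<le> C" "integral {p..q} \<phi> \<le> (C * (q - p) / 4) ^ 4"
  shows "\<exists>y\<in>{p..q}. \<phi> y \<le> C * root 4 (integral {y..q} \<phi>) ^ 3"
proof -
  have "continuous_on {-q..-p} (\<lambda>x. \<phi> (- x))"
    by (rule continuous_on_compose2[OF c]) (auto intro!: continuous_intros)
  moreover have "integral {-q..-p} (\<lambda>x. \<phi> (- x)) = integral {p..q} \<phi>"
    by (rule Henstock_Kurzweil_Integration.integral_reflect_real)
  ultimately obtain y where y: "y \<in> {-q..-p}" "\<phi> (- y) \<le> C * root 4 (integral {-q..y} (\<lambda>x. \<phi> (- x))) ^ 3"
    using exists_point_below_integral_power[of "-q" "-p" "\<lambda>x. \<phi> (- x)" C] pq phi C by auto
  have "integral {-q..y} (\<lambda>x. \<phi> (- x)) = integral {- y..q} \<phi>"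
    using Henstock_Kurzweil_Integration.integral_reflect_real[of q "- y" \<phi>] by simp
  then show ?thesis using y by (intro bexI[of _ "- y"]) auto
qed

text \<open>Pigeonhole over the four quarters. Mass at most mu_R/4 between the cuts keeps the phase
  gained there at most pi/2 even for k = 2 om.\<close>

lemma light_quarter:
  fixes \<phi> :: "real \<Rightarrow> real"
  assumes L: "0 < L" and i: "\<phi> integrable_on {0..L}"
  shows "\<exists>p\<ge>0. p + L / 4 \<le> L \<and> integral {p..p + L / 4} \<phi> \<le> integral {0..L} \<phi> / 4"
proof (rule ccontr)
  assume "\<not> ?thesis"
  then have gt: "integral {0..L} \<phi> / 4 < integral {p..p + L / 4} \<phi>" if "0 \<le> p" "p + L / 4 \<le> L" for p
    using that by (meson not_le)
  have comb: "integral {0..a} \<phi> + integral {a..b} \<phi> = integral {0..b} \<phi>" if "0 \<le> a" "a \<le> b" "b \<le> L" for a b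
    by (rule Henstock_Kurzweil_Integration.integral_combine) (use that i in \<open>auto intro: integrable_on_subinterval\<close>)
  show False
    using gt[of 0] gt[of "L/4"] gt[of "L/2"] gt[of "3*L/4"] comb[of "L/4" "L/2"] comb[of "L/2" "3*L/4"] comb[of "3*L/4" L] L
    by (simp add: field_simps)
qed

lemma root4_power6: "0 \<le> r \<Longrightarrow> root 4 r ^ 6 = r * sqrt r"
proof -
  assume r: "0 \<le> r"
  have "root 4 r ^ 6 = root 4 r ^ 4 * (root 4 r)\<^sup>2" by (simp flip: power_add)
  also have "(root 4 r)\<^sup>2 = sqrt r"
  proof -
    have "root 4 r = sqrt (sqrt r)" using real_root_mult_exp[of 2 2 r] by (simp add: sqrt_def)
    then show ?thesis using r by simp
  qed
  finally show ?thesis using r by simp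
qed

text \<open>The edge is cut at two points y1 <= y2 of a light quarter and three calibrations are
  added; \<open>r\<close> is the mass between the cuts. The cuts are fixed before \<open>k\<close>
  and \<open>eta\<close> are quantified: in \<open>coercivity\<close> both depend on the sum of all
  the \<open>r\<close>.\<close>

lemma interval_calibration:
  assumes f: "ac_on 0 L f g" and g2: "(\<lambda>x. (g x)\<^sup>2) integrable_on {0..L}" and L: "0 < L"
    and mass: "integral {0..L} (\<lambda>x. (f x)\<^sup>2) \<le> mu_R"
  shows "\<exists>m1 m2 r. 0 \<le> m1 \<and> 0 \<le> m2 \<and> 0 \<le> r \<and> m1 + m2 + r = integral {0..L} (\<lambda>x. (f x)\<^sup>2) \<and>
    (\<forall>k eta. 0 \<le> k \<and> k \<le> 2 * om \<and> 0 < eta \<and> k * m1 + eta < pi \<and> k * m2 + eta < pi \<longrightarrow>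
      k / 4 * (cot (k * m1 + eta) * f 0 ^ 4 + cot (k * m2 + eta) * f L ^ 4)
        - om * (64 / L)\<^sup>2 * (r * sqrt r) * (1 + 1 / eta)
      \<le> integral {0..L} (\<lambda>x. (g x)\<^sup>2) - k\<^sup>2 / 4 * integral {0..L} (\<lambda>x. f x ^ 6))"
proof -
  let ?f2 = "\<lambda>x. (f x)\<^sup>2" and ?g2 = "\<lambda>x. (g x)\<^sup>2" and ?f6 = "\<lambda>x. f x ^ 6"
  have cf: "continuous_on {0..L} f" using ac_on_continuous[OF f] .
  have cf2: "continuous_on {0..L} ?f2" using cf by (intro continuous_intros)
  have if2: "?f2 integrable_on {0..L}" using cf2 by (rule integrable_continuous_real)
  have if6: "?f6 integrable_on {0..L}" using cf by (intro integrable_continuous_real continuous_intros)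
  obtain p where p: "0 \<le> p" "p + L / 4 \<le> L" "integral {p..p + L / 4} ?f2 \<le> integral {0..L} ?f2 / 4"
    using light_quarter[OF L if2] by blast
  \<comment> \<open>The cut points are sought in [p, c] and [c, q], so the integrals over [y1, c]
    and [c, y2] that control them are both at most \<open>r\<close>.\<close>
  define c where "c = p + L / 8"
  define q where "q = p + L / 4"
  have pcq: "0 \<le> p" "p < c" "c < q" "q \<le> L" "c - p = L / 8" "q - c = L / 8" using p L by (auto simp: c_def q_def)
  \<comment> \<open>The right-hand side is 2^4 = 16 > mu_R.\<close>
  have small: "integral {a..b} ?f2 \<le> (64 / L * (L / 8) / 4) ^ 4" if "0 \<le> a" "b \<le> L" for a b
  proof -
    have "integral {a..b} ?f2 \<le> integral {0..L} ?f2"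
      using that if2 by (intro integral_mono_set) (auto intro: integrable_on_subinterval)
    then show ?thesis using mass mu_R_less_16 L by simp
  qed
  obtain y1 where y1: "y1 \<in> {p..c}" "?f2 y1 \<le> 64 / L * root 4 (integral {y1..c} ?f2) ^ 3"
    using exists_point_below_integral_power'[of p c ?f2 "64 / L"] small[of p c] pcq L continuous_on_subset[OF cf2, of "{p..c}"] by auto
  obtain y2 where y2: "y2 \<in> {c..q}" "?f2 y2 \<le> 64 / L * root 4 (integral {c..y2} ?f2) ^ 3"
    using exists_point_below_integral_power[of c q ?f2 "64 / L"] small[of c q] pcq L continuous_on_subset[OF cf2, of "{c..q}"] by auto
  have y: "0 \<le> y1" "y1 \<le> y2" "y2 \<le> L" "y1 \<le> c" "c \<le> y2" "p \<le> y1" "y2 \<le> q" using y1 y2 pcq by auto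
  define m1 r m2 where "m1 = integral {0..y1} ?f2" and "r = integral {y1..y2} ?f2" and "m2 = integral {y2..L} ?f2"
  have int_sub: "h integrable_on {a..b}" if "h integrable_on {0..L}" "0 \<le> a" "b \<le> L" for h :: "real \<Rightarrow> real" and a b
    using that by (auto intro: integrable_on_subinterval)
  have nn: "0 \<le> m1" "0 \<le> r" "0 \<le> m2" unfolding m1_def r_def m2_def
    using y int_sub[OF if2] by (auto intro!: integral_nonneg)
  have comb: "integral {0..L} h = integral {0..y1} h + integral {y1..y2} h + integral {y2..L} h"
    if "h integrable_on {0..L}" for h :: "real \<Rightarrow> real"
    using Henstock_Kurzweil_Integration.integral_combine[of 0 y1 L h]
      Henstock_Kurzweil_Integration.integral_combine[of y1 y2 L h] int_sub[OF that] that y by simp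
  have sum: "m1 + m2 + r = integral {0..L} ?f2" using comb[OF if2] by (simp add: m1_def m2_def r_def)
  have r4: "r \<le> mu_R / 4"
  proof -
    have "r \<le> integral {p..q} ?f2" unfolding r_def
      using y pcq int_sub[OF if2] by (intro integral_mono_set) auto
    then show ?thesis using p mass by (simp add: q_def)
  qed
  have bnd: "f z ^ 4 \<le> (64 / L)\<^sup>2 * (r * sqrt r)" if z: "?f2 z \<le> 64 / L * root 4 s ^ 3" "0 \<le> s" "s \<le> r" for z s
  proof -
    have "?f2 z \<le> 64 / L * root 4 r ^ 3"
      using z L by (smt (verit) divide_nonneg_nonneg mult_left_mono power_mono real_root_ge_zero real_root_le_mono zero_less_numeral)
    then have "(?f2 z)\<^sup>2 \<le> (64 / L * root 4 r ^ 3)\<^sup>2" by (intro power_mono) auto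
    also have "\<dots> = (64 / L)\<^sup>2 * root 4 r ^ 6" by (simp add: power_mult_distrib power_divide flip: power_mult)
    finally show ?thesis using root4_power6[OF nn(2)] by simp
  qed
  have b1: "f y1 ^ 4 \<le> (64 / L)\<^sup>2 * (r * sqrt r)"
    by (rule bnd[OF y1(2)]) (use y int_sub[OF if2] in \<open>auto simp: r_def intro!: integral_nonneg integral_mono_set\<close>)
  have b2: "f y2 ^ 4 \<le> (64 / L)\<^sup>2 * (r * sqrt r)"
    by (rule bnd[OF y2(2)]) (use y int_sub[OF if2] in \<open>auto simp: r_def intro!: integral_nonneg integral_mono_set\<close>)
  have main: "k / 4 * (cot (k * m1 + eta) * f 0 ^ 4 + cot (k * m2 + eta) * f L ^ 4)
        - om * (64 / L)\<^sup>2 * (r * sqrt r) * (1 + 1 / eta)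
      \<le> integral {0..L} ?g2 - k\<^sup>2 / 4 * integral {0..L} ?f6"
    if k: "0 \<le> k" "k \<le> 2 * om" and eta: "0 < eta" "k * m1 + eta < pi" "k * m2 + eta < pi" for k eta
  proof -
    define D where "D = (64 / L)\<^sup>2 * (r * sqrt r)"
    have km: "0 \<le> k * m1" "0 \<le> k * m2" "0 \<le> k * r" using k nn by auto
    have eta_pi: "eta < pi" using km eta by linarith
    have cal: "k / 4 * (cot (th + k * integral {a..b} ?f2) * f b ^ 4 - cot th * f a ^ 4)
        \<le> integral {a..b} ?g2 - k\<^sup>2 / 4 * integral {a..b} ?f6"
      if "0 \<le> a" "a \<le> b" "b \<le> L" "0 < th" "th + k * integral {a..b} ?f2 < pi" for a b th
      using calibration[OF ac_on_subinterval[OF f that(1,3)] int_sub[OF g2 that(1,3)] that(2) k(1) that(4,5)] .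
    \<comment> \<open>The phase runs from pi - (k m1 + eta) at 0 to pi - eta at y1; the last piece
      mirrors this, starting at eta.\<close>
    have c1: "k / 4 * (cot (k * m1 + eta) * f 0 ^ 4 - cot eta * f y1 ^ 4) \<le> integral {0..y1} ?g2 - k\<^sup>2 / 4 * integral {0..y1} ?f6"
    proof -
      have "pi - (k * m1 + eta) + k * m1 = pi - eta" by simp
      then show ?thesis
        using cal[of 0 y1 "pi - (k * m1 + eta)"] y eta km unfolding m1_def[symmetric] by (simp add: cot_pi_minus)
    qed
    have c3: "k / 4 * (cot (k * m2 + eta) * f L ^ 4 - cot eta * f y2 ^ 4) \<le> integral {y2..L} ?g2 - k\<^sup>2 / 4 * integral {y2..L} ?f6"
      using cal[of y2 L eta] y eta unfolding m2_def[symmetric] by (simp add: add.commute)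
    \<comment> \<open>Started at pi/4, the middle phase ends at most at 3 pi/4, so either end costs
      at most f^4.\<close>
    have c2: "k / 4 * (- (f y2 ^ 4) - f y1 ^ 4) \<le> integral {y1..y2} ?g2 - k\<^sup>2 / 4 * integral {y1..y2} ?f6"
    proof -
      have "k * r \<le> (2 * om) * (mu_R / 4)" using k r4 nn om_pos by (intro mult_mono) auto
      also have "\<dots> = pi / 2" by (simp flip: om_mu_R)
      finally have kr: "k * r \<le> pi / 2" .
      have cot1: "cot (pi / 4) = 1" by (simp add: cot_def cos_45 sin_45)
      have "(- 1 :: real) = cot (pi - pi / 4)" by (simp only: cot_pi_minus cot1)
      also have "\<dots> \<le> cot (pi / 4 + k * r)" using kr km pi_gt_zero by (intro cot_antimono add_pos_nonneg) auto
      finally have "(- 1) * f y2 ^ 4 \<le> cot (pi / 4 + k * r) * f y2 ^ 4" by (rule mult_right_mono) simp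
      then have "k / 4 * (- (f y2 ^ 4) - f y1 ^ 4) \<le> k / 4 * (cot (pi / 4 + k * r) * f y2 ^ 4 - cot (pi / 4) * f y1 ^ 4)"
        using k cot1 by (intro mult_left_mono) auto
      also have "\<dots> \<le> integral {y1..y2} ?g2 - k\<^sup>2 / 4 * integral {y1..y2} ?f6"
        using cal[of y1 y2 "pi / 4"] y kr pi_gt_zero unfolding r_def[symmetric] by simp
      finally show ?thesis .
    qed
    \<comment> \<open>Cost of one cut: cot(eta) <= 1/eta from the outer piece and 1 from the middle
      piece.\<close>
    have err: "k / 4 * (cot eta * f z ^ 4 + f z ^ 4) \<le> om / 2 * D * (1 + 1 / eta)" if z: "f z ^ 4 \<le> D" for z
    proof -
      have "k / 4 * (cot eta * f z ^ 4 + f z ^ 4) = k / 4 * ((1 + cot eta) * f z ^ 4)" by (simp add: algebra_simps)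
      also have "\<dots> \<le> k / 4 * ((1 + 1 / eta) * f z ^ 4)"
        using cot_le_inverse[OF eta(1) eta_pi] k by (intro mult_left_mono mult_right_mono) auto
      also have "\<dots> \<le> (2 * om) / 4 * ((1 + 1 / eta) * D)"
        using z k eta om_pos by (intro mult_mono divide_right_mono mult_left_mono) auto
      finally show ?thesis by (simp add: algebra_simps)
    qed
    have split: "integral {0..L} ?g2 - k\<^sup>2 / 4 * integral {0..L} ?f6 =
      (integral {0..y1} ?g2 - k\<^sup>2 / 4 * integral {0..y1} ?f6) + (integral {y1..y2} ?g2 - k\<^sup>2 / 4 * integral {y1..y2} ?f6)
      + (integral {y2..L} ?g2 - k\<^sup>2 / 4 * integral {y2..L} ?f6)"
      unfolding comb[OF g2] comb[OF if6] by (simp add: algebra_simps)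
    have D': "om * (64 / L)\<^sup>2 * (r * sqrt r) * (1 + 1 / eta) = om / 2 * D * (1 + 1 / eta) + om / 2 * D * (1 + 1 / eta)"
      by (simp add: D_def)
    show ?thesis
      unfolding split D' using c1 c2 c3 err[of y1] err[of y2] b1 b2 unfolding D_def[symmetric]
      by (simp add: algebra_simps)
  qed
  show ?thesis using nn sum main by (intro exI[of _ m1] exI[of _ m2] exI[of _ r]) auto
qed

section \<open>Weak limits of derivatives\<close>

definition L2_on :: "real \<Rightarrow> (real \<Rightarrow> real) \<Rightarrow> bool" where
  "L2_on L h \<longleftrightarrow> set_borel_measurable lborel {0..L} h \<and> set_integrable lborel {0..L} (\<lambda>x. (h x)\<^sup>2)"

lemma L2_on_D:
  assumes "L2_on L h"
  shows "set_borel_measurable lborel {0..L} h" "set_integrable lborel {0..L} (\<lambda>x. (h x)\<^sup>2)"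
    "set_integrable lborel {0..L} h" "(\<lambda>x. (h x)\<^sup>2) integrable_on {0..L}" "h integrable_on {0..L}"
  using assms set_integrable_of_square[of 0 L h] set_borel_integral_eq_integral(1)[of "{0..L}" "\<lambda>x. (h x)\<^sup>2"]
    set_borel_integral_eq_integral(1)[of "{0..L}" h]
  unfolding L2_on_def by auto

lemma L2_on_lin:
  assumes h: "L2_on L h" and k: "L2_on L k"
  shows "L2_on L (\<lambda>x. a * h x + b * k x)"
  unfolding L2_on_def
proof
  show m: "set_borel_measurable lborel {0..L} (\<lambda>x. a * h x + b * k x)"
  proof -
    have "set_integrable lborel {0..L} (\<lambda>x. a * h x + b * k x)"
      using L2_on_D(3)[OF h] L2_on_D(3)[OF k] by (intro set_integral_add(1)) auto
    then show ?thesis by (auto simp: set_integrable_def set_borel_measurable_def)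
  qed
  show "set_integrable lborel {0..L} (\<lambda>x. (a * h x + b * k x)\<^sup>2)"
  proof (rule set_integrable_bound)
    show "set_integrable lborel {0..L} (\<lambda>x. 2 * a\<^sup>2 * (h x)\<^sup>2 + 2 * b\<^sup>2 * (k x)\<^sup>2)"
      using L2_on_D(2)[OF h] L2_on_D(2)[OF k] by (intro set_integral_add(1)) auto
    show "set_borel_measurable lborel {0..L} (\<lambda>x. (a * h x + b * k x)\<^sup>2)"
      using set_borel_measurable_power[OF m, of 1] by (simp add: numeral_2_eq_2)
    have "(a * h x + b * k x)\<^sup>2 \<le> 2 * a\<^sup>2 * (h x)\<^sup>2 + 2 * b\<^sup>2 * (k x)\<^sup>2" for x
    proof -
      have "0 \<le> (a * h x - b * k x)\<^sup>2" by simp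
      then show ?thesis by (simp add: power2_eq_square algebra_simps)
    qed
    then show "AE x in lborel. x \<in> {0..L} \<longrightarrow> norm ((a * h x + b * k x)\<^sup>2) \<le> norm (2 * a\<^sup>2 * (h x)\<^sup>2 + 2 * b\<^sup>2 * (k x)\<^sup>2)"
      by (simp add: abs_of_nonneg)
  qed
qed

lemma L2_on_parallelogram:
  assumes h: "L2_on L h" and k: "L2_on L k"
  shows "integral {0..L} (\<lambda>x. (1 * h x + (-1) * k x)\<^sup>2) = 2 * integral {0..L} (\<lambda>x. (h x)\<^sup>2) +
    2 * integral {0..L} (\<lambda>x. (k x)\<^sup>2) - 4 * integral {0..L} (\<lambda>x. (1/2 * h x + 1/2 * k x)\<^sup>2)"
proof -
  note a = L2_on_D(4)[OF h] and b = L2_on_D(4)[OF k]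
    and c = L2_on_D(4)[OF L2_on_lin[OF h k, of "1/2" "1/2"]]
  have "integral {0..L} (\<lambda>x. (1 * h x + (-1) * k x)\<^sup>2) =
     integral {0..L} (\<lambda>x. (2 * (h x)\<^sup>2 + 2 * (k x)\<^sup>2) - 4 * (1/2 * h x + 1/2 * k x)\<^sup>2)"
    by (rule integral_cong) (simp add: power2_eq_square algebra_simps)
  also have "\<dots> = integral {0..L} (\<lambda>x. 2 * (h x)\<^sup>2 + 2 * (k x)\<^sup>2) - integral {0..L} (\<lambda>x. 4 * (1/2 * h x + 1/2 * k x)\<^sup>2)"
    using a b c by (intro integral_diff integrable_add integrable_on_mult_right)
  also have "integral {0..L} (\<lambda>x. 2 * (h x)\<^sup>2 + 2 * (k x)\<^sup>2) = integral {0..L} (\<lambda>x. 2 * (h x)\<^sup>2) + integral {0..L} (\<lambda>x. 2 * (k x)\<^sup>2)"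
    using a b by (intro integral_add integrable_on_mult_right)
  finally show ?thesis by simp
qed

lemma L2_on_abs_bound:
  assumes h: "L2_on L h" and L: "0 < L"
  shows "(LINT x:{0..L}|lborel. \<bar>h x\<bar>) \<le> sqrt (L * integral {0..L} (\<lambda>x. (h x)\<^sup>2))"
proof -
  have s: "set_integrable lborel {0..L} (\<lambda>x. \<bar>h x\<bar>)" using L2_on_D(3)[OF h] by (rule set_integrable_abs)
  have i: "(\<lambda>x. 1 * \<bar>h x\<bar>) integrable_on {0..L}" using set_borel_integral_eq_integral(1)[OF s] by simp
  have "(integral {0..L} (\<lambda>x. 1 * \<bar>h x\<bar>))\<^sup>2 \<le> integral {0..L} (\<lambda>x. 1\<^sup>2) * integral {0..L} (\<lambda>x. \<bar>h x\<bar>\<^sup>2)"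
    by (rule integral_Cauchy_Schwarz) (use i L2_on_D(4)[OF h] in auto)
  then have "(integral {0..L} (\<lambda>x. \<bar>h x\<bar>))\<^sup>2 \<le> L * integral {0..L} (\<lambda>x. (h x)\<^sup>2)" using L by simp
  then show ?thesis unfolding set_borel_integral_eq_integral(2)[OF s] by (rule real_le_rsqrt)
qed

text \<open>On a bounded interval an L2-Cauchy sequence is L1-Cauchy, so a subsequence converges
  almost everywhere. Fatou then bounds the norm of the limit and, applied to differences, gives L1
  convergence and thus convergence of the primitives.\<close>

lemma L2_on_complete:
  assumes L: "0 < L" and h: "\<And>n. L2_on L (h n)"
    and cau: "\<And>e. 0 < e \<Longrightarrow> \<exists>N. \<forall>i\<ge>N. \<forall>j\<ge>N. integral {0..L} (\<lambda>x. (1 * h i x + (-1) * h j x)\<^sup>2) < e"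
    and bnd: "\<And>n. integral {0..L} (\<lambda>x. (h n x)\<^sup>2) \<le> C + d n" and d: "d \<longlonglongrightarrow> 0"
  shows "\<exists>g r. strict_mono (r :: nat \<Rightarrow> nat) \<and> L2_on L g \<and> integral {0..L} (\<lambda>x. (g x)\<^sup>2) \<le> C \<and>
    (\<forall>x\<in>{0..L}. (\<lambda>n. integral {0..x} (h (r n))) \<longlonglongrightarrow> integral {0..x} g)"
proof -
  define k where "k n x = indicator {0..L} x *\<^sub>R h n x" for n x
  have ik: "integrable lborel (k n)" for n
    using L2_on_D(3)[OF h] unfolding k_def set_integrable_def .
  have [measurable]: "k n \<in> borel_measurable borel" for n
    using borel_measurable_integrable[OF ik[of n]] by simp
  have L1: "\<exists>N. \<forall>i\<ge>N. \<forall>j\<ge>N. LINT x|lborel. norm (k i x - k j x) < e" if e: "0 < e" for e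
  proof -
    obtain N where N: "\<And>i j. i \<ge> N \<Longrightarrow> j \<ge> N \<Longrightarrow> integral {0..L} (\<lambda>x. (1 * h i x + (-1) * h j x)\<^sup>2) < e\<^sup>2 / L"
      using cau[of "e\<^sup>2 / L"] e L by auto
    have "LINT x|lborel. norm (k i x - k j x) < e" if ij: "i \<ge> N" "j \<ge> N" for i j
    proof -
      have "(LINT x|lborel. norm (k i x - k j x)) = (LINT x:{0..L}|lborel. \<bar>1 * h i x + (-1) * h j x\<bar>)"
        unfolding set_lebesgue_integral_def k_def by (rule Bochner_Integration.integral_cong) (auto simp: indicator_def)
      also have "\<dots> \<le> sqrt (L * integral {0..L} (\<lambda>x. (1 * h i x + (-1) * h j x)\<^sup>2))"
        by (rule L2_on_abs_bound[OF L2_on_lin[OF h h] L])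
      also have "\<dots> < sqrt (L * (e\<^sup>2 / L))"
        using N[OF ij] L by (intro real_sqrt_less_mono mult_strict_left_mono)
      also have "\<dots> = e" using L e by simp
      finally show ?thesis .
    qed
    then show ?thesis by blast
  qed
  obtain r where r: "strict_mono r" "AE x in lborel. Cauchy (\<lambda>i. k (r i) x)"
    using cauchy_L1_AE_cauchy_subseq[OF ik L1] by blast
  define g where "g x = lim (\<lambda>i. k (r i) x)" for x
  have [measurable]: "g \<in> borel_measurable borel" unfolding g_def by measurable
  have lim: "AE x in lborel. (\<lambda>i. k (r i) x) \<longlonglongrightarrow> g x"
    using r(2) by eventually_elim (auto simp: g_def Cauchy_convergent_iff convergent_LIMSEQ_iff)
  have g0: "g x = 0" if "x \<notin> {0..L}" for x
    using that by (simp add: g_def k_def)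
  have gi: "(\<lambda>x. indicator {0..L} x *\<^sub>R g x) = g" "(\<lambda>x. indicator {0..L} x *\<^sub>R (g x)\<^sup>2) = (\<lambda>x. (g x)\<^sup>2)"
    using g0 by (auto simp: indicator_def fun_eq_iff)
  have nn2: "(\<integral>\<^sup>+x. ennreal ((k n x)\<^sup>2) \<partial>lborel) = ennreal (integral {0..L} (\<lambda>x. (h n x)\<^sup>2))" for n
  proof -
    have i: "integrable lborel (\<lambda>x. indicator {0..L} x *\<^sub>R (h n x)\<^sup>2)" using L2_on_D(2)[OF h] unfolding set_integrable_def .
    have "(\<integral>\<^sup>+x. ennreal ((k n x)\<^sup>2) \<partial>lborel) = (\<integral>\<^sup>+x. ennreal (indicator {0..L} x *\<^sub>R (h n x)\<^sup>2) \<partial>lborel)"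
      by (rule nn_integral_cong) (auto simp: k_def indicator_def)
    also have "\<dots> = ennreal (LINT x|lborel. indicator {0..L} x *\<^sub>R (h n x)\<^sup>2)"
      by (rule nn_integral_eq_integral[OF i]) auto
    finally show ?thesis
      using set_borel_integral_eq_integral(2)[OF L2_on_D(2)[OF h[of n]]] by (simp add: set_lebesgue_integral_def)
  qed
  have dr: "(\<lambda>n. C + d (r n)) \<longlonglongrightarrow> C" using LIMSEQ_subseq_LIMSEQ[OF d r(1)] by (auto intro!: tendsto_eq_intros simp: o_def)
  have C0: "0 \<le> C"
  proof (rule LIMSEQ_le_const[OF dr])
    have "0 \<le> integral {0..L} (\<lambda>x. (h n x)\<^sup>2)" for n using L2_on_D(4)[OF h] by (intro integral_nonneg) auto
    then show "\<exists>N. \<forall>n\<ge>N. 0 \<le> C + d (r n)" using bnd order_trans by blast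
  qed
  have gC: "(\<integral>\<^sup>+x. ennreal ((g x)\<^sup>2) \<partial>lborel) \<le> ennreal C"
  proof -
    have "(\<integral>\<^sup>+x. ennreal ((g x)\<^sup>2) \<partial>lborel) = (\<integral>\<^sup>+x. liminf (\<lambda>n. ennreal ((k (r n) x)\<^sup>2)) \<partial>lborel)"
    proof (rule nn_integral_cong_AE)
      show "AE x in lborel. ennreal ((g x)\<^sup>2) = liminf (\<lambda>n. ennreal ((k (r n) x)\<^sup>2))"
        using lim
      proof eventually_elim
        case (elim x)
        have "(\<lambda>n. ennreal ((k (r n) x)\<^sup>2)) \<longlonglongrightarrow> ennreal ((g x)\<^sup>2)"
          using elim by (intro tendsto_ennrealI tendsto_intros)
        then show ?case by (rule lim_imp_Liminf[OF sequentially_bot, symmetric])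
      qed
    qed
    also have "\<dots> \<le> liminf (\<lambda>n. \<integral>\<^sup>+x. ennreal ((k (r n) x)\<^sup>2) \<partial>lborel)"
      by (rule nn_integral_liminf) measurable
    also have "\<dots> \<le> liminf (\<lambda>n. ennreal (C + d (r n)))"
      unfolding nn2 using bnd by (intro Liminf_mono always_eventually allI ennreal_leI)
    also have "\<dots> = ennreal C"
      using dr by (intro lim_imp_Liminf tendsto_ennrealI) auto
    finally show ?thesis .
  qed
  have ig2: "integrable lborel (\<lambda>x. (g x)\<^sup>2)"
    by (rule integrableI_nonneg) (use gC in \<open>auto simp: less_top[symmetric] top_unique\<close>)
  have L2g: "L2_on L g"
    unfolding L2_on_def set_borel_measurable_def set_integrable_def gi using ig2 by auto
  have "ennreal (integral {0..L} (\<lambda>x. (g x)\<^sup>2)) = (\<integral>\<^sup>+x. ennreal ((g x)\<^sup>2) \<partial>lborel)"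
    using nn_integral_eq_integral[OF ig2] set_borel_integral_eq_integral(2)[OF L2_on_D(2)[OF L2g]]
    unfolding set_lebesgue_integral_def gi by simp
  then have gC': "integral {0..L} (\<lambda>x. (g x)\<^sup>2) \<le> C"
    using gC C0 ennreal_le_iff[OF C0, of "integral {0..L} (\<lambda>x. (g x)\<^sup>2)"] by simp
  have ig: "integrable lborel g"
    using L2_on_D(3)[OF L2g] unfolding set_integrable_def gi .
  have conv: "(\<lambda>n. integral {0..x} (h (r n))) \<longlonglongrightarrow> integral {0..x} g" if x: "x \<in> {0..L}" for x
  proof (rule LIMSEQ_I)
    fix e :: real assume e: "0 < e"
    obtain N where N: "\<And>i j. i \<ge> N \<Longrightarrow> j \<ge> N \<Longrightarrow> LINT x|lborel. norm (k i x - k j x) < e / 2"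
      using L1[of "e / 2"] e by auto
    have "norm (integral {0..x} (h (r n)) - integral {0..x} g) < e" if n: "n \<ge> N" for n
    proof -
      have rn: "r n \<ge> N" using n seq_suble[OF r(1), of n] by simp
      \<comment> \<open>The limit function is the almost everywhere limit in \<open>j\<close>, so
        Fatou carries the Cauchy bound for the pair (r n, r j) over to the distance from
        \<open>g\<close>.\<close>
      have "(\<integral>\<^sup>+t. ennreal (norm (k (r n) t - g t)) \<partial>lborel) = (\<integral>\<^sup>+t. liminf (\<lambda>j. ennreal (norm (k (r n) t - k (r j) t))) \<partial>lborel)"
      proof (rule nn_integral_cong_AE)
        show "AE t in lborel. ennreal (norm (k (r n) t - g t)) = liminf (\<lambda>j. ennreal (norm (k (r n) t - k (r j) t)))"
          using lim
        proof eventually_elim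
          case (elim t)
          have "(\<lambda>j. ennreal (norm (k (r n) t - k (r j) t))) \<longlonglongrightarrow> ennreal (norm (k (r n) t - g t))"
            using elim by (intro tendsto_ennrealI tendsto_intros)
          then show ?case by (rule lim_imp_Liminf[OF sequentially_bot, symmetric])
        qed
      qed
      also have "\<dots> \<le> liminf (\<lambda>j. \<integral>\<^sup>+t. ennreal (norm (k (r n) t - k (r j) t)) \<partial>lborel)"
        by (rule nn_integral_liminf) measurable
      also have "\<dots> \<le> liminf (\<lambda>j. ennreal (e / 2))"
      proof (rule Liminf_mono)
        have "(\<integral>\<^sup>+t. ennreal (norm (k (r n) t - k (r j) t)) \<partial>lborel) \<le> ennreal (e / 2)" if j: "j \<ge> N" for j
        proof -
          have "(\<integral>\<^sup>+t. ennreal (norm (k (r n) t - k (r j) t)) \<partial>lborel) = ennreal (LINT t|lborel. norm (k (r n) t - k (r j) t))"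
            using ik by (intro nn_integral_eq_integral) auto
          also have "\<dots> \<le> ennreal (e / 2)"
            using N[OF rn, of "r j"] j seq_suble[OF r(1), of j] by (intro ennreal_leI) simp
          finally show ?thesis .
        qed
        then show "\<forall>\<^sub>F j in sequentially. (\<integral>\<^sup>+t. ennreal (norm (k (r n) t - k (r j) t)) \<partial>lborel) \<le> ennreal (e / 2)"
          by (auto simp: eventually_sequentially)
      qed
      also have "\<dots> = ennreal (e / 2)" by (rule lim_imp_Liminf) auto
      finally have "ennreal (LINT t|lborel. norm (k (r n) t - g t)) \<le> ennreal (e / 2)"
        using nn_integral_eq_integral[of lborel "\<lambda>t. norm (k (r n) t - g t)"] ik ig by simp
      then have le: "(LINT t|lborel. norm (k (r n) t - g t)) \<le> e / 2" using e by (simp add: ennreal_le_iff)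
      have s1: "set_integrable lborel {0..x} (h (r n))" by (rule set_integrable_subset[OF L2_on_D(3)[OF h]]) (use x in auto)
      have s2: "set_integrable lborel {0..x} g" by (rule set_integrable_subset[OF L2_on_D(3)[OF L2g]]) (use x in auto)
      have "integral {0..x} (h (r n)) - integral {0..x} g = (LINT t:{0..x}|lborel. h (r n) t - g t)"
        using set_borel_integral_eq_integral(2)[OF s1] set_borel_integral_eq_integral(2)[OF s2] set_integral_diff(2)[OF s1 s2] by simp
      also have "\<dots> = (LINT t|lborel. indicator {0..x} t *\<^sub>R (k (r n) t - g t))"
        unfolding set_lebesgue_integral_def by (rule Bochner_Integration.integral_cong) (use x in \<open>auto simp: k_def indicator_def\<close>)
      finally have "norm (integral {0..x} (h (r n)) - integral {0..x} g) = norm (LINT t|lborel. indicator {0..x} t *\<^sub>R (k (r n) t - g t))" by simp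
      also have "\<dots> \<le> (LINT t|lborel. norm (indicator {0..x} t *\<^sub>R (k (r n) t - g t)))"
        by (rule integral_norm_bound)
      also have "\<dots> \<le> (LINT t|lborel. norm (k (r n) t - g t))"
      proof (rule Bochner_Integration.integral_mono)
        have i: "integrable lborel (\<lambda>t. k (r n) t - g t)" using ik ig by simp
        show "integrable lborel (\<lambda>t. norm (indicat_real {0..x} t *\<^sub>R (k (r n) t - g t)))"
          by (rule integrable_norm[OF integrable_mult_indicator[OF _ i]]) simp
        show "integrable lborel (\<lambda>t. norm (k (r n) t - g t))" using i by (rule integrable_norm)
      qed (auto simp: indicator_def)
      finally show ?thesis using le e by simp
    qed
    then show "\<exists>no. \<forall>n\<ge>no. norm (integral {0..x} (h (r n)) - integral {0..x} g) < e" by blast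
  qed
  show ?thesis using r(1) L2g gC' conv by blast
qed

text \<open>Lower semicontinuity of the kinetic energy, proved by minimization: among L2 functions
  whose primitive is uniformly \<open>e\<close>-close to \<open>U\<close> take almost minimal norms
  and let \<open>e\<close> tend to 0. These classes are convex, so the parallelogram law makes the
  almost minimizers Cauchy.\<close>

lemma weak_derivative_limit:
  assumes L: "0 < L" and g: "\<And>n. L2_on L (g n)"
    and unif: "\<And>e. 0 < e \<Longrightarrow> \<exists>N. \<forall>n\<ge>N. \<forall>x\<in>{0..L}. \<bar>integral {0..x} (g n) - U x\<bar> \<le> e"
    and lim: "(\<lambda>n. integral {0..L} (\<lambda>x. (g n x)\<^sup>2)) \<longlonglongrightarrow> C"
  shows "\<exists>h. L2_on L h \<and> integral {0..L} (\<lambda>x. (h x)\<^sup>2) \<le> C \<and> (\<forall>x\<in>{0..L}. integral {0..x} h = U x)"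
proof -
  define Q where "Q h = integral {0..L} (\<lambda>x. (h x)\<^sup>2)" for h :: "real \<Rightarrow> real"
  define A where "A e = {h. L2_on L h \<and> (\<forall>x\<in>{0..L}. \<bar>integral {0..x} h - U x\<bar> \<le> e)}" for e :: real
  define I where "I e = Inf (Q ` A e)" for e
  have Q0: "0 \<le> Q h" if "L2_on L h" for h unfolding Q_def using L2_on_D(4)[OF that] by (intro integral_nonneg) auto
  have bdd: "bdd_below (Q ` A e)" for e using Q0 by (auto simp: A_def intro!: bdd_belowI[of _ 0])
  have ne: "A e \<noteq> {}" if "0 < e" for e using unif[OF that] g by (auto simp: A_def)
  have mono: "A e \<subseteq> A e'" if "e \<le> e'" for e e' using that by (force simp: A_def)
  have I_le: "I e \<le> C" if e: "0 < e" for e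
  proof -
    obtain N where N: "\<And>n. n \<ge> N \<Longrightarrow> g n \<in> A e" using unif[OF e] g by (auto simp: A_def)
    have "I e \<le> Q (g n)" if "n \<ge> N" for n unfolding I_def using N[OF that] bdd by (intro cInf_lower) auto
    then show ?thesis using lim unfolding Q_def by (intro LIMSEQ_le_const[OF lim]) blast
  qed
  have I_anti: "I e' \<le> I e" if "0 < e" "e \<le> e'" for e e'
    unfolding I_def using mono[OF that(2)] ne[OF that(1)] bdd by (intro cInf_superset_mono) auto
  have mid: "(\<lambda>x. 1/2 * h x + 1/2 * k x) \<in> A e" if h: "h \<in> A e" and k: "k \<in> A e" for h k e
  proof -
    have "L2_on L (\<lambda>x. 1/2 * h x + 1/2 * k x)" using h k by (intro L2_on_lin) (auto simp: A_def)
    moreover have "\<bar>integral {0..x} (\<lambda>x. 1/2 * h x + 1/2 * k x) - U x\<bar> \<le> e" if x: "x \<in> {0..L}" for x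
    proof -
      have "h integrable_on {0..x}" "k integrable_on {0..x}"
        using h k x by (auto simp: A_def intro!: integrable_on_subinterval[OF L2_on_D(5)])
      then have "integral {0..x} (\<lambda>x. 1/2 * h x + 1/2 * k x) = integral {0..x} (\<lambda>x. 1/2 * h x) + integral {0..x} (\<lambda>x. 1/2 * k x)"
        by (intro integral_add integrable_on_mult_right)
      then have "integral {0..x} (\<lambda>x. 1/2 * h x + 1/2 * k x) = 1/2 * integral {0..x} h + 1/2 * integral {0..x} k"
        by simp
      moreover have "\<bar>integral {0..x} h - U x\<bar> \<le> e" "\<bar>integral {0..x} k - U x\<bar> \<le> e" using h k x by (auto simp: A_def)
      ultimately show ?thesis by (simp add: abs_le_iff)
    qed
    ultimately show ?thesis by (simp add: A_def)
  qed
  define \<epsilon> where "\<epsilon> n = 1 / (real n + 1)" for n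
  have eps: "0 < \<epsilon> n" "m \<le> n \<Longrightarrow> \<epsilon> n \<le> \<epsilon> m" for m n by (auto simp: \<epsilon>_def frac_le)
  have eps0: "\<epsilon> \<longlonglongrightarrow> 0" unfolding \<epsilon>_def using LIMSEQ_inverse_real_of_nat by (simp add: inverse_eq_divide add.commute)
  have "\<exists>h\<in>A (\<epsilon> n). Q h < I (\<epsilon> n) + \<epsilon> n" for n
    using cInf_lessD[of "Q ` A (\<epsilon> n)" "I (\<epsilon> n) + \<epsilon> n"] ne[OF eps(1)] eps(1)[of n] unfolding I_def by auto
  then obtain h where h: "\<And>n. h n \<in> A (\<epsilon> n)" "\<And>n. Q (h n) < I (\<epsilon> n) + \<epsilon> n" by metis
  have L2h: "L2_on L (h n)" for n using h(1) by (simp add: A_def)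
  \<comment> \<open>The infimum grows as the class shrinks and stays below \<open>C\<close>; its
    convergence is what makes the next estimate small.\<close>
  define J where "J n = I (\<epsilon> n)" for n
  have "incseq J" unfolding J_def incseq_def using I_anti eps by blast
  moreover have "J n \<le> C" for n unfolding J_def using I_le eps by blast
  ultimately obtain Jl where Jl: "J \<longlonglongrightarrow> Jl" "\<And>n. J n \<le> Jl" using incseq_convergent[of J C] by blast
  \<comment> \<open>The midpoint of two candidates stays in the class of index \<open>N\<close>,
    hence has squared norm at least J N.\<close>
  have par: "integral {0..L} (\<lambda>x. (1 * h i x + (-1) * h j x)\<^sup>2) \<le> 4 * (Jl - J N) + 4 * \<epsilon> N" if ij: "i \<ge> N" "j \<ge> N" for i j N
  proof -
    have hA: "h i \<in> A (\<epsilon> N)" "h j \<in> A (\<epsilon> N)" using h(1) mono eps(2) ij by blast+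
    have "J N \<le> Q (\<lambda>x. 1/2 * h i x + 1/2 * h j x)" unfolding J_def I_def using mid[OF hA] bdd by (intro cInf_lower) auto
    moreover have "Q (h i) \<le> Jl + \<epsilon> N" "Q (h j) \<le> Jl + \<epsilon> N"
      using h(2)[of i] h(2)[of j] Jl(2)[of i] Jl(2)[of j] eps(2)[OF ij(1)] eps(2)[OF ij(2)] unfolding J_def by auto
    ultimately show ?thesis unfolding L2_on_parallelogram[OF L2h L2h] Q_def by simp
  qed
  have cau: "\<exists>N. \<forall>i\<ge>N. \<forall>j\<ge>N. integral {0..L} (\<lambda>x. (1 * h i x + (-1) * h j x)\<^sup>2) < e" if e: "0 < e" for e
  proof -
    have "(\<lambda>N. 4 * (Jl - J N) + 4 * \<epsilon> N) \<longlonglongrightarrow> 4 * (Jl - Jl) + 4 * 0"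
      by (intro tendsto_intros Jl eps0)
    then have "eventually (\<lambda>N. 4 * (Jl - J N) + 4 * \<epsilon> N < e) sequentially"
      using e by (intro order_tendstoD(2)) auto
    then obtain N where "4 * (Jl - J N) + 4 * \<epsilon> N < e" by (auto simp: eventually_sequentially)
    then show ?thesis using par by (meson le_less_trans)
  qed
  have "integral {0..L} (\<lambda>x. (h n x)\<^sup>2) \<le> C + \<epsilon> n" for n
    using h(2)[of n] I_le[OF eps(1)[of n]] unfolding Q_def by simp
  then obtain w r where w: "strict_mono (r :: nat \<Rightarrow> nat)" "L2_on L w" "integral {0..L} (\<lambda>x. (w x)\<^sup>2) \<le> C"
    "\<And>x. x \<in> {0..L} \<Longrightarrow> (\<lambda>n. integral {0..x} (h (r n))) \<longlonglongrightarrow> integral {0..x} w"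
    using L2_on_complete[OF L L2h cau _ eps0, of C] by blast
  have "integral {0..x} w = U x" if x: "x \<in> {0..L}" for x
  proof (rule LIMSEQ_unique[OF w(4)[OF x]])
    have "(\<lambda>n. integral {0..x} (h (r n)) - U x) \<longlonglongrightarrow> 0"
    proof (rule Lim_null_comparison)
      show "eventually (\<lambda>n. norm (integral {0..x} (h (r n)) - U x) \<le> \<epsilon> (r n)) sequentially"
        using h(1) x by (auto simp: A_def)
      show "(\<lambda>n. \<epsilon> (r n)) \<longlonglongrightarrow> 0" using LIMSEQ_subseq_LIMSEQ[OF eps0 w(1)] by (simp add: o_def)
    qed
    then show "(\<lambda>n. integral {0..x} (h (r n))) \<longlonglongrightarrow> U x" by (simp add: LIM_zero_iff)
  qed
  then show ?thesis using w by blast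
qed

section \<open>Compactness on a single edge\<close>

definition En :: "real set \<Rightarrow> (real \<Rightarrow> real) \<Rightarrow> (real \<Rightarrow> real) \<Rightarrow> real" where
  "En S f g = integral S (\<lambda>x. (g x)\<^sup>2) / 2 - integral S (\<lambda>x. f x ^ 6) / 6"

text \<open>\<open>m\<close> and \<open>\<epsilon>\<close> are limits along the sequence, whereas
  \<open>f\<close> need only satisfy inequalities: on a halfline it is a replacement of no larger
  mass and energy, not a limit of the profiles. Uniform convergence is claimed on bounded edges
  alone.\<close>

definition edge_limit ::
  "real set \<Rightarrow> (nat \<Rightarrow> real \<Rightarrow> real) \<Rightarrow> (nat \<Rightarrow> real \<Rightarrow> real) \<Rightarrow> (real \<Rightarrow> real) \<Rightarrow> (real \<Rightarrow> real) \<Rightarrow> real \<Rightarrow> real \<Rightarrow> bool" where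
  "edge_limit S F G f g m \<epsilon> \<longleftrightarrow> H1_on S f g \<and> (\<lambda>n. F n 0) \<longlonglongrightarrow> f 0 \<and>
     (\<lambda>n. integral S (\<lambda>x. (F n x)\<^sup>2)) \<longlonglongrightarrow> m \<and> (\<lambda>n. En S (F n) (G n)) \<longlonglongrightarrow> \<epsilon> \<and>
     integral S (\<lambda>x. (f x)\<^sup>2) \<le> m \<and> En S f g \<le> \<epsilon> \<and>
     (\<forall>L. S = {0..L} \<longrightarrow> uniform_limit S F f sequentially)"

lemma edge_limit_subseq:
  assumes "edge_limit S F G f g m \<epsilon>" "strict_mono (r :: nat \<Rightarrow> nat)"
  shows "edge_limit S (F \<circ> r) (G \<circ> r) f g m \<epsilon>"
proof -
  have u: "uniform_limit S (F \<circ> r) f sequentially" if "uniform_limit S F f sequentially"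
    using filterlim_compose[OF that filterlim_subseq[OF assms(2)]] by (simp add: o_def)
  show ?thesis
    using assms(1) u LIMSEQ_subseq_LIMSEQ[OF _ assms(2)] unfolding edge_limit_def by (fastforce simp: o_def)
qed

section \<open>Compactness on bounded edges\<close>

lemma H1_on_intervalI:
  assumes ac: "\<And>x. x \<in> {0..L} \<Longrightarrow> integral {0..x} g = f x - f 0" and g: "L2_on L g" and cf: "continuous_on {0..L} f"
  shows "H1_on {0..L} f g"
  unfolding H1_on_def
proof (intro conjI ballI)
  show "set_integrable lborel {0..L} (\<lambda>x. (f x)\<^sup>2)"
    using cf by (intro borel_integrable_atLeastAtMost' continuous_intros)
  fix x assume x: "x \<in> {0..L}"
  have "set_integrable lborel {0..x} g" by (rule set_integrable_subset[OF L2_on_D(3)[OF g]]) (use x in auto)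
  then show "f x = f 0 + (LINT t:{0..x}|lborel. g t)"
    using ac[OF x] set_borel_integral_eq_integral(2) by fastforce
qed (use L2_on_D[OF g] in auto)

lemma H1_on_interval_L2: "H1_on {0..L} f g \<Longrightarrow> L2_on L g"
  using H1_onD(1,2) unfolding L2_on_def by blast

lemma integral_power_limit:
  fixes F :: "nat \<Rightarrow> real \<Rightarrow> real" and f :: "real \<Rightarrow> real"
  assumes F: "\<And>n. continuous_on {0..L} (F n)" and B: "\<And>n x. x \<in> {0..L} \<Longrightarrow> \<bar>F n x\<bar> \<le> B"
    and lim: "\<And>x. x \<in> {0..L} \<Longrightarrow> (\<lambda>n. F n x) \<longlonglongrightarrow> f x"
  shows "(\<lambda>n. integral {0..L} (\<lambda>x. F n x ^ p)) \<longlonglongrightarrow> integral {0..L} (\<lambda>x. f x ^ p)"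
proof (rule dominated_convergence(2))
  show "(\<lambda>x. F n x ^ p) integrable_on {0..L}" for n
    using F by (intro integrable_continuous_real continuous_intros)
  show "(\<lambda>x. B ^ p) integrable_on {0..L}" by (rule integrable_const_ivl)
  show "norm (F n x ^ p) \<le> B ^ p" if "x \<in> {0..L}" for n x
    using B[OF that] by (simp add: power_abs power_mono)
  show "(\<lambda>n. F n x ^ p) \<longlonglongrightarrow> f x ^ p" if "x \<in> {0..L}" for x
    using lim[OF that] by (rule tendsto_power)
qed

lemma interval_compactness:
  assumes L: "0 < L" and H: "\<And>n. H1_on {0..L} (F n) (G n)"
    and B: "\<And>n. integral {0..L} (\<lambda>x. (G n x)\<^sup>2) \<le> B" and M: "\<And>n. integral {0..L} (\<lambda>x. (F n x)\<^sup>2) \<le> M"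
  shows "\<exists>r f g m \<epsilon>. strict_mono (r :: nat \<Rightarrow> nat) \<and> edge_limit {0..L} (F \<circ> r) (G \<circ> r) f g m \<epsilon>"
proof -
  have ac: "ac_on 0 L (F n) (G n)" for n by (rule H1_on_ac[OF H]) simp
  note i = H1_on_square_integrable[OF H]
  have nn: "0 \<le> integral {0..L} (\<lambda>x. (G n x)\<^sup>2)" "0 \<le> integral {0..L} (\<lambda>x. (F n x)\<^sup>2)" for n
    using i by (auto intro!: integral_nonneg)
  define S where "S = sqrt (M / L + 2 * sqrt (M * B))"
  have bnd: "\<bar>F n x\<bar> \<le> S" if "x \<in> {0..L}" for n x
  proof -
    have "(F n x)\<^sup>2 \<le> integral {0..L} (\<lambda>x. (F n x)\<^sup>2) / L + 2 * sqrt (integral {0..L} (\<lambda>x. (F n x)\<^sup>2) * integral {0..L} (\<lambda>x. (G n x)\<^sup>2))"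
      by (rule interval_sup_bound[OF ac i(1) L that])
    also have "\<dots> \<le> M / L + 2 * sqrt (M * B)"
      using M[of n] B[of n] nn[of n] L
      by (intro add_mono divide_right_mono mult_left_mono real_sqrt_le_mono mult_mono) auto
    finally show ?thesis unfolding S_def using real_le_rsqrt[of "\<bar>F n x\<bar>"] by simp
  qed
  have B0: "0 \<le> B" using nn(1)[of 0] B[of 0] by linarith
  have hold: "\<bar>F n x - F n y\<bar> \<le> sqrt (\<bar>x - y\<bar> * B)" if "x \<in> {0..L}" "y \<in> {0..L}" for n x y
  proof -
    have "\<bar>F n y - F n x\<bar> \<le> sqrt ((y - x) * B)" if "x \<in> {0..L}" "y \<in> {0..L}" "x \<le> y" for x y
    proof -
      have "\<bar>F n y - F n x\<bar> \<le> sqrt ((y - x) * integral {0..L} (\<lambda>x. (G n x)\<^sup>2))"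
        using ac_diff_bound[OF ac i(1), of x y] that by auto
      also have "\<dots> \<le> sqrt ((y - x) * B)" using B[of n] that by (intro real_sqrt_le_mono mult_left_mono) auto
      finally show ?thesis .
    qed
    from this[of x y] this[of y x] that show ?thesis
      by (cases "x \<le> y") (auto simp: abs_minus_commute)
  qed
  obtain f r where f: "continuous_on {0..L} f" "strict_mono (r :: nat \<Rightarrow> nat)"
    and unif: "\<And>e. 0 < e \<Longrightarrow> \<exists>N. \<forall>n x. n \<ge> N \<and> x \<in> {0..L} \<longrightarrow> norm (F (r n) x - f x) < e"
  proof (rule Arzela_Ascoli[of "{0..L}" F S])
    fix x e :: real assume x: "x \<in> {0..L}" and e: "0 < e"
    define d where "d = e\<^sup>2 / (B + 1)"
    have d: "0 < d" using e B0 by (simp add: d_def)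
    have "norm (F n x - F n y) < e" if y: "y \<in> {0..L}" "norm (x - y) < d" for n y
    proof -
      have "\<bar>x - y\<bar> * B \<le> d * B" using y B0 by (intro mult_right_mono) auto
      also have "\<dots> < e\<^sup>2" using e B0 by (simp add: d_def field_simps)
      finally have "sqrt (\<bar>x - y\<bar> * B) < e" using e by (simp add: real_less_lsqrt)
      then show ?thesis using hold[OF x y(1), of n] by simp
    qed
    then show "\<exists>d. 0 < d \<and> (\<forall>n y. y \<in> {0..L} \<and> norm (x - y) < d \<longrightarrow> norm (F n x - F n y) < e)" using d by blast
  qed (use bnd in auto)
  have "bounded (range (\<lambda>n. integral {0..L} (\<lambda>x. (G (r n) x)\<^sup>2)))"
    using nn(1) B by (intro boundedI[of _ B]) auto
  then obtain C s where s: "strict_mono (s :: nat \<Rightarrow> nat)" "((\<lambda>n. integral {0..L} (\<lambda>x. (G (r n) x)\<^sup>2)) \<circ> s) \<longlonglongrightarrow> C"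
    using bounded_imp_convergent_subsequence by blast
  define t where "t = r \<circ> s"
  have t: "strict_mono t" unfolding t_def using f(2) s(1) by (rule strict_mono_o)
  have unif': "\<exists>N. \<forall>n x. n \<ge> N \<and> x \<in> {0..L} \<longrightarrow> \<bar>F (t n) x - f x\<bar> < e" if e: "0 < e" for e
  proof -
    obtain N where N: "\<And>n x. n \<ge> N \<Longrightarrow> x \<in> {0..L} \<Longrightarrow> norm (F (r n) x - f x) < e" using unif[OF e] by blast
    have "\<bar>F (t n) x - f x\<bar> < e" if "n \<ge> N" "x \<in> {0..L}" for n x
      using N[of "s n" x] that seq_suble[OF s(1), of n] by (simp add: t_def)
    then show ?thesis by blast
  qed
  have U: "uniform_limit {0..L} (F \<circ> t) f sequentially"
  proof (rule uniform_limitI)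
    fix e :: real assume "0 < e"
    then show "\<forall>\<^sub>F n in sequentially. \<forall>x\<in>{0..L}. dist ((F \<circ> t) n x) (f x) < e"
      using unif'[of e] unfolding eventually_sequentially dist_real_def o_def by blast
  qed
  have pt: "(\<lambda>n. F (t n) x) \<longlonglongrightarrow> f x" if "x \<in> {0..L}" for x
    using tendsto_uniform_limitI[OF U that] by (simp add: o_def)
  \<comment> \<open>The uniform limit acquires a weak derivative whose squared norm is at most the
    limit of the kinetic energies.\<close>
  have "\<exists>h. L2_on L h \<and> integral {0..L} (\<lambda>x. (h x)\<^sup>2) \<le> C \<and> (\<forall>x\<in>{0..L}. integral {0..x} h = f x - f 0)"
  proof (rule weak_derivative_limit[OF L, of "\<lambda>n. G (t n)"])
    show "L2_on L (G (t n))" for n by (rule H1_on_interval_L2[OF H])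
    show "(\<lambda>n. integral {0..L} (\<lambda>x. (G (t n) x)\<^sup>2)) \<longlonglongrightarrow> C" using s(2) by (simp add: t_def o_def)
    fix e :: real assume e: "0 < e"
    obtain N where N: "\<And>n x. n \<ge> N \<Longrightarrow> x \<in> {0..L} \<Longrightarrow> \<bar>F (t n) x - f x\<bar> < e / 2" using unif'[of "e/2"] e by auto
    have "\<bar>integral {0..x} (G (t n)) - (f x - f 0)\<bar> \<le> e" if "n \<ge> N" "x \<in> {0..L}" for n x
    proof -
      have "integral {0..x} (G (t n)) = F (t n) x - F (t n) 0" using ac_on_eq[OF ac, of x "t n"] that by simp
      then show ?thesis using N[OF that] N[OF that(1), of 0] L by (simp only: atLeastAtMost_iff) linarith
    qed
    then show "\<exists>N. \<forall>n\<ge>N. \<forall>x\<in>{0..L}. \<bar>integral {0..x} (G (t n)) - (f x - f 0)\<bar> \<le> e" by blast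
  qed
  then obtain h where h: "L2_on L h" "integral {0..L} (\<lambda>x. (h x)\<^sup>2) \<le> C" "\<And>x. x \<in> {0..L} \<Longrightarrow> integral {0..x} h = f x - f 0"
    by blast
  have Hf: "H1_on {0..L} f h" by (rule H1_on_intervalI[OF h(3) h(1) f(1)])
  have pw: "(\<lambda>n. integral {0..L} (\<lambda>x. F (t n) x ^ p)) \<longlonglongrightarrow> integral {0..L} (\<lambda>x. f x ^ p)" for p
    by (rule integral_power_limit[where B = S]) (use ac_on_continuous[OF ac] bnd pt in auto)
  have "edge_limit {0..L} (F \<circ> t) (G \<circ> t) f h (integral {0..L} (\<lambda>x. (f x)\<^sup>2)) (C / 2 - integral {0..L} (\<lambda>x. f x ^ 6) / 6)"
    unfolding edge_limit_def
  proof (intro conjI allI impI)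
    show "(\<lambda>n. (F \<circ> t) n 0) \<longlonglongrightarrow> f 0" using pt[of 0] L by (simp add: o_def)
    show "(\<lambda>n. integral {0..L} (\<lambda>x. ((F \<circ> t) n x)\<^sup>2)) \<longlonglongrightarrow> integral {0..L} (\<lambda>x. (f x)\<^sup>2)"
      using pw[of 2] by (simp add: o_def)
    have "(\<lambda>n. integral {0..L} (\<lambda>x. (G (t n) x)\<^sup>2)) \<longlonglongrightarrow> C" using s(2) by (simp add: t_def o_def)
    then show "(\<lambda>n. En {0..L} ((F \<circ> t) n) ((G \<circ> t) n)) \<longlonglongrightarrow> C / 2 - integral {0..L} (\<lambda>x. f x ^ 6) / 6"
      unfolding En_def o_def using pw[of 6] by (intro tendsto_intros) auto
    show "En {0..L} f h \<le> C / 2 - integral {0..L} (\<lambda>x. f x ^ 6) / 6" using h(2) by (simp add: En_def)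
  qed (use Hf U in auto)
  then show ?thesis using t by blast
qed

section \<open>Compactness on halflines\<close>

lemma halfline_power6_bound:
  assumes H: "H1_on {0..} f g"
  shows "integral {0..} (\<lambda>x. f x ^ 6) \<le>
    4 * (integral {0..} (\<lambda>x. (f x)\<^sup>2) * integral {0..} (\<lambda>x. (g x)\<^sup>2)) * integral {0..} (\<lambda>x. (f x)\<^sup>2)"
proof -
  let ?B = "4 * (integral {0..} (\<lambda>x. (f x)\<^sup>2) * integral {0..} (\<lambda>x. (g x)\<^sup>2))"
  have "integral {0..} (\<lambda>x. f x ^ 6) \<le> integral {0..} (\<lambda>x. ?B * (f x)\<^sup>2)"
  proof (rule integral_le)
    show "(\<lambda>x. f x ^ 6) integrable_on {0..}" by (rule set_borel_integral_eq_integral(1)[OF halfline_power6_integrable[OF H]])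
    show "(\<lambda>x. ?B * (f x)\<^sup>2) integrable_on {0..}" by (rule integrable_on_mult_right[OF H1_on_square_integrable(2)[OF H]])
    fix x :: real assume "x \<in> {0..}"
    then have "f x ^ 4 * (f x)\<^sup>2 \<le> ?B * (f x)\<^sup>2" using halfline_sup_bound[OF H] by (intro mult_right_mono) auto
    then show "f x ^ 6 \<le> ?B * (f x)\<^sup>2" by (simp flip: power_add)
  qed
  then show ?thesis by simp
qed

lemma H1_on_zero: "S = {0..} \<or> S = {0..L} \<Longrightarrow> H1_on S (\<lambda>_. 0) (\<lambda>_. 0)"
  by (rule H1_on_C1) (auto simp: set_integrable_def)

lemma halfline_energy_lower_bound:
  assumes H: "H1_on {0..} f g" and eta: "0 < eta" "om * integral {0..} (\<lambda>x. (f x)\<^sup>2) + eta < pi"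
  shows "om / 4 * (cot (om * integral {0..} (\<lambda>x. (f x)\<^sup>2) + eta) * f 0 ^ 4) \<le> 2 * En {0..} f g"
  using halfline_calibration[OF H less_imp_le[OF om_pos] eta] unfolding En_def om_square by simp

lemma isCont_cot': "0 < x \<Longrightarrow> x < pi \<Longrightarrow> isCont cot (x::real)"
  using sin_gt_zero[of x] by (intro isCont_cot) auto

text \<open>Only the three numbers boundary value, mass and energy are passed to the limit. The
  calibration bound survives this limit, and the soliton tail attains it. The gap between
  \<open>M\<close> and \<open>mu_R\<close> leaves room for a fixed padding
  \<open>eta\<close>.\<close>

lemma halfline_compactness:
  assumes H: "\<And>n. H1_on {0..} (F n) (G n)" and MR: "M < mu_R"
    and B: "\<And>n. integral {0..} (\<lambda>x. (G n x)\<^sup>2) \<le> B" and M: "\<And>n. integral {0..} (\<lambda>x. (F n x)\<^sup>2) \<le> M"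
  shows "\<exists>r f g m \<epsilon>. strict_mono (r :: nat \<Rightarrow> nat) \<and> edge_limit {0..} (F \<circ> r) (G \<circ> r) f g m \<epsilon>"
proof -
  define k where "k n = integral {0..} (\<lambda>x. (G n x)\<^sup>2)" for n
  define \<mu> where "\<mu> n = integral {0..} (\<lambda>x. (F n x)\<^sup>2)" for n
  define e where "e n = En {0..} (F n) (G n)" for n
  have nn: "0 \<le> k n" "0 \<le> \<mu> n" for n
    using H1_on_square_integrable[OF H] by (auto intro!: integral_nonneg simp: k_def \<mu>_def)
  have kB: "k n \<le> B" and mM: "\<mu> n \<le> M" for n using B M by (auto simp: k_def \<mu>_def)
  have BM: "0 \<le> B" "0 \<le> M" using nn[of 0] kB[of 0] mM[of 0] by auto
  have a4: "F n 0 ^ 4 \<le> 4 * (\<mu> n * k n)" for n using halfline_sup_bound[OF H, of 0 n] by (simp add: \<mu>_def k_def)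
  have a4': "F n 0 ^ 4 \<le> 4 * (\<mu> n * B)" for n
    using a4[of n] mult_left_mono[OF kB nn(2), of n n] by linarith
  have a4'': "F n 0 ^ 4 \<le> 4 * (M * B)" for n
    using a4'[of n] mult_right_mono[OF mM BM(1), of n] by linarith
  have "bounded (range (\<lambda>n. (F n 0, \<mu> n, e n)))"
  proof -
    have b1: "\<bar>F n 0\<bar> \<le> 1 + 4 * (M * B)" for n
    proof (cases "\<bar>F n 0\<bar> \<le> 1")
      case True then show ?thesis using BM by (simp add: add_increasing2)
    next
      case False
      then have "\<bar>F n 0\<bar> ^ 1 \<le> \<bar>F n 0\<bar> ^ 4" by (intro power_increasing) auto
      then show ?thesis using a4''[of n] by simp
    qed
    have b2: "\<bar>e n\<bar> \<le> B + 4 * (M * B) * M" for n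
    proof -
      have "0 \<le> integral {0..} (\<lambda>x. F n x ^ 6)"
        using set_borel_integral_eq_integral(1)[OF halfline_power6_integrable[OF H]] by (intro integral_nonneg) auto
      moreover have "integral {0..} (\<lambda>x. F n x ^ 6) \<le> 4 * (M * B) * M"
      proof -
        have "integral {0..} (\<lambda>x. F n x ^ 6) \<le> 4 * (\<mu> n * k n) * \<mu> n"
          using halfline_power6_bound[OF H, of n] by (simp add: \<mu>_def k_def)
        also have "\<dots> \<le> 4 * (M * B) * M" using nn[of n] kB[of n] mM[of n] BM by (intro mult_mono) auto
        finally show ?thesis .
      qed
      ultimately show ?thesis using nn(1)[of n] kB[of n] by (simp add: e_def En_def k_def abs_le_iff)
    qed
    have "bounded (range (\<lambda>n. F n 0))" using b1 by (intro boundedI) auto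
    moreover have "bounded (range \<mu>)" using mM nn by (intro boundedI[of _ M]) auto
    moreover have "bounded (range e)" using b2 by (intro boundedI) auto
    ultimately have "bounded (range (\<lambda>n. F n 0) \<times> range \<mu> \<times> range e)" by (intro bounded_Times)
    then show ?thesis by (rule bounded_subset) auto
  qed
  then obtain l r where r: "strict_mono (r :: nat \<Rightarrow> nat)" "((\<lambda>n. (F n 0, \<mu> n, e n)) \<circ> r) \<longlonglongrightarrow> l"
    using bounded_imp_convergent_subsequence by blast
  obtain a m \<epsilon> where l: "l = (a, m, \<epsilon>)" by (cases l)
  have la: "(\<lambda>n. F (r n) 0) \<longlonglongrightarrow> a" and lm: "(\<lambda>n. \<mu> (r n)) \<longlonglongrightarrow> m" and le: "(\<lambda>n. e (r n)) \<longlonglongrightarrow> \<epsilon>"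
    using tendsto_fst[OF r(2)] tendsto_fst[OF tendsto_snd[OF r(2)]] tendsto_snd[OF tendsto_snd[OF r(2)]]
    by (auto simp: o_def l)
  have m: "0 \<le> m" "m \<le> M"
    using LIMSEQ_le_const[OF lm, of 0] LIMSEQ_le_const2[OF lm, of M] nn mM by auto
  have omM: "om * m \<le> om * M" "om * M < pi" using m MR om_pos om_mu_R mult_strict_left_mono[OF MR om_pos] by auto
  have low: "om / 4 * (cot (om * m + eta) * a ^ 4) \<le> 2 * \<epsilon>" if eta: "0 < eta" "om * M + eta < pi" for eta
  proof (rule LIMSEQ_le)
    have "om / 4 * (cot (om * \<mu> n + eta) * F n 0 ^ 4) \<le> 2 * e n" for n
      unfolding \<mu>_def e_def
      by (rule halfline_energy_lower_bound[OF H eta(1)]) (use mult_left_mono[OF M less_imp_le[OF om_pos], of n] eta in linarith)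
    then show "\<exists>N. \<forall>n\<ge>N. om / 4 * (cot (om * \<mu> (r n) + eta) * F (r n) 0 ^ 4) \<le> 2 * e (r n)" by blast
    have "isCont cot (om * m + eta)"
    proof (rule isCont_cot')
      show "0 < om * m + eta" using eta om_pos m by (intro add_nonneg_pos) auto
      show "om * m + eta < pi" using eta omM by linarith
    qed
    then have "(\<lambda>n. cot (om * \<mu> (r n) + eta)) \<longlonglongrightarrow> cot (om * m + eta)"
      by (rule isCont_tendsto_compose) (intro tendsto_intros lm)
    then show "(\<lambda>n. om / 4 * (cot (om * \<mu> (r n) + eta) * F (r n) 0 ^ 4)) \<longlonglongrightarrow> om / 4 * (cot (om * m + eta) * a ^ 4)"
      by (intro tendsto_intros la)
    show "(\<lambda>n. 2 * e (r n)) \<longlonglongrightarrow> 2 * \<epsilon>" by (intro tendsto_intros le)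
  qed
  have "\<exists>f g. H1_on {0..} f g \<and> f 0 = a \<and> integral {0..} (\<lambda>x. (f x)\<^sup>2) \<le> m \<and> En {0..} f g \<le> \<epsilon>"
  \<comment> \<open>With vanishing boundary value the zero function serves, and the mass may be
    lost; otherwise the tail keeps the whole mass \<open>m\<close>.\<close>
  proof (cases "a = 0")
    case True
    have "0 \<le> \<epsilon>" using low[of "(pi - om * M) / 2"] omM True by (simp add: field_simps)
    then have "En {0..} (\<lambda>_. 0) (\<lambda>_. 0) \<le> \<epsilon>" by (simp add: En_def)
    then show ?thesis using True H1_on_zero[of "{0..}"] m by (intro exI[of _ "\<lambda>_. 0"]) auto
  next
    case False
    have "a ^ 4 \<le> 4 * (m * B)"
      by (rule LIMSEQ_le[of "\<lambda>n. F (r n) 0 ^ 4" _ "\<lambda>n. 4 * (\<mu> (r n) * B)"])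
        (use a4' in \<open>auto intro!: tendsto_intros la lm\<close>)
    moreover have "0 < a ^ 4" using False by simp
    \<comment> \<open>A nonzero boundary value needs mass, because a^4 <= 4 m B.\<close>
    ultimately have m0: "0 < m" using m BM by (cases "m = 0") auto
    obtain f g where fg: "H1_on {0..} f g" "f 0 = a" "integral {0..} (\<lambda>x. (f x)\<^sup>2) = m"
      "integral {0..} (\<lambda>x. (g x)\<^sup>2) - 1 / 3 * integral {0..} (\<lambda>x. f x ^ 6) = om / 4 * (cot (om * m) * a ^ 4)"
      using soliton_tail[OF False m0] m MR by auto
    \<comment> \<open>The padding was needed only along the sequence; here it tends to 0.\<close>
    have "om / 4 * (cot (om * m) * a ^ 4) \<le> 2 * \<epsilon>"
    proof (rule tendsto_upperbound)
      have "isCont cot (om * m)" using le_less_trans[OF omM] om_pos m0 by (intro isCont_cot') simp_all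
      then have "((\<lambda>eta. cot (om * m + eta)) \<longlongrightarrow> cot (om * m)) (at_right 0)"
      proof (rule isCont_tendsto_compose)
        have "((\<lambda>eta. om * m + eta) \<longlongrightarrow> om * m + 0) (at_right 0)" by (rule tendsto_add[OF tendsto_const tendsto_ident_at])
        then show "((\<lambda>eta. om * m + eta) \<longlongrightarrow> om * m) (at_right 0)" by simp
      qed
      then show "((\<lambda>eta. om / 4 * (cot (om * m + eta) * a ^ 4)) \<longlongrightarrow> om / 4 * (cot (om * m) * a ^ 4)) (at_right 0)"
        by (rule tendsto_mult_left[OF tendsto_mult_right])
      show "\<forall>\<^sub>F eta in at_right 0. om / 4 * (cot (om * m + eta) * a ^ 4) \<le> 2 * \<epsilon>"
        using low omM(2) by (auto simp: eventually_at_right_field intro!: exI[of _ "pi - om * M"])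
    qed simp
    then have "En {0..} f g \<le> \<epsilon>" using fg(4) by (simp add: En_def)
    then show ?thesis using fg by auto
  qed
  then obtain f g where "H1_on {0..} f g" "f 0 = a" "integral {0..} (\<lambda>x. (f x)\<^sup>2) \<le> m" "En {0..} f g \<le> \<epsilon>" by blast
  then have "edge_limit {0..} (F \<circ> r) (G \<circ> r) f g m \<epsilon>"
    unfolding edge_limit_def using la lm le by (auto simp: o_def \<mu>_def e_def)
  then show ?thesis using r(1) by blast
qed

section \<open>Coercivity on metric graphs\<close>

lemma edge_H1_iff: "edge_H1 G e f g \<longleftrightarrow> H1_on (edom G e) f g"
  unfolding edge_H1_def H1_on_def by simp

locale nls_graph =
  fixes G :: "('v, 'e) mgraph"
  assumes metric: "metric_graph G" and connected: "connected_mgraph G" and noncompact: "noncompact G"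
begin

abbreviation "bounded_edges \<equiv> edges G - hlines G"

lemma finite_edges: "finite (edges G)" "finite (hlines G)" "finite bounded_edges"
  using metric finite_subset by (auto simp: metric_graph_def)

lemma hlines_edges: "e \<in> hlines G \<Longrightarrow> e \<in> edges G"
  using metric by (auto simp: metric_graph_def)

lemma len_pos: "e \<in> bounded_edges \<Longrightarrow> 0 < len G e"
  using metric by (auto simp: metric_graph_def)

lemma edom_simps: "e \<in> hlines G \<Longrightarrow> edom G e = {0..}" "e \<notin> hlines G \<Longrightarrow> edom G e = {0..len G e}"
  by (auto simp: edom_def)

lemma sum_edges: "(\<Sum>e\<in>edges G. h e) = (\<Sum>e\<in>hlines G. h e) + (\<Sum>e\<in>bounded_edges. h e)" for h :: "'e \<Rightarrow> real"
  using sum.subset_diff[of "hlines G" "edges G" h] finite_edges hlines_edges by (auto simp: add.commute)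

definition em :: "('e \<Rightarrow> real \<Rightarrow> real) \<Rightarrow> 'e \<Rightarrow> real" where
  "em u e = integral (edom G e) (\<lambda>x. (u e x)\<^sup>2)"

definition e6 :: "('e \<Rightarrow> real \<Rightarrow> real) \<Rightarrow> 'e \<Rightarrow> real" where
  "e6 u e = integral (edom G e) (\<lambda>x. u e x ^ 6)"

lemma H1_edge: "H1 G u g \<Longrightarrow> e \<in> edges G \<Longrightarrow> H1_on (edom G e) (u e) (g e)"
  by (simp add: H1_def edge_H1_iff)

lemma H1_power6_integrable:
  assumes "H1_on (edom G e) f g"
  shows "set_integrable lborel (edom G e) (\<lambda>x. f x ^ 6)"
proof (cases "e \<in> hlines G")
  case True
  then show ?thesis using halfline_power6_integrable assms by (simp add: edom_simps)
next
  case False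
  then have "continuous_on {0..len G e} f" using H1_on_continuous[OF assms] by (auto simp: edom_simps)
  then show ?thesis using False
    by (simp add: edom_simps) (intro borel_integrable_atLeastAtMost' continuous_intros)
qed

lemma mass_eq: "H1 G u g \<Longrightarrow> mass G u = (\<Sum>e\<in>edges G. em u e)"
  unfolding mass_def gint_def em_def
  by (intro sum.cong refl set_borel_integral_eq_integral(2) H1_onD(3)[OF H1_edge])

lemma kin_eq: "H1 G u g \<Longrightarrow> kin G g = (\<Sum>e\<in>edges G. em g e)"
  unfolding kin_def gint_def em_def
  by (intro sum.cong refl set_borel_integral_eq_integral(2) H1_onD(2)[OF H1_edge])

lemma L6_eq: "H1 G u g \<Longrightarrow> L6 G u = (\<Sum>e\<in>edges G. e6 u e)"
  unfolding L6_def gint_def e6_def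
  by (intro sum.cong refl set_borel_integral_eq_integral(2) H1_power6_integrable[OF H1_edge])

lemma energy_eq: "H1 G u g \<Longrightarrow> energy G u g = (\<Sum>e\<in>edges G. En (edom G e) (u e) (g e))"
  unfolding energy_def kin_eq L6_eq En_def em_def e6_def
  by (simp add: sum_subtractf flip: sum_divide_distrib)

lemma em_nonneg: "H1 G u g \<Longrightarrow> e \<in> edges G \<Longrightarrow> 0 \<le> em u e" "H1 G u g \<Longrightarrow> e \<in> edges G \<Longrightarrow> 0 \<le> em g e"
  unfolding em_def using H1_on_square_integrable[OF H1_edge] by (auto intro!: integral_nonneg)

lemma e6_nonneg: "H1 G u g \<Longrightarrow> e \<in> edges G \<Longrightarrow> 0 \<le> e6 u e"
  unfolding e6_def using set_borel_integral_eq_integral(1)[OF H1_power6_integrable[OF H1_edge]] by (auto intro!: integral_nonneg)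

lemma nonneg:
  assumes "H1 G u g"
  shows "0 \<le> mass G u" "0 \<le> kin G g" "0 \<le> L6 G u"
  unfolding mass_eq[OF assms] kin_eq[OF assms] L6_eq[OF assms]
  using em_nonneg[OF assms] e6_nonneg[OF assms] by (auto intro!: sum_nonneg)

lemma em_le:
  assumes "H1 G u g" "e \<in> edges G"
  shows "em u e \<le> mass G u" "em g e \<le> kin G g"
  unfolding mass_eq[OF assms(1)] kin_eq[OF assms(1)]
  using em_nonneg[OF assms(1)] assms(2) finite_edges by (auto intro!: member_le_sum)

text \<open>Ends of edges at finite vertices: \<open>True\<close> is the source end,
  \<open>False\<close> the target end. A self-loop contributes both ends at one vertex, in agreement
  with \<open>deg\<close>.\<close>

definition half_edges :: "('e \<times> bool) set" where
  "half_edges = edges G \<times> {True} \<union> bounded_edges \<times> {False}"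

definition anchor :: "'e \<times> bool \<Rightarrow> 'v" where
  "anchor i = (if snd i then src G (fst i) else tgt G (fst i))"

lemma finite_half_edges: "finite half_edges"
  using finite_edges by (auto simp: half_edges_def)

lemma anchor_verts: "i \<in> half_edges \<Longrightarrow> anchor i \<in> verts G"
  using metric by (auto simp: half_edges_def anchor_def metric_graph_def)

lemma card_half_edges_at: "card {i \<in> half_edges. anchor i = v} = deg G v"
proof -
  have "{i \<in> half_edges. anchor i = v} = {e \<in> edges G. src G e = v} \<times> {True} \<union> {e \<in> bounded_edges. tgt G e = v} \<times> {False}"
    by (auto simp: half_edges_def anchor_def)
  also have "card \<dots> = card ({e \<in> edges G. src G e = v} \<times> {True}) + card ({e \<in> bounded_edges. tgt G e = v} \<times> {False})"
    using finite_edges by (intro card_Un_disjoint) auto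
  finally show ?thesis by (simp add: deg_def card_cartesian_product)
qed

lemma sum_half_edges:
  fixes h :: "'e \<times> bool \<Rightarrow> real"
  shows "(\<Sum>i\<in>half_edges. h i) = (\<Sum>e\<in>hlines G. h (e, True)) + (\<Sum>e\<in>bounded_edges. h (e, True) + h (e, False))"
proof -
  have "(\<Sum>i\<in>half_edges. h i) = (\<Sum>i\<in>edges G \<times> {True}. h i) + (\<Sum>i\<in>bounded_edges \<times> {False}. h i)"
    unfolding half_edges_def using finite_edges by (intro sum.union_disjoint) auto
  also have "\<dots> = (\<Sum>e\<in>edges G. h (e, True)) + (\<Sum>e\<in>bounded_edges. h (e, False))"
  proof -
    have "(\<Sum>i\<in>A \<times> {b}. h i) = (\<Sum>e\<in>A. h (e, b))" for A b
      by (rule sum.reindex_bij_witness[of _ "\<lambda>e. (e, b)" fst]) auto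
    then show ?thesis by simp
  qed
  finally show ?thesis by (simp add: sum_edges sum.distrib)
qed

text \<open>All calibrations are added and the boundary terms regrouped by vertices, where the
  absence of terminal points makes the cotangent sums nonnegative. What is lost at the cuts is of
  order sqrt \<open>\<tau>\<close>.\<close>

lemma coercivity:
  assumes no_term: "\<forall>v. \<not> terminal_point G v"
  shows "\<exists>C\<ge>0. \<forall>u g. H1 G u g \<and> mass G u < mu_R \<and> energy G u g \<le> 0 \<longrightarrow>
    (\<exists>\<tau>. 0 < \<tau> \<and> mu_R - mass G u \<le> \<tau> \<and> \<tau> \<le> mu_R - (\<Sum>h\<in>hlines G. em u h) \<and>
      \<tau> / mu_R * kin G g - C * sqrt \<tau> \<le> 2 * energy G u g)"
proof -
  define N where "N = real (card half_edges)"
  obtain h0 where h0: "h0 \<in> hlines G" using noncompact by (auto simp: noncompact_def)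
  then have "(h0, True) \<in> half_edges" using hlines_edges by (auto simp: half_edges_def)
  then have N: "0 < N" using finite_half_edges unfolding N_def by (auto simp: card_gt_0_iff)
  define D where "D = (\<Sum>e\<in>bounded_edges. om * (64 / len G e)\<^sup>2)"
  have D: "0 \<le> D" unfolding D_def using om_pos by (intro sum_nonneg) auto
  define C where "C = D * (mu_R + 4 * N / om)"
  have C: "0 \<le> C" unfolding C_def using D N om_pos mu_R_pos by simp
  have "\<exists>\<tau>. 0 < \<tau> \<and> mu_R - mass G u \<le> \<tau> \<and> \<tau> \<le> mu_R - (\<Sum>h\<in>hlines G. em u h) \<and>
      \<tau> / mu_R * kin G g - C * sqrt \<tau> \<le> 2 * energy G u g"
    if H: "H1 G u g" and mass: "mass G u < mu_R" and neg: "energy G u g \<le> 0" for u g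
  proof -
    obtain \<phi> where phi: "\<And>e. e \<in> edges G \<Longrightarrow> u e 0 = \<phi> (src G e)"
      "\<And>e. e \<in> bounded_edges \<Longrightarrow> u e (len G e) = \<phi> (tgt G e)"
      using H unfolding H1_def by auto
    have "\<forall>e\<in>bounded_edges. \<exists>m1 m2 r. 0 \<le> m1 \<and> 0 \<le> m2 \<and> 0 \<le> r \<and> m1 + m2 + r = em u e \<and>
      (\<forall>k eta. 0 \<le> k \<and> k \<le> 2 * om \<and> 0 < eta \<and> k * m1 + eta < pi \<and> k * m2 + eta < pi \<longrightarrow>
        k / 4 * (cot (k * m1 + eta) * u e 0 ^ 4 + cot (k * m2 + eta) * u e (len G e) ^ 4)
          - om * (64 / len G e)\<^sup>2 * (r * sqrt r) * (1 + 1 / eta) \<le> em g e - k\<^sup>2 / 4 * e6 u e)"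
    proof
      fix e assume e: "e \<in> bounded_edges"
      then have He: "H1_on {0..len G e} (u e) (g e)" using H1_edge[OF H, of e] by (simp add: edom_simps)
      have "em u e \<le> mu_R" using em_le(1)[OF H, of e] mass e by auto
      then show "\<exists>m1 m2 r. 0 \<le> m1 \<and> 0 \<le> m2 \<and> 0 \<le> r \<and> m1 + m2 + r = em u e \<and>
      (\<forall>k eta. 0 \<le> k \<and> k \<le> 2 * om \<and> 0 < eta \<and> k * m1 + eta < pi \<and> k * m2 + eta < pi \<longrightarrow>
        k / 4 * (cot (k * m1 + eta) * u e 0 ^ 4 + cot (k * m2 + eta) * u e (len G e) ^ 4)
          - om * (64 / len G e)\<^sup>2 * (r * sqrt r) * (1 + 1 / eta) \<le> em g e - k\<^sup>2 / 4 * e6 u e)"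
        using interval_calibration[OF H1_on_ac[OF He order_refl] H1_on_square_integrable(1)[OF He] len_pos[OF e]] e
        unfolding em_def e6_def by (simp add: edom_simps)
    qed
    then obtain m1 m2 r where m: "\<And>e. e \<in> bounded_edges \<Longrightarrow> 0 \<le> m1 e \<and> 0 \<le> m2 e \<and> 0 \<le> r e \<and> m1 e + m2 e + r e = em u e"
      and cal: "\<And>e k eta. e \<in> bounded_edges \<Longrightarrow> 0 \<le> k \<Longrightarrow> k \<le> 2 * om \<Longrightarrow> 0 < eta \<Longrightarrow> k * m1 e + eta < pi \<Longrightarrow> k * m2 e + eta < pi \<Longrightarrow>
        k / 4 * (cot (k * m1 e + eta) * u e 0 ^ 4 + cot (k * m2 e + eta) * u e (len G e) ^ 4)
          - om * (64 / len G e)\<^sup>2 * (r e * sqrt (r e)) * (1 + 1 / eta) \<le> em g e - k\<^sup>2 / 4 * e6 u e"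
      by metis
    \<comment> \<open>Mass charged to an end: a whole halfline, or the piece of a bounded edge up to
      the nearer cut.\<close>
    define mm where "mm i = (if snd i then if fst i \<in> hlines G then em u (fst i) else m1 (fst i) else m2 (fst i))" for i
    have mm0: "0 \<le> mm i" if "i \<in> half_edges" for i
      using that m em_nonneg(1)[OF H] by (auto simp: half_edges_def mm_def)
    define R where "R = (\<Sum>e\<in>bounded_edges. r e)"
    \<comment> \<open>The part of the budget \<open>mu_R\<close> not charged to any end: missing
      mass plus mass between cuts.\<close>
    define \<tau> where "\<tau> = mu_R - mass G u + R"
    have R0: "0 \<le> R" unfolding R_def using m by (intro sum_nonneg) auto
    have tau: "0 < \<tau>" "mu_R - mass G u \<le> \<tau>" using R0 mass by (auto simp: \<tau>_def)
    have mass_split: "mass G u = (\<Sum>h\<in>hlines G. em u h) + (\<Sum>e\<in>bounded_edges. em u e)"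
      using mass_eq[OF H] sum_edges by simp
    have summm: "(\<Sum>i\<in>half_edges. mm i) = mu_R - \<tau>"
    proof -
      have "(\<Sum>i\<in>half_edges. mm i) = (\<Sum>e\<in>hlines G. em u e) + (\<Sum>e\<in>bounded_edges. m1 e + m2 e)"
        unfolding sum_half_edges by (intro arg_cong2[of _ _ _ _ "(+)"] sum.cong) (auto simp: mm_def)
      also have "(\<Sum>e\<in>bounded_edges. m1 e + m2 e) = (\<Sum>e\<in>bounded_edges. em u e - r e)"
        by (intro sum.cong refl) (use m in force)
      finally show ?thesis by (simp add: mass_split \<tau>_def R_def sum_subtractf)
    qed
    have "R \<le> (\<Sum>e\<in>bounded_edges. em u e)" unfolding R_def using m by (intro sum_mono) force
    then have tau2: "\<tau> \<le> mu_R - (\<Sum>h\<in>hlines G. em u h)" by (simp add: \<tau>_def mass_split)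
    have "0 \<le> (\<Sum>h\<in>hlines G. em u h)" using em_nonneg(1)[OF H] hlines_edges by (intro sum_nonneg) auto
    then have tau3: "\<tau> \<le> mu_R" using tau2 by linarith
    \<comment> \<open>Of the spare phase om \<open>\<tau>\<close>, one half pays for raising
      \<open>k\<close> above \<open>om\<close>, one quarter for the \<open>N\<close> paddings
      \<open>eta\<close>, and one quarter keeps the sum strictly below pi.\<close>
    define k where "k = om * (1 + \<tau> / (2 * mu_R))"
    define eta where "eta = om * \<tau> / (4 * N)"
    have "\<tau> / (2 * mu_R) \<le> 1" using tau3 mu_R_pos by (simp add: divide_simps)
    then have k: "0 \<le> k" "k \<le> 2 * om"
      using om_pos tau mu_R_pos mult_left_mono[of "1 + \<tau> / (2 * mu_R)" 2 om] by (auto simp: k_def)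
    have eta: "0 < eta" using om_pos tau N by (simp add: eta_def)
    define \<beta> where "\<beta> i = k * mm i + eta" for i
    have b0: "0 < \<beta> i" if "i \<in> half_edges" for i using mm0[OF that] k eta by (simp add: \<beta>_def add_nonneg_pos)
    have bsum: "(\<Sum>i\<in>half_edges. \<beta> i) < pi"
    proof -
      have "(\<Sum>i\<in>half_edges. \<beta> i) = k * (mu_R - \<tau>) + N * eta"
        unfolding \<beta>_def by (simp add: sum.distrib summm N_def flip: sum_distrib_left)
      also have "k * (mu_R - \<tau>) \<le> om * (mu_R - \<tau> / 2)"
      proof -
        have "(1 + \<tau> / (2 * mu_R)) * (mu_R - \<tau>) = mu_R - \<tau> / 2 - \<tau> * \<tau> / (2 * mu_R)"
          using mu_R_pos by (simp add: field_simps)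
        also have "\<dots> \<le> mu_R - \<tau> / 2" using mu_R_pos by simp
        finally show ?thesis unfolding k_def mult.assoc using om_pos by (intro mult_left_mono) auto
      qed
      also have "N * eta = om * \<tau> / 4" using N by (simp add: eta_def)
      finally have "(\<Sum>i\<in>half_edges. \<beta> i) \<le> om * mu_R - om * \<tau> / 4" by (simp add: algebra_simps)
      then show ?thesis using om_mu_R mult_pos_pos[OF om_pos tau(1)] by simp
    qed
    have bpi: "\<beta> i < pi" if "i \<in> half_edges" for i
      using member_le_sum[OF that, of \<beta>] b0 finite_half_edges bsum by (force intro: less_imp_le)
    define err where "err e = om * (64 / len G e)\<^sup>2 * (r e * sqrt (r e)) * (1 + 1 / eta)" for e
    \<comment> \<open>Continuity at a vertex gives all its ends the common factor
      \<open>\<phi> v ^ 4\<close>, so only the sum of cotangents matters.\<close>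
    have vert: "0 \<le> (\<Sum>i\<in>half_edges. cot (\<beta> i) * \<phi> (anchor i) ^ 4)"
    proof -
      have "(\<Sum>i\<in>half_edges. cot (\<beta> i) * \<phi> (anchor i) ^ 4) =
        (\<Sum>v\<in>verts G. \<Sum>i\<in>{i\<in>half_edges. anchor i = v}. cot (\<beta> i) * \<phi> (anchor i) ^ 4)"
        using finite_half_edges metric anchor_verts by (intro sum.group[symmetric]) (auto simp: metric_graph_def)
      also have "\<dots> = (\<Sum>v\<in>verts G. (\<Sum>i\<in>{i\<in>half_edges. anchor i = v}. cot (\<beta> i)) * \<phi> v ^ 4)"
        unfolding sum_distrib_right by (intro sum.cong refl) auto
      also have "0 \<le> \<dots>"
      proof (rule sum_nonneg)
        fix v assume v: "v \<in> verts G"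
        have "0 \<le> (\<Sum>i\<in>{i\<in>half_edges. anchor i = v}. cot (\<beta> i))"
        proof (rule sum_cot_nonneg)
          show "card {i \<in> half_edges. anchor i = v} \<noteq> 1"
            using no_term v unfolding card_half_edges_at terminal_point_def by blast
          have "(\<Sum>i\<in>{i\<in>half_edges. anchor i = v}. \<beta> i) \<le> (\<Sum>i\<in>half_edges. \<beta> i)"
            using finite_half_edges b0 by (intro sum_mono2) (auto intro: less_imp_le)
          then show "(\<Sum>i\<in>{i\<in>half_edges. anchor i = v}. \<beta> i) \<le> pi" using bsum by simp
        qed (use finite_half_edges b0 in auto)
        then show "0 \<le> (\<Sum>i\<in>{i\<in>half_edges. anchor i = v}. cot (\<beta> i)) * \<phi> v ^ 4" by simp
      qed
      finally show ?thesis .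
    qed
    have hl: "k / 4 * (cot (\<beta> (h, True)) * \<phi> (anchor (h, True)) ^ 4) \<le> em g h - k\<^sup>2 / 4 * e6 u h" if h: "h \<in> hlines G" for h
    proof -
      have Hh: "H1_on {0..} (u h) (g h)" using H1_edge[OF H hlines_edges[OF h]] h by (simp add: edom_simps)
      have "\<beta> (h, True) < pi" using h hlines_edges by (intro bpi) (auto simp: half_edges_def)
      then show ?thesis
        using halfline_calibration[OF Hh k(1) eta] h phi(1)[OF hlines_edges[OF h]]
        by (simp add: \<beta>_def mm_def anchor_def em_def e6_def edom_simps)
    qed
    have be: "k / 4 * (cot (\<beta> (e, True)) * \<phi> (anchor (e, True)) ^ 4 + cot (\<beta> (e, False)) * \<phi> (anchor (e, False)) ^ 4) - err e
        \<le> em g e - k\<^sup>2 / 4 * e6 u e" if e: "e \<in> bounded_edges" for e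
    proof -
      have "\<beta> (e, True) < pi" "\<beta> (e, False) < pi" using e by (auto intro!: bpi simp: half_edges_def)
      then show ?thesis using cal[OF e k eta] e phi
        by (simp add: \<beta>_def mm_def anchor_def err_def)
    qed
    have "k / 4 * (\<Sum>i\<in>half_edges. cot (\<beta> i) * \<phi> (anchor i) ^ 4) - (\<Sum>e\<in>bounded_edges. err e) =
      (\<Sum>h\<in>hlines G. k / 4 * (cot (\<beta> (h, True)) * \<phi> (anchor (h, True)) ^ 4)) +
      (\<Sum>e\<in>bounded_edges. k / 4 * (cot (\<beta> (e, True)) * \<phi> (anchor (e, True)) ^ 4 + cot (\<beta> (e, False)) * \<phi> (anchor (e, False)) ^ 4) - err e)"
      unfolding sum_half_edges by (simp add: sum_subtractf sum_distrib_left distrib_left)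
    also have "\<dots> \<le> (\<Sum>h\<in>hlines G. em g h - k\<^sup>2 / 4 * e6 u h) + (\<Sum>e\<in>bounded_edges. em g e - k\<^sup>2 / 4 * e6 u e)"
      by (intro add_mono sum_mono hl be)
    also have "\<dots> = kin G g - k\<^sup>2 / 4 * L6 G u"
      unfolding kin_eq[OF H] L6_eq[OF H] sum_edges[symmetric] by (simp only: sum_subtractf sum_distrib_left)
    finally have "k / 4 * (\<Sum>i\<in>half_edges. cot (\<beta> i) * \<phi> (anchor i) ^ 4) - (\<Sum>e\<in>bounded_edges. err e) \<le> kin G g - k\<^sup>2 / 4 * L6 G u" .
    moreover have "0 \<le> k / 4 * (\<Sum>i\<in>half_edges. cot (\<beta> i) * \<phi> (anchor i) ^ 4)" using vert k by simp
    moreover have "(\<Sum>e\<in>bounded_edges. err e) \<le> C * sqrt \<tau>"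
    proof -
      have "err e \<le> om * (64 / len G e)\<^sup>2 * ((mu_R + 4 * N / om) * sqrt \<tau>)" if e: "e \<in> bounded_edges" for e
      proof -
        have "r e \<le> R" unfolding R_def using m finite_edges e by (intro member_le_sum) auto
        then have re: "0 \<le> r e" "r e \<le> \<tau>" using m[OF e] mass by (auto simp: \<tau>_def)
        have "r e * sqrt (r e) * (1 + 1 / eta) \<le> \<tau> * sqrt \<tau> * (1 + 1 / eta)"
          using re eta tau by (intro mult_right_mono mult_mono) auto
        also have "\<dots> = (\<tau> + \<tau> / eta) * sqrt \<tau>" by (simp add: algebra_simps)
        \<comment> \<open>Dividing by the padding costs one power of \<open>\<tau>\<close>; the
          power 3/2 gained at the cut points leaves sqrt \<open>\<tau>\<close>.\<close>
        also have "\<tau> / eta = 4 * N / om" using tau by (simp add: eta_def)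
        also have "(\<tau> + 4 * N / om) * sqrt \<tau> \<le> (mu_R + 4 * N / om) * sqrt \<tau>" using tau3 tau by (intro mult_right_mono) auto
        finally have "om * (64 / len G e)\<^sup>2 * (r e * sqrt (r e) * (1 + 1 / eta)) \<le> om * (64 / len G e)\<^sup>2 * ((mu_R + 4 * N / om) * sqrt \<tau>)"
          using om_pos by (intro mult_left_mono) auto
        then show ?thesis by (simp add: err_def mult.assoc)
      qed
      then have "(\<Sum>e\<in>bounded_edges. err e) \<le> (\<Sum>e\<in>bounded_edges. om * (64 / len G e)\<^sup>2 * ((mu_R + 4 * N / om) * sqrt \<tau>))"
        by (rule sum_mono)
      also have "\<dots> = D * ((mu_R + 4 * N / om) * sqrt \<tau>)" unfolding D_def by (rule sum_distrib_right[symmetric])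
      finally show ?thesis by (simp add: C_def)
    qed
    ultimately have low: "- (C * sqrt \<tau>) \<le> kin G g - k\<^sup>2 / 4 * L6 G u" by linarith
    \<comment> \<open>The enlarged \<open>k\<close> acts like an energy whose sixth-power term is
      multiplied by \<open>l\<close>.\<close>
    define l where "l = (1 + \<tau> / (2 * mu_R))\<^sup>2"
    have kl: "k\<^sup>2 / 4 = l / 3" unfolding k_def l_def by (simp add: power_mult_distrib om_square)
    have l: "1 + \<tau> / mu_R \<le> l"
    proof -
      have "l = 1 + \<tau> / mu_R + (\<tau> / (2 * mu_R))\<^sup>2" by (simp add: l_def power2_sum)
      then show ?thesis by simp
    qed
    then have l1: "1 \<le> l" using tau mu_R_pos by (smt (verit) divide_pos_pos)
    have "\<tau> / mu_R * kin G g - C * sqrt \<tau> \<le> (l - 1) * kin G g + (kin G g - k\<^sup>2 / 4 * L6 G u)"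
      using low l nonneg(2)[OF H] by (intro order_trans[OF _ add_mono[OF mult_right_mono[of "\<tau> / mu_R"] low]]) auto
    also have "\<dots> = 2 * (l * energy G u g)" unfolding kl energy_def by (simp add: algebra_simps)
    \<comment> \<open>Here nonpositive energy is essential: multiplication by l >= 1 can only lower
      it.\<close>
    also have "\<dots> \<le> 2 * energy G u g" using neg l1 mult_right_mono_neg[OF l1 neg] by simp
    finally show ?thesis using tau tau2 by blast
  qed
  then show ?thesis using C by blast
qed

end

section \<open>Scaling, the Gagliardo--Nirenberg inequality and test functions\<close>

lemma H1_on_scale:
  assumes "H1_on S f g"
  shows "H1_on S (\<lambda>x. c * f x) (\<lambda>x. c * g x)"
proof -
  have "set_borel_measurable lborel S (\<lambda>x. c * g x)"
  proof -
    have "(\<lambda>x. c * (indicator S x *\<^sub>R g x)) \<in> borel_measurable lborel"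
      using H1_onD(1)[OF assms] unfolding set_borel_measurable_def by measurable
    then show ?thesis unfolding set_borel_measurable_def by (simp add: mult.left_commute)
  qed
  moreover have "c * f x = c * f 0 + (LINT t:{0..x}|lborel. c * g t)" if "x \<in> S" for x
    using H1_onD(4)[OF assms that] by (simp add: algebra_simps)
  ultimately show ?thesis
    unfolding H1_on_def power_mult_distrib using H1_onD(2,3)[OF assms] by (intro conjI ballI) simp_all
qed

text \<open>A filler for the halflines of a test function that carry no soliton tail; its energy is
  estimated by dropping the sixth power.\<close>

lemma exp_halfline:
  shows "H1_on {0..} (\<lambda>x. a * exp (- x)) (\<lambda>x. - a * exp (- x))"
    and "integral {0..} (\<lambda>x. (a * exp (- x))\<^sup>2) = a\<^sup>2 / 2"
    and "En {0..} (\<lambda>x. a * exp (- x)) (\<lambda>x. - a * exp (- x)) \<le> a\<^sup>2 / 4"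
proof -
  have sq: "(a * exp (- x))\<^sup>2 = a\<^sup>2 * exp (- 2 * x)" "(- a * exp (- x))\<^sup>2 = a\<^sup>2 * exp (- 2 * x)" for x
    by (simp_all add: power_mult_distrib flip: exp_double)
  have c: "continuous_on UNIV (\<lambda>x. a\<^sup>2 * exp (- 2 * x))" by (intro continuous_intros)
  have d: "((\<lambda>x. - (a\<^sup>2 / 2) * exp (- 2 * x)) has_real_derivative a\<^sup>2 * exp (- 2 * x)) (at x)" for x
    by (auto intro!: derivative_eq_intros)
  have "filterlim (\<lambda>x::real. 2 * x) at_top at_top"
    by (intro filterlim_tendsto_pos_mult_at_top[OF tendsto_const _ filterlim_ident]) auto
  then have "filterlim (\<lambda>x::real. - 2 * x) at_bot at_top" by (simp add: filterlim_uminus_at_top)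
  then have "((\<lambda>x::real. exp (- 2 * x)) \<longlongrightarrow> 0) at_top" by (rule filterlim_compose[OF exp_at_bot])
  then have l: "((\<lambda>x. - (a\<^sup>2 / 2) * exp (- 2 * x)) \<longlongrightarrow> - (a\<^sup>2 / 2) * 0) at_top" by (intro tendsto_intros)
  have i: "set_integrable lborel {0..} (\<lambda>x. a\<^sup>2 * exp (- 2 * x))" "integral {0..} (\<lambda>x. a\<^sup>2 * exp (- 2 * x)) = a\<^sup>2 / 2"
    using halfline_FTC[OF c d _ l] by auto
  show H: "H1_on {0..} (\<lambda>x. a * exp (- x)) (\<lambda>x. - a * exp (- x))"
  proof (rule H1_on_C1)
    show "((\<lambda>x. a * exp (- x)) has_real_derivative - a * exp (- x)) (at x)" for x
      by (auto intro!: derivative_eq_intros)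
    show "continuous_on UNIV (\<lambda>x. - a * exp (- x))" by (intro continuous_intros)
  qed (use i in \<open>simp_all only: sq\<close>, simp)
  show "integral {0..} (\<lambda>x. (a * exp (- x))\<^sup>2) = a\<^sup>2 / 2" unfolding sq by (rule i)
  have "0 \<le> integral {0..} (\<lambda>x. (a * exp (- x)) ^ 6)"
    using set_borel_integral_eq_integral(1)[OF halfline_power6_integrable[OF H]] by (intro integral_nonneg) auto
  then show "En {0..} (\<lambda>x. a * exp (- x)) (\<lambda>x. - a * exp (- x)) \<le> a\<^sup>2 / 4"
    unfolding En_def sq i by simp
qed

context nls_graph
begin

lemma H1_scale:
  assumes "H1 G u g"
  shows "H1 G (\<lambda>e x. c * u e x) (\<lambda>e x. c * g e x)"
proof -
  obtain \<phi> where "\<forall>e\<in>edges G. u e 0 = \<phi> (src G e) \<and> (e \<notin> hlines G \<longrightarrow> u e (len G e) = \<phi> (tgt G e))"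
    using assms unfolding H1_def by blast
  then have "\<exists>\<phi>. \<forall>e\<in>edges G. c * u e 0 = \<phi> (src G e) \<and> (e \<notin> hlines G \<longrightarrow> c * u e (len G e) = \<phi> (tgt G e))"
    by (intro exI[of _ "\<lambda>v. c * \<phi> v"]) auto
  then show ?thesis
    using H1_on_scale[OF H1_edge[OF assms]] unfolding H1_def edge_H1_iff by auto
qed

lemma scale_eqs:
  "mass G (\<lambda>e x. c * u e x) = c\<^sup>2 * mass G u" "kin G (\<lambda>e x. c * g e x) = c\<^sup>2 * kin G g"
  "L6 G (\<lambda>e x. c * u e x) = c ^ 6 * L6 G u"
  "energy G (\<lambda>e x. c * u e x) (\<lambda>e x. c * g e x) = c\<^sup>2 * kin G g / 2 - c ^ 6 * L6 G u / 6"
  unfolding energy_def mass_def kin_def L6_def gint_def power_mult_distrib set_integral_mult_right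
  by (simp_all add: sum_distrib_left)

lemma mass_zero:
  assumes H: "H1 G u g" and m: "mass G u = 0" and e: "e \<in> edges G" and x: "x \<in> edom G e"
  shows "u e x = 0"
proof -
  have em: "em u e = 0" using em_le(1)[OF H e] em_nonneg(1)[OF H e] m by simp
  show ?thesis
  proof (cases "e \<in> hlines G")
    case True
    then have "H1_on {0..} (u e) (g e)" using H1_edge[OF H e] by (simp add: edom_simps)
    from halfline_sup_bound[OF this, of x] show ?thesis using True x em by (simp add: edom_simps em_def)
  next
    case False
    then have He: "H1_on {0..len G e} (u e) (g e)" using H1_edge[OF H e] by (simp add: edom_simps)
    have "(u e x)\<^sup>2 \<le> em u e / len G e + 2 * sqrt (em u e * em g e)"
      using interval_sup_bound[OF H1_on_ac[OF He order_refl] H1_on_square_integrable(1)[OF He] len_pos, of x] False e x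
      by (simp add: edom_simps em_def)
    then show ?thesis using em by simp
  qed
qed

lemma L6_zero:
  assumes H: "H1 G u g" and z: "\<And>e x. e \<in> edges G \<Longrightarrow> x \<in> edom G e \<Longrightarrow> u e x = 0"
  shows "L6 G u = 0"
proof -
  have "e6 u e = integral (edom G e) (\<lambda>x. 0)" if "e \<in> edges G" for e
    unfolding e6_def by (rule integral_cong) (use z that in auto)
  then show ?thesis unfolding L6_eq[OF H] by simp
qed

text \<open>Each edge of a connecting path contributes at most sqrt(length * kinetic energy). The
  constant depends on the graph only, and only the kinetic energy of bounded edges enters;
  \<open>vanishing\<close> relies on both.\<close>

lemma core_oscillation:
  "\<exists>C\<ge>0. \<forall>u g \<phi>. H1 G u g \<and> (\<forall>e\<in>edges G. u e 0 = \<phi> (src G e) \<and> (e \<notin> hlines G \<longrightarrow> u e (len G e) = \<phi> (tgt G e))) \<longrightarrow>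
     (\<forall>v\<in>verts G. \<forall>w\<in>verts G. \<bar>\<phi> v - \<phi> w\<bar> \<le> C * sqrt (\<Sum>e\<in>bounded_edges. em g e)) \<and>
     (\<forall>e\<in>bounded_edges. \<forall>x\<in>edom G e. \<forall>w\<in>verts G. \<bar>u e x - \<phi> w\<bar> \<le> C * sqrt (\<Sum>e\<in>bounded_edges. em g e))"
proof -
  define ok where "ok u g \<phi> \<longleftrightarrow> H1 G u g \<and> (\<forall>e\<in>edges G. u e 0 = \<phi> (src G e) \<and> (e \<notin> hlines G \<longrightarrow> u e (len G e) = \<phi> (tgt G e)))" for u g \<phi>
  define kc where "kc g = (\<Sum>e\<in>bounded_edges. em g e)" for g
  define l where "l = (\<Sum>e\<in>bounded_edges. len G e)"
  have l_le: "len G e \<le> l" if "e \<in> bounded_edges" for e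
    unfolding l_def using that finite_edges len_pos by (intro member_le_sum) (auto intro: less_imp_le)
  have edge: "\<bar>u e x - u e y\<bar> \<le> sqrt l * sqrt (kc g)"
    if ok: "ok u g \<phi>" and e: "e \<in> bounded_edges" and xy: "x \<in> edom G e" "y \<in> edom G e" for u g \<phi> e x y
  proof -
    have H: "H1 G u g" using ok by (simp add: ok_def)
    have He: "H1_on {0..len G e} (u e) (g e)" using H1_edge[OF H, of e] e by (simp add: edom_simps)
    note ac = H1_on_ac[OF He order_refl] and i = H1_on_square_integrable(1)[OF He]
    have main: "\<bar>u e y - u e x\<bar> \<le> sqrt l * sqrt (kc g)" if "0 \<le> x" "x \<le> y" "y \<le> len G e" for x y
    proof -
      have "\<bar>u e y - u e x\<bar> \<le> sqrt ((y - x) * em g e)"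
        using ac_diff_bound[OF ac i that] e by (simp add: em_def edom_simps)
      also have "\<dots> \<le> sqrt (l * kc g)"
      proof (intro real_sqrt_le_mono mult_mono)
        show "y - x \<le> l" using that l_le[OF e] by simp
        show "em g e \<le> kc g" unfolding kc_def using e finite_edges em_nonneg(2)[OF H] by (intro member_le_sum) auto
        show "0 \<le> l" using l_le[OF e] len_pos[OF e] by simp
        show "0 \<le> em g e" using em_nonneg(2)[OF H] e by auto
      qed
      finally show ?thesis by (simp add: real_sqrt_mult)
    qed
    show ?thesis using main[of x y] main[of y x] xy e by (cases "x \<le> y") (auto simp: edom_simps abs_minus_commute)
  qed
  let ?rel = "{(a, b). \<exists>e\<in>bounded_edges. {src G e, tgt G e} = {a, b}}"
  have path: "\<exists>C\<ge>0. \<forall>u g \<phi>. ok u g \<phi> \<longrightarrow> \<bar>\<phi> v - \<phi> w\<bar> \<le> C * sqrt (kc g)" if "(v, w) \<in> ?rel\<^sup>*" for v w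
    using that
  proof (induction rule: rtrancl_induct)
    case base
    show ?case by (intro exI[of _ 0]) auto
  next
    case (step y z)
    obtain C where C: "0 \<le> C" "\<And>u g \<phi>. ok u g \<phi> \<Longrightarrow> \<bar>\<phi> v - \<phi> y\<bar> \<le> C * sqrt (kc g)" using step.IH by blast
    obtain e where e: "e \<in> bounded_edges" "{src G e, tgt G e} = {y, z}" using step.hyps(2) by auto
    have "\<bar>\<phi> v - \<phi> z\<bar> \<le> (C + sqrt l) * sqrt (kc g)" if ok: "ok u g \<phi>" for u g \<phi>
    proof -
      have "0 \<in> edom G e" "len G e \<in> edom G e" using e(1) len_pos[OF e(1)] by (auto simp: edom_simps)
      then have "\<bar>u e (len G e) - u e 0\<bar> \<le> sqrt l * sqrt (kc g)" by (intro edge[OF ok e(1)])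
      moreover have "u e 0 = \<phi> (src G e)" "u e (len G e) = \<phi> (tgt G e)" using ok e(1) by (auto simp: ok_def)
      ultimately have "\<bar>\<phi> (tgt G e) - \<phi> (src G e)\<bar> \<le> sqrt l * sqrt (kc g)" by simp
      then have "\<bar>\<phi> y - \<phi> z\<bar> \<le> sqrt l * sqrt (kc g)" using e(2) by (auto simp: doubleton_eq_iff abs_minus_commute)
      then show ?thesis using C(2)[OF ok] by (simp add: distrib_right)
    qed
    moreover have "0 \<le> l" unfolding l_def using len_pos by (intro sum_nonneg) (auto intro: less_imp_le)
    ultimately show ?case using C(1) by (intro exI[of _ "C + sqrt l"]) auto
  qed
  have "\<forall>p\<in>verts G \<times> verts G. \<exists>C\<ge>0. \<forall>u g \<phi>. ok u g \<phi> \<longrightarrow> \<bar>\<phi> (fst p) - \<phi> (snd p)\<bar> \<le> C * sqrt (kc g)"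
    using path connected unfolding connected_mgraph_def by fastforce
  then obtain c where c: "\<And>p. p \<in> verts G \<times> verts G \<Longrightarrow> 0 \<le> c p"
    "\<And>p u g \<phi>. p \<in> verts G \<times> verts G \<Longrightarrow> ok u g \<phi> \<Longrightarrow> \<bar>\<phi> (fst p) - \<phi> (snd p)\<bar> \<le> c p * sqrt (kc g)"
    by metis
  \<comment> \<open>The sum handles pairs of vertices; the extra sqrt l is reserved for moving from
    a vertex into an edge.\<close>
  define C where "C = (\<Sum>p\<in>verts G \<times> verts G. c p) + sqrt l"
  have fv: "finite (verts G)" using metric by (simp add: metric_graph_def)
  have l0: "0 \<le> l" unfolding l_def using len_pos by (intro sum_nonneg) (auto intro: less_imp_le)
  have kc0: "0 \<le> kc g" if "ok u g \<phi>" for u g \<phi>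
    unfolding kc_def using that em_nonneg(2) by (intro sum_nonneg) (auto simp: ok_def)
  have vv: "\<bar>\<phi> v - \<phi> w\<bar> \<le> (C - sqrt l) * sqrt (kc g)" if ok: "ok u g \<phi>" and vw: "v \<in> verts G" "w \<in> verts G" for u g \<phi> v w
  proof -
    have "\<bar>\<phi> v - \<phi> w\<bar> \<le> c (v, w) * sqrt (kc g)" using c(2)[OF _ ok, of "(v, w)"] vw by simp
    also have "\<dots> \<le> (C - sqrt l) * sqrt (kc g)"
    proof (rule mult_right_mono)
      show "c (v, w) \<le> C - sqrt l" unfolding C_def using vw c(1) fv member_le_sum[of "(v, w)" "verts G \<times> verts G" c] by auto
      show "0 \<le> sqrt (kc g)" using kc0[OF ok] by simp
    qed
    finally show ?thesis .
  qed
  have C0: "0 \<le> C" unfolding C_def using c(1) l0 by (intro add_nonneg_nonneg sum_nonneg) auto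
  have "\<bar>\<phi> v - \<phi> w\<bar> \<le> C * sqrt (kc g)" if ok: "ok u g \<phi>" and vw: "v \<in> verts G" "w \<in> verts G" for u g \<phi> v w
  proof -
    have "0 \<le> sqrt l * sqrt (kc g)" using l0 kc0[OF ok] by simp
    then show ?thesis using vv[OF ok vw] by (simp add: left_diff_distrib)
  qed
  moreover have "\<bar>u e x - \<phi> w\<bar> \<le> C * sqrt (kc g)"
    if ok: "ok u g \<phi>" and e: "e \<in> bounded_edges" "x \<in> edom G e" and w: "w \<in> verts G" for u g \<phi> e x w
  proof -
    have "0 \<in> edom G e" using e len_pos[OF e(1)] by (auto simp: edom_simps)
    then have "\<bar>u e x - u e 0\<bar> \<le> sqrt l * sqrt (kc g)" by (rule edge[OF ok e])
    moreover have "u e 0 = \<phi> (src G e)" "src G e \<in> verts G" using ok e metric by (auto simp: ok_def metric_graph_def)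
    ultimately show ?thesis using vv[OF ok _ w, of "src G e"] by (simp add: left_diff_distrib)
  qed
  ultimately show ?thesis using C0 unfolding ok_def kc_def by (intro exI[of _ C]) blast
qed

text \<open>Functions vanish on halflines by the sup bound, are constant on the core by
  \<open>core_oscillation\<close>, and the two meet at the vertex of a halfline.\<close>

lemma kin_zero:
  assumes H: "H1 G u g" and k: "kin G g = 0" and e: "e \<in> edges G" and x: "x \<in> edom G e"
  shows "u e x = 0"
proof -
  have em0: "em g e = 0" if "e \<in> edges G" for e using em_le(2)[OF H that] em_nonneg(2)[OF H that] k by simp
  have hl: "u h x = 0" if h: "h \<in> hlines G" and x: "0 \<le> x" for h x
  proof -
    have "H1_on {0..} (u h) (g h)" using H1_edge[OF H hlines_edges[OF h]] h by (simp add: edom_simps)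
    from halfline_sup_bound[OF this x] show ?thesis using em0[OF hlines_edges[OF h]] h by (simp add: em_def edom_simps)
  qed
  show ?thesis
  proof (cases "e \<in> hlines G")
    case True
    then show ?thesis using hl x by (simp add: edom_simps)
  next
    case False
    obtain h where h: "h \<in> hlines G" using noncompact by (auto simp: noncompact_def)
    obtain \<phi> where phi: "\<forall>e\<in>edges G. u e 0 = \<phi> (src G e) \<and> (e \<notin> hlines G \<longrightarrow> u e (len G e) = \<phi> (tgt G e))"
      using H unfolding H1_def by blast
    have "(\<Sum>e\<in>bounded_edges. em g e) = 0" using em0 by (intro sum.neutral) auto
    moreover have "src G h \<in> verts G" using metric hlines_edges[OF h] by (auto simp: metric_graph_def)
    moreover obtain C where "\<forall>e\<in>bounded_edges. \<forall>x\<in>edom G e. \<forall>w\<in>verts G. \<bar>u e x - \<phi> w\<bar> \<le> C * sqrt (\<Sum>e\<in>bounded_edges. em g e)"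
      using core_oscillation H phi by blast
    ultimately have "\<bar>u e x - \<phi> (src G h)\<bar> \<le> 0" using e False x by fastforce
    moreover have "\<phi> (src G h) = 0" using phi hl[OF h, of 0] hlines_edges[OF h] by auto
    ultimately show ?thesis by simp
  qed
qed

lemma kin_pos:
  assumes H: "H1 G u g" and m: "0 < mass G u"
  shows "0 < kin G g"
proof -
  have "kin G g \<noteq> 0"
  proof
    assume "kin G g = 0"
    then have "em u e = integral (edom G e) (\<lambda>x. 0)" if "e \<in> edges G" for e
      unfolding em_def using kin_zero[OF H _ that] by (intro integral_cong) simp
    then show False using m by (simp add: mass_eq[OF H])
  qed
  then show ?thesis using nonneg(2)[OF H] by simp
qed

lemma GN_energy:
  assumes mu: "0 < mu_crit G" and H: "H1 G u g"
  shows "kin G g / 2 * (1 - (mass G u / mu_crit G)\<^sup>2) \<le> energy G u g"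
proof -
  define K where "K = real_of_ereal (KG G)"
  \<comment> \<open>An infinite \<open>KG\<close> would give K = 0 and 3 / K = 0 by the default
    values, hence \<open>mu_crit\<close> = 0; positivity makes \<open>KG\<close> a positive
    real.\<close>
  have "0 < 3 / K" using mu unfolding mu_crit_def K_def[symmetric] by simp
  then have K: "0 < K" by (simp add: zero_less_divide_iff)
  then have KG: "KG G = ereal K" by (cases "KG G") (auto simp: K_def)
  have mu2: "(mu_crit G)\<^sup>2 = 3 / K" using K unfolding mu_crit_def K_def[symmetric] by simp
  have "L6 G u \<le> K * (mass G u)\<^sup>2 * kin G g"
  proof (cases "\<exists>e\<in>edges G. \<exists>x\<in>edom G e. u e x \<noteq> 0")
    case False
    then show ?thesis using L6_zero[OF H] nonneg[OF H] K by auto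
  next
    case True
    have "ereal (L6 G u / ((mass G u)\<^sup>2 * kin G g)) \<le> KG G"
      unfolding KG_def using H True by (intro SUP_upper2[of "(u, g)"]) auto
    then have "L6 G u / ((mass G u)\<^sup>2 * kin G g) \<le> K" by (simp add: KG)
    moreover have "0 < mass G u" using mass_zero[OF H] True nonneg(1)[OF H] by force
    moreover have "0 < kin G g" using kin_zero[OF H] True nonneg(2)[OF H] by force
    ultimately show ?thesis by (simp add: divide_simps mult.assoc)
  qed
  moreover have "K * (mass G u)\<^sup>2 * kin G g = 3 * kin G g * (mass G u / mu_crit G)\<^sup>2"
    unfolding power_divide mu2 using K by (simp add: field_simps)
  ultimately have "L6 G u \<le> 3 * kin G g * (mass G u / mu_crit G)\<^sup>2" by simp
  then show ?thesis unfolding energy_def by (simp add: algebra_simps)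
qed

text \<open>A soliton tail on one halfline, the constant \<open>a\<close> on the core, exponentials
  on the other halflines. Letting \<open>om * m\<close> approach pi drives the energy down; letting
  \<open>a\<close> tend to 0 makes its upper bound small.\<close>

lemma test_function:
  assumes h: "h \<in> hlines G" and a: "a \<noteq> 0" and m: "0 < m" "m < mu_R"
  shows "\<exists>u g. H1 G u g \<and>
    mass G u = m + a\<^sup>2 * ((\<Sum>e\<in>bounded_edges. len G e) + (real (card (hlines G)) - 1) / 2) \<and>
    energy G u g \<le> om / 8 * (cot (om * m) * a ^ 4) + a\<^sup>2 * ((real (card (hlines G)) - 1) / 4)"
proof -
  obtain f f' where f: "H1_on {0..} f f'" "f 0 = a" "integral {0..} (\<lambda>x. (f x)\<^sup>2) = m"
    "integral {0..} (\<lambda>x. (f' x)\<^sup>2) - 1 / 3 * integral {0..} (\<lambda>x. f x ^ 6) = om / 4 * (cot (om * m) * a ^ 4)"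
    using soliton_tail[OF a m] by blast
  define u where "u e = (if e = h then f else if e \<in> hlines G then (\<lambda>x. a * exp (- x)) else (\<lambda>_. a))" for e
  define g where "g e = (if e = h then f' else if e \<in> hlines G then (\<lambda>x. - a * exp (- x)) else (\<lambda>_. 0))" for e
  have const: "H1_on {0..L} (\<lambda>_. a) (\<lambda>_. 0)" for L
    by (rule H1_on_C1[where L = L]) (auto intro!: borel_integrable_atLeastAtMost')
  have H: "H1 G u g"
    unfolding H1_def edge_H1_iff
  proof (intro conjI ballI exI[of _ "\<lambda>_. a"] impI)
    fix e assume "e \<in> edges G"
    show "H1_on (edom G e) (u e) (g e)"
      using f(1) exp_halfline(1)[of a] const h by (auto simp: u_def g_def edom_simps)
    show "u e 0 = a" using f(2) by (auto simp: u_def)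
    show "u e (len G e) = a" if "e \<notin> hlines G" using that h by (auto simp: u_def)
  qed
  have hl: "(\<Sum>e\<in>hlines G. q e) = q h + (\<Sum>e\<in>hlines G - {h}. q e)" for q :: "'e \<Rightarrow> real"
    using finite_edges h by (intro sum.remove) auto
  have card: "real (card (hlines G - {h})) = real (card (hlines G)) - 1"
    using card_Suc_Diff1[OF finite_edges(2) h] by simp
  have "mass G u = em u h + (\<Sum>e\<in>hlines G - {h}. em u e) + (\<Sum>e\<in>bounded_edges. em u e)"
    unfolding mass_eq[OF H] sum_edges hl ..
  also have "em u h = m" using f(3) h by (simp add: em_def u_def edom_simps)
  also have "(\<Sum>e\<in>hlines G - {h}. em u e) = (\<Sum>e\<in>hlines G - {h}. a\<^sup>2 / 2)"
    by (intro sum.cong refl) (auto simp: em_def u_def edom_simps exp_halfline(2))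
  also have "(\<Sum>e\<in>bounded_edges. em u e) = (\<Sum>e\<in>bounded_edges. a\<^sup>2 * len G e)"
  proof (intro sum.cong refl)
    fix e assume e: "e \<in> bounded_edges"
    then have "e \<noteq> h" using h by auto
    then show "em u e = a\<^sup>2 * len G e" using e len_pos[OF e] by (simp add: em_def u_def edom_simps)
  qed
  finally have mass: "mass G u = m + a\<^sup>2 * ((\<Sum>e\<in>bounded_edges. len G e) + (real (card (hlines G)) - 1) / 2)"
    by (simp add: card sum_distrib_left algebra_simps add_divide_distrib diff_divide_distrib)
  have "energy G u g = En {0..} f f' + (\<Sum>e\<in>hlines G - {h}. En (edom G e) (u e) (g e)) + (\<Sum>e\<in>bounded_edges. En (edom G e) (u e) (g e))"
    unfolding energy_eq[OF H] sum_edges hl using h by (simp add: u_def g_def edom_simps)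
  also have "En {0..} f f' = om / 8 * (cot (om * m) * a ^ 4)" using f(4) by (simp add: En_def)
  also have "(\<Sum>e\<in>hlines G - {h}. En (edom G e) (u e) (g e)) \<le> (\<Sum>e\<in>hlines G - {h}. a\<^sup>2 / 4)"
    by (intro sum_mono) (use exp_halfline(3)[of a] in \<open>auto simp: u_def g_def edom_simps\<close>)
  also have "(\<Sum>e\<in>bounded_edges. En (edom G e) (u e) (g e)) \<le> (\<Sum>e\<in>bounded_edges. 0)"
  proof (intro sum_mono)
    fix e assume e: "e \<in> bounded_edges"
    then have "e \<noteq> h" using h by auto
    then show "En (edom G e) (u e) (g e) \<le> 0" using e len_pos[OF e] by (simp add: En_def u_def g_def edom_simps)
  qed
  finally have "energy G u g \<le> om / 8 * (cot (om * m) * a ^ 4) + a\<^sup>2 * ((real (card (hlines G)) - 1) / 4)"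
    by (simp add: card mult.commute)
  then show ?thesis using H mass by blast
qed

end

section \<open>Vanishing on the core\<close>

text \<open>Successive extraction over the finite index set, possible because \<open>P\<close> is
  inherited by subsequences.\<close>

lemma common_subsequence:
  fixes P :: "'i \<Rightarrow> (nat \<Rightarrow> nat) \<Rightarrow> bool"
  assumes fin: "finite I"
    and ex: "\<And>i s. i \<in> I \<Longrightarrow> strict_mono s \<Longrightarrow> \<exists>r :: nat \<Rightarrow> nat. strict_mono r \<and> P i (s \<circ> r)"
    and sub: "\<And>i s (r :: nat \<Rightarrow> nat). i \<in> I \<Longrightarrow> P i s \<Longrightarrow> strict_mono r \<Longrightarrow> P i (s \<circ> r)"
  shows "\<exists>r. strict_mono r \<and> (\<forall>i\<in>I. P i r)"
  using fin ex sub
proof (induction I rule: finite_induct)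
  case empty
  show ?case by (intro exI[of _ id]) (auto simp: strict_mono_def)
next
  case (insert j J)
  have "\<exists>r. strict_mono r \<and> (\<forall>i\<in>J. P i r)"
    by (rule insert.IH) (use insert.prems in auto)
  then obtain s where s: "strict_mono s" "\<And>i. i \<in> J \<Longrightarrow> P i s" by blast
  obtain r where r: "strict_mono r" "P j (s \<circ> r)" using insert.prems(1)[OF insertI1 s(1)] by blast
  have "P i (s \<circ> r)" if "i \<in> J" for i using insert.prems(2)[OF insertI2[OF that] s(2)[OF that] r(1)] .
  then show ?case using r(2) strict_mono_o[OF s(1) r(1)] by blast
qed

text \<open>A gap \<open>d\<close> below pi turns nonnegativity into a definite gain: x <= pi - (y +
  d) gives cot x >= -cot(y + d), and cot y - cot(y + d) = sin d / (sin y sin(y + d)).\<close>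

lemma cot_sum_lower_bound:
  fixes x y d :: real
  assumes "0 < x" "0 < y" "0 < d" "x + y + d \<le> pi"
  shows "sin d \<le> cot x + cot y"
proof -
  have s: "0 < sin y" "0 < sin (y + d)" "0 \<le> sin d" using assms by (auto intro!: sin_gt_zero sin_ge_zero)
  have "- cot (y + d) = cot (pi - (y + d))" by (rule cot_pi_minus[symmetric])
  also have "\<dots> \<le> cot x" using assms by (intro cot_antimono) auto
  finally have "cot y - cot (y + d) \<le> cot x + cot y" by simp
  moreover have "cot y - cot (y + d) = sin d / (sin y * sin (y + d))" using cot_diff_eq[of y "y + d"] s by simp
  moreover have "sin d \<le> sin d / (sin y * sin (y + d))"
  proof -
    have "sin y * sin (y + d) \<le> 1 * 1" using s by (intro mult_mono) auto
    then show ?thesis using s by (simp add: pos_le_divide_eq mult_left_le)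
  qed
  ultimately show ?thesis by linarith
qed

text \<open>In (x - y)(x + y)(x^2 + y^2) the factor x + y is estimated by \<open>b\<close> and the
  others by \<open>A\<close> and \<open>D\<close>: the small factor \<open>b\<close> is what later
  absorbs this error.\<close>

lemma abs_power4_diff_le:
  fixes x y A D b :: real
  assumes "\<bar>x - y\<bar> \<le> D" "\<bar>x\<bar> \<le> A + D" "\<bar>y\<bar> \<le> A + D" "\<bar>x\<bar> \<le> b" "\<bar>y\<bar> \<le> b" "0 \<le> A" "0 \<le> D"
  shows "\<bar>x ^ 4 - y ^ 4\<bar> \<le> 8 * b * (A\<^sup>2 * D + D ^ 3)"
proof -
  have b: "0 \<le> b" using assms(4) by linarith
  have "x ^ 4 - y ^ 4 = (x - y) * ((x + y) * (x\<^sup>2 + y\<^sup>2))" by (simp add: power2_eq_square power4_eq_xxxx algebra_simps)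
  then have "\<bar>x ^ 4 - y ^ 4\<bar> = \<bar>x - y\<bar> * (\<bar>x + y\<bar> * (x\<^sup>2 + y\<^sup>2))" by (simp add: abs_mult)
  also have "\<dots> \<le> D * ((2 * b) * ((A + D)\<^sup>2 + (A + D)\<^sup>2))"
  proof (intro mult_mono add_mono)
    show "\<bar>x + y\<bar> \<le> 2 * b" using assms by linarith
    show "x\<^sup>2 \<le> (A + D)\<^sup>2" "y\<^sup>2 \<le> (A + D)\<^sup>2" using assms by (auto simp: abs_le_square_iff[symmetric])
  qed (use assms b in auto)
  also have "(A + D)\<^sup>2 \<le> 2 * A\<^sup>2 + 2 * D\<^sup>2"
  proof -
    have "0 \<le> (A - D)\<^sup>2" by simp
    then show ?thesis by (simp add: power2_sum power2_diff)
  qed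
  then have "D * ((2 * b) * ((A + D)\<^sup>2 + (A + D)\<^sup>2)) \<le> D * ((2 * b) * ((2 * A\<^sup>2 + 2 * D\<^sup>2) + (2 * A\<^sup>2 + 2 * D\<^sup>2)))"
    using assms b by (intro mult_left_mono add_mono) auto
  also have "\<dots> = 8 * b * (A\<^sup>2 * D + D ^ 3)" by (simp add: algebra_simps power2_eq_square power3_eq_cube)
  finally show ?thesis .
qed

context nls_graph
begin

text \<open>Two halflines whose phases leave a gap gain a multiple of A^4, with A the smaller
  boundary value in modulus, and the core gains kc/2. The errors, from the sixth power on the core
  and from unequal boundary values, are of the form A^4 + kc with coefficients that vanish as
  \<open>b\<close> tends to 0.\<close>

lemma vanishing:
  assumes two: "card (hlines G) > 1" and M: "M < mu_R" and K0: "0 \<le> K0"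
  shows "\<exists>b>0. \<forall>u g. H1 G u g \<and> mass G u \<le> M \<and> kin G g \<le> K0 \<and>
     (\<forall>e\<in>bounded_edges. \<forall>x\<in>edom G e. \<bar>u e x\<bar> \<le> b) \<and> (\<forall>h\<in>hlines G. \<bar>u h 0\<bar> \<le> b) \<longrightarrow> 0 \<le> energy G u g"
proof -
  obtain C where C: "0 \<le> C" and osc: "\<And>u g \<phi>. H1 G u g \<Longrightarrow>
     \<forall>e\<in>edges G. u e 0 = \<phi> (src G e) \<and> (e \<notin> hlines G \<longrightarrow> u e (len G e) = \<phi> (tgt G e)) \<Longrightarrow>
     (\<forall>v\<in>verts G. \<forall>w\<in>verts G. \<bar>\<phi> v - \<phi> w\<bar> \<le> C * sqrt (\<Sum>e\<in>bounded_edges. em g e)) \<and>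
     (\<forall>e\<in>bounded_edges. \<forall>x\<in>edom G e. \<forall>w\<in>verts G. \<bar>u e x - \<phi> w\<bar> \<le> C * sqrt (\<Sum>e\<in>bounded_edges. em g e))"
    using core_oscillation by blast
  define n where "n = real (card (hlines G))"
  have n: "0 < n" using two by (simp add: n_def)
  \<comment> \<open>The spare phase om (mu_R - M) equals 2 d: one half is spent on the
    \<open>n\<close> paddings \<open>eta\<close>, the other is the gap.\<close>
  define d where "d = om * (mu_R - M) / 2"
  define eta where "eta = om * (mu_R - M) / (2 * n)"
  have d: "0 < d" using M om_pos by (simp add: d_def)
  have eta: "0 < eta" using M om_pos n by (simp add: eta_def)
  define c0 where "c0 = sin d"
  define C0 where "C0 = \<bar>cot d\<bar>"
  define l where "l = (\<Sum>e\<in>bounded_edges. len G e)"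
  have l0: "0 \<le> l" unfolding l_def using len_pos by (intro sum_nonneg) (auto intro: less_imp_le)
  define Dm where "Dm = C * sqrt K0"
  have Dm: "0 \<le> Dm" using C K0 by (simp add: Dm_def)
  have d_pi: "d < pi" if "0 \<le> M"
  proof -
    have "om * (mu_R - M) \<le> om * mu_R" using that om_pos by (intro mult_left_mono) auto
    then have "d \<le> pi / 2" using om_mu_R by (simp add: d_def)
    then show ?thesis using pi_gt_zero by linarith
  qed
  \<comment> \<open>The assumptions \<open>b1\<close> and \<open>b2\<close> are the coefficients of
    A^4 and of kc in the final lower bound.\<close>
  have key: "0 \<le> energy G u g"
    if H: "H1 G u g" and mass: "mass G u \<le> M" and kin: "kin G g \<le> K0"
      and small: "\<And>e x. e \<in> bounded_edges \<Longrightarrow> x \<in> edom G e \<Longrightarrow> \<bar>u e x\<bar> \<le> b" "\<And>h. h \<in> hlines G \<Longrightarrow> \<bar>u h 0\<bar> \<le> b"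
      and b: "0 < b" and b1: "0 \<le> om * c0 / 8 - 4 / 3 * l * b\<^sup>2 - om * C0 * b / 2"
      and b2: "0 \<le> 1 / 2 - C\<^sup>2 * (4 / 3 * l * b\<^sup>2 * Dm\<^sup>2 + om * C0 * b * (1 / 2 + Dm))" for u g b
  proof -
    have M0: "0 \<le> M" using nonneg(1)[OF H] mass by simp
    obtain \<phi> where phi: "\<forall>e\<in>edges G. u e 0 = \<phi> (src G e) \<and> (e \<notin> hlines G \<longrightarrow> u e (len G e) = \<phi> (tgt G e))"
      using H unfolding H1_def by blast
    define kc where "kc = (\<Sum>e\<in>bounded_edges. em g e)"
    have kc0: "0 \<le> kc" unfolding kc_def using em_nonneg(2)[OF H] by (intro sum_nonneg) auto
    have "kc \<le> kin G g" unfolding kc_def kin_eq[OF H] using em_nonneg(2)[OF H] finite_edges by (intro sum_mono2) auto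
    then have kcK: "kc \<le> K0" using kin by simp
    define D where "D = C * sqrt kc"
    have D: "0 \<le> D" "D \<le> Dm" "D\<^sup>2 = C\<^sup>2 * kc" using C kc0 kcK
      by (auto simp: D_def Dm_def power_mult_distrib intro!: mult_left_mono)
    define a where "a h = \<phi> (src G h)" for h
    have ah: "a h = u h 0" "src G h \<in> verts G" if "h \<in> hlines G" for h
      using phi hlines_edges[OF that] metric by (auto simp: a_def metric_graph_def)
    have oscv: "\<bar>a h - a h'\<bar> \<le> D" if "h \<in> hlines G" "h' \<in> hlines G" for h h'
      using osc[OF H phi] ah that unfolding a_def D_def kc_def by blast
    have osce: "\<bar>u e x - a h\<bar> \<le> D" if "e \<in> bounded_edges" "x \<in> edom G e" "h \<in> hlines G" for e x h
      using osc[OF H phi] ah that unfolding a_def D_def kc_def by blast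
    define \<beta> where "\<beta> h = om * em u h + eta" for h
    have b0: "0 < \<beta> h" if "h \<in> hlines G" for h
      using em_nonneg(1)[OF H hlines_edges[OF that]] om_pos eta by (simp add: \<beta>_def add_nonneg_pos)
    have bsum: "(\<Sum>h\<in>hlines G. \<beta> h) \<le> pi - d"
    proof -
      have "(\<Sum>h\<in>hlines G. \<beta> h) = om * (\<Sum>h\<in>hlines G. em u h) + n * eta"
        by (simp add: \<beta>_def sum.distrib n_def flip: sum_distrib_left)
      also have "(\<Sum>h\<in>hlines G. em u h) \<le> mass G u"
        unfolding mass_eq[OF H] using em_nonneg(1)[OF H] finite_edges hlines_edges by (intro sum_mono2) auto
      then have "om * (\<Sum>h\<in>hlines G. em u h) \<le> om * M" using mass om_pos by (intro mult_left_mono) auto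
      also have "n * eta = om * (mu_R - M) / 2" using n by (simp add: eta_def)
      finally have "(\<Sum>h\<in>hlines G. \<beta> h) \<le> om * M + d" by (simp add: d_def)
      moreover have "om * M + d + d = om * mu_R" by (simp add: d_def algebra_simps)
      ultimately show ?thesis using om_mu_R by linarith
    qed
    \<comment> \<open>Only the halfline of largest phase can have a negative cotangent.\<close>
    obtain h1 where h1: "h1 \<in> hlines G" "\<And>h. h \<in> hlines G \<Longrightarrow> \<beta> h \<le> \<beta> h1"
    proof -
      have "Max (\<beta> ` hlines G) \<in> \<beta> ` hlines G" using two finite_edges by (intro Max_in) auto
      then obtain h1 where "h1 \<in> hlines G" "\<beta> h1 = Max (\<beta> ` hlines G)" by auto
      then show ?thesis using finite_edges by (intro that[of h1]) auto
    qed
    obtain h2 where h2: "h2 \<in> hlines G" "h2 \<noteq> h1"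
    proof -
      have "hlines G \<noteq> {h1}" using two by auto
      then show ?thesis using h1(1) that by blast
    qed
    have pair: "\<beta> h + \<beta> h1 \<le> pi - d" if "h \<in> hlines G" "h \<noteq> h1" for h
    proof -
      have "(\<Sum>i\<in>{h, h1}. \<beta> i) \<le> (\<Sum>h\<in>hlines G. \<beta> h)"
        using that h1 finite_edges b0 by (intro sum_mono2) (auto intro: less_imp_le)
      then show ?thesis using bsum that by simp
    qed
    have low: "om / 8 * (cot (\<beta> h) * a h ^ 4) \<le> En (edom G h) (u h) (g h)" if h: "h \<in> hlines G" for h
    proof -
      have Hh: "H1_on {0..} (u h) (g h)" using H1_edge[OF H hlines_edges[OF h]] h by (simp add: edom_simps)
      have "\<beta> h \<le> (\<Sum>h\<in>hlines G. \<beta> h)" using h b0 finite_edges by (intro member_le_sum) (auto intro: less_imp_le)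
      then have "\<beta> h < pi" using bsum d by linarith
      then show ?thesis
        using halfline_energy_lower_bound[OF Hh eta] h ah(1)[OF h] by (simp add: \<beta>_def em_def edom_simps)
    qed
    define A where "A = min \<bar>a h1\<bar> \<bar>a h2\<bar>"
    have A0: "0 \<le> A" by (simp add: A_def)
    have A12: "\<bar>a h1\<bar> \<le> A + D" "\<bar>a h2\<bar> \<le> A + D" "A \<le> \<bar>a h1\<bar>" "A \<le> \<bar>a h2\<bar>"
      using oscv[OF h1(1) h2(1)] D by (auto simp: A_def min_def)
    define c where "c h = cot (\<beta> h)" for h
    have cpos: "0 \<le> c h" if "h \<in> hlines G" "h \<noteq> h1" for h
      unfolding c_def using b0[OF that(1)] pair[OF that] h1(2)[OF that(1)] d by (intro cot_nonneg) auto
    have c12: "c0 \<le> c h1 + c h2"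
      unfolding c0_def c_def using cot_sum_lower_bound[OF b0[OF h1(1)] b0[OF h2(1)] d] pair[OF h2] by simp
    have c1: "- C0 \<le> c h1"
    proof -
      have "cot (pi - d) \<le> cot (\<beta> h1)" using pair[OF h2] b0[OF h1(1)] b0[OF h2(1)] d by (intro cot_antimono) auto
      then show ?thesis by (simp add: cot_pi_minus C0_def c_def)
    qed
    have c00: "0 \<le> c0" unfolding c0_def using d d_pi[OF M0] by (intro sin_ge_zero) auto
    have C00: "0 \<le> C0" by (simp add: C0_def)
    define X where "X = \<bar>a h1 ^ 4 - a h2 ^ 4\<bar>"
    have A4: "A ^ 4 \<le> a h1 ^ 4" "A ^ 4 \<le> a h2 ^ 4"
      using power_mono[OF A12(3) A0, of 4] power_mono[OF A12(4) A0, of 4] by simp_all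
    \<comment> \<open>If the cotangent at h1 is negative, the boundary value there is replaced by
      the one at h2; \<open>C0\<close> bounds the modulus of that cotangent and \<open>X\<close> the
      change of the fourth power.\<close>
    have two_h: "c0 * A ^ 4 - C0 * X \<le> c h1 * a h1 ^ 4 + c h2 * a h2 ^ 4"
    proof (cases "0 \<le> c h1")
      case True
      have "c0 * A ^ 4 \<le> (c h1 + c h2) * A ^ 4" using c12 by (intro mult_right_mono) auto
      also have "\<dots> \<le> c h1 * a h1 ^ 4 + c h2 * a h2 ^ 4"
        unfolding distrib_right using True cpos[OF h2] A4 by (intro add_mono mult_left_mono) auto
      moreover have "0 \<le> C0 * X" using C00 by (simp add: X_def)
      ultimately show ?thesis by linarith
    next
      case False
      have "c0 * A ^ 4 \<le> c0 * a h2 ^ 4" using c00 A4 by (intro mult_left_mono) auto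
      also have "\<dots> \<le> (c h1 + c h2) * a h2 ^ 4" using c12 by (intro mult_right_mono) auto
      finally have "c0 * A ^ 4 \<le> (c h1 + c h2) * a h2 ^ 4" .
      moreover have "- (C0 * X) \<le> c h1 * (a h1 ^ 4 - a h2 ^ 4)"
      proof -
        have "\<bar>c h1 * (a h1 ^ 4 - a h2 ^ 4)\<bar> \<le> C0 * X"
          unfolding abs_mult X_def using False c1 by (intro mult_right_mono) auto
        then show ?thesis by linarith
      qed
      ultimately show ?thesis by (simp add: algebra_simps)
    qed
    have X: "X \<le> 8 * b * (A ^ 4 / 2 + (1 / 2 + Dm) * D\<^sup>2)"
    proof -
      have "X \<le> 8 * b * (A\<^sup>2 * D + D ^ 3)"
        unfolding X_def using oscv[OF h1(1) h2(1)] A12 A0 D small(2)[OF h1(1)] small(2)[OF h2(1)] ah(1)[OF h1(1)] ah(1)[OF h2(1)]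
        by (intro abs_power4_diff_le) auto
      \<comment> \<open>A^2 D <= A^4/2 + D^2/2, and one factor D of D^3 is bounded by
        \<open>Dm\<close>; D^2 is a multiple of kc.\<close>
      also have "A\<^sup>2 * D + D ^ 3 \<le> A ^ 4 / 2 + (1 / 2 + Dm) * D\<^sup>2"
      proof -
        have "0 \<le> (A\<^sup>2 - D)\<^sup>2" by simp
        then have "A\<^sup>2 * D \<le> A ^ 4 / 2 + D\<^sup>2 / 2" by (simp add: power2_diff flip: power_mult)
        moreover have "D ^ 3 \<le> Dm * D\<^sup>2" using mult_right_mono[OF D(2), of "D\<^sup>2"] by (simp add: power2_eq_square power3_eq_cube mult.assoc)
        ultimately show ?thesis by (simp add: algebra_simps)
      qed
      then have "8 * b * (A\<^sup>2 * D + D ^ 3) \<le> 8 * b * (A ^ 4 / 2 + (1 / 2 + Dm) * D\<^sup>2)" using b by (intro mult_left_mono) auto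
      finally show ?thesis .
    qed
    have halflines: "om / 8 * (c0 * A ^ 4 - C0 * X) \<le> (\<Sum>h\<in>hlines G. En (edom G h) (u h) (g h))"
    proof -
      have "c h1 * a h1 ^ 4 + c h2 * a h2 ^ 4 = (\<Sum>h\<in>{h1, h2}. c h * a h ^ 4)" using h2 by simp
      also have "\<dots> \<le> (\<Sum>h\<in>hlines G. c h * a h ^ 4)"
        using h1 h2 finite_edges cpos by (intro sum_mono2) auto
      finally have "om / 8 * (c0 * A ^ 4 - C0 * X) \<le> om / 8 * (\<Sum>h\<in>hlines G. c h * a h ^ 4)"
        using two_h om_pos by (intro mult_left_mono) auto
      also have "\<dots> \<le> (\<Sum>h\<in>hlines G. En (edom G h) (u h) (g h))"
        unfolding sum_distrib_left using low by (intro sum_mono) (auto simp: c_def)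
      finally show ?thesis .
    qed
    have core: "kc / 2 - 4 / 3 * l * b\<^sup>2 * (A ^ 4 + Dm\<^sup>2 * D\<^sup>2) \<le> (\<Sum>e\<in>bounded_edges. En (edom G e) (u e) (g e))"
    proof -
      define W where "W = 8 * b\<^sup>2 * (A ^ 4 + Dm\<^sup>2 * D\<^sup>2)"
      have "em g e / 2 - len G e * W / 6 \<le> En (edom G e) (u e) (g e)" if e: "e \<in> bounded_edges" for e
      proof -
        have pt: "u e x ^ 6 \<le> W" if x: "x \<in> edom G e" for x
        proof -
          have "\<bar>u e x\<bar> \<le> A + D" using osce[OF e x h1(1)] osce[OF e x h2(1)] by (auto simp: A_def min_def)
          then have "\<bar>u e x\<bar> ^ 4 \<le> (A + D) ^ 4" by (intro power_mono) auto
          also have "(A + D) ^ 4 \<le> 8 * (A ^ 4 + D ^ 4)"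
          proof -
            have sq: "(x + y)\<^sup>2 \<le> 2 * (x\<^sup>2 + y\<^sup>2)" for x y :: real
            proof -
              have "0 \<le> (x - y)\<^sup>2" by simp
              then show ?thesis by (simp add: power2_sum power2_diff)
            qed
            have "((A + D)\<^sup>2)\<^sup>2 \<le> (2 * (A\<^sup>2 + D\<^sup>2))\<^sup>2" using sq[of A D] by (intro power_mono) auto
            also have "\<dots> = 4 * (A\<^sup>2 + D\<^sup>2)\<^sup>2" by (simp only: power_mult_distrib) simp
            also have "\<dots> \<le> 4 * (2 * ((A\<^sup>2)\<^sup>2 + (D\<^sup>2)\<^sup>2))" using sq[of "A\<^sup>2" "D\<^sup>2"] by simp
            finally show ?thesis by (simp flip: power_mult)
          qed
          also have "D ^ 4 \<le> Dm\<^sup>2 * D\<^sup>2"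
          proof -
            have "D\<^sup>2 * D\<^sup>2 \<le> Dm\<^sup>2 * D\<^sup>2" using D(1,2) by (intro mult_right_mono power_mono) auto
            then show ?thesis by (simp flip: power_add)
          qed
          finally have u4: "u e x ^ 4 \<le> 8 * (A ^ 4 + Dm\<^sup>2 * D\<^sup>2)" by simp
          have "(u e x)\<^sup>2 \<le> b\<^sup>2" using small(1)[OF e x] b by (simp add: abs_le_square_iff[symmetric])
          then have "(u e x)\<^sup>2 * u e x ^ 4 \<le> b\<^sup>2 * (8 * (A ^ 4 + Dm\<^sup>2 * D\<^sup>2))" using u4 by (intro mult_mono) auto
          then show ?thesis by (simp add: W_def algebra_simps flip: power_add)
        qed
        have "e6 u e \<le> integral (edom G e) (\<lambda>x. W)"
          unfolding e6_def
        proof (rule integral_le)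
          show "(\<lambda>x. u e x ^ 6) integrable_on edom G e"
            by (rule set_borel_integral_eq_integral(1)[OF H1_power6_integrable[OF H1_edge[OF H]]]) (use e in auto)
          show "(\<lambda>x. W) integrable_on edom G e" using e by (simp add: edom_simps integrable_const_ivl)
        qed (rule pt)
        also have "\<dots> = len G e * W" using e len_pos[OF e] by (simp add: edom_simps)
        finally show ?thesis by (simp add: En_def em_def e6_def)
      qed
      then have "(\<Sum>e\<in>bounded_edges. em g e / 2 - len G e * W / 6) \<le> (\<Sum>e\<in>bounded_edges. En (edom G e) (u e) (g e))"
        by (rule sum_mono)
      moreover have "(\<Sum>e\<in>bounded_edges. em g e / 2 - len G e * W / 6) = kc / 2 - l * W / 6"
        by (simp add: kc_def l_def sum_subtractf sum_divide_distrib sum_distrib_right)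
      moreover have "4 / 3 * l * b\<^sup>2 * (A ^ 4 + Dm\<^sup>2 * D\<^sup>2) = l * W / 6" by (simp add: W_def)
      ultimately show ?thesis by linarith
    qed
    have "om / 8 * (C0 * X) \<le> om / 8 * (C0 * (8 * b * (A ^ 4 / 2 + (1 / 2 + Dm) * D\<^sup>2)))"
      using X C00 om_pos by (intro mult_left_mono) auto
    then have "kc / 2 - 4 / 3 * l * b\<^sup>2 * (A ^ 4 + Dm\<^sup>2 * D\<^sup>2) + om / 8 * (c0 * A ^ 4)
        - om / 8 * (C0 * (8 * b * (A ^ 4 / 2 + (1 / 2 + Dm) * D\<^sup>2))) \<le> energy G u g"
      using halflines core unfolding energy_eq[OF H] sum_edges by (simp add: algebra_simps)
    moreover have "kc / 2 - 4 / 3 * l * b\<^sup>2 * (A ^ 4 + Dm\<^sup>2 * D\<^sup>2) + om / 8 * (c0 * A ^ 4)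
        - om / 8 * (C0 * (8 * b * (A ^ 4 / 2 + (1 / 2 + Dm) * D\<^sup>2))) =
      A ^ 4 * (om * c0 / 8 - 4 / 3 * l * b\<^sup>2 - om * C0 * b / 2) +
      kc * (1 / 2 - C\<^sup>2 * (4 / 3 * l * b\<^sup>2 * Dm\<^sup>2 + om * C0 * b * (1 / 2 + Dm)))"
      unfolding D(3) by (simp add: algebra_simps)
    moreover have "0 \<le> \<dots>" using b1 b2 kc0 by simp
    ultimately show ?thesis by linarith
  qed
  show ?thesis
  proof (cases "0 \<le> M")
    case False
    then have "\<not> mass G u \<le> M" if "H1 G u g" for u g using nonneg(1)[OF that] by linarith
    then show ?thesis by (intro exI[of _ 1]) auto
  next
    case True
    have c0: "0 < c0" unfolding c0_def using d d_pi[OF True] by (intro sin_gt_zero) auto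
    have "((\<lambda>b. om * c0 / 8 - 4 / 3 * l * b\<^sup>2 - om * C0 * b / 2) \<longlongrightarrow> om * c0 / 8) (at_right 0)"
      by (auto intro!: tendsto_eq_intros)
    then have e1: "\<forall>\<^sub>F b in at_right 0. 0 < om * c0 / 8 - 4 / 3 * l * b\<^sup>2 - om * C0 * b / 2"
      by (rule order_tendstoD(1)) (use c0 om_pos in simp)
    have "((\<lambda>b. 1 / 2 - C\<^sup>2 * (4 / 3 * l * b\<^sup>2 * Dm\<^sup>2 + om * C0 * b * (1 / 2 + Dm))) \<longlongrightarrow> 1 / 2) (at_right 0)"
      by (auto intro!: tendsto_eq_intros)
    then have e2: "\<forall>\<^sub>F b in at_right 0. 0 < 1 / 2 - C\<^sup>2 * (4 / 3 * l * b\<^sup>2 * Dm\<^sup>2 + om * C0 * b * (1 / 2 + Dm))"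
      by (rule order_tendstoD(1)) simp
    have "\<forall>\<^sub>F b in at_right (0::real). 0 < b" by (rule eventually_at_right_less)
    from eventually_conj[OF this eventually_conj[OF e1 e2]]
    obtain b where "0 < b" "0 < om * c0 / 8 - 4 / 3 * l * b\<^sup>2 - om * C0 * b / 2"
      "0 < 1 / 2 - C\<^sup>2 * (4 / 3 * l * b\<^sup>2 * Dm\<^sup>2 + om * C0 * b * (1 / 2 + Dm))"
      using eventually_happens[of _ "at_right (0::real)"] trivial_limit_at_right_real by blast
    then show ?thesis using key[of _ _ b] by (intro exI[of _ b]) (auto intro: less_imp_le)
  qed
qed

end

section \<open>Compactness on metric graphs\<close>

context nls_graph
begin

text \<open>Edgewise limits along a common subsequence. The total mass may approach
  \<open>mu_R\<close>, but each halfline must keep a uniform distance from it, which is why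
  \<open>M\<close> is separate from \<open>m\<close>.\<close>

lemma graph_compactness:
  assumes H: "\<And>n. H1 G (u n) (g n)" and K: "\<And>n. kin G (g n) \<le> K" and mass: "\<And>n. mass G (u n) \<le> m"
    and M: "M < mu_R" and hm: "\<And>n h. h \<in> hlines G \<Longrightarrow> em (u n) h \<le> M"
    and ml: "(\<lambda>n. mass G (u n)) \<longlonglongrightarrow> \<mu>" and en: "\<And>n. energy G (u n) (g n) \<le> c n" and cl: "c \<longlonglongrightarrow> E"
  shows "\<exists>r w w'. strict_mono (r :: nat \<Rightarrow> nat) \<and> H1 G w w' \<and> mass G w \<le> \<mu> \<and> energy G w w' \<le> E \<and>
    (\<forall>h\<in>hlines G. (\<lambda>n. u (r n) h 0) \<longlonglongrightarrow> w h 0) \<and>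
    (\<forall>e\<in>bounded_edges. uniform_limit (edom G e) (\<lambda>n. u (r n) e) (w e) sequentially)"
proof -
  define P where "P e s \<longleftrightarrow> (\<exists>f g' m \<epsilon>. edge_limit (edom G e) (\<lambda>n. u (s n) e) (\<lambda>n. g (s n) e) f g' m \<epsilon>)" for e and s :: "nat \<Rightarrow> nat"
  have "\<exists>r. strict_mono r \<and> (\<forall>e\<in>edges G. P e r)"
  proof (rule common_subsequence[OF finite_edges(1)])
    fix e and s :: "nat \<Rightarrow> nat" assume e: "e \<in> edges G"
    have b: "em (g (s n)) e \<le> K" "em (u (s n)) e \<le> m" for n
      using em_le[OF H e] K mass order_trans by blast+
    show "\<exists>r :: nat \<Rightarrow> nat. strict_mono r \<and> P e (s \<circ> r)"
    proof (cases "e \<in> hlines G")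
      case True
      have "\<exists>r f g' m \<epsilon>. strict_mono (r :: nat \<Rightarrow> nat) \<and> edge_limit {0..} ((\<lambda>n. u (s n) e) \<circ> r) ((\<lambda>n. g (s n) e) \<circ> r) f g' m \<epsilon>"
      proof (rule halfline_compactness[OF _ M])
        show "H1_on {0..} (u (s n) e) (g (s n) e)" for n using H1_edge[OF H e] True by (simp add: edom_simps)
        show "integral {0..} (\<lambda>x. (g (s n) e x)\<^sup>2) \<le> K" for n using b(1) True by (simp add: em_def edom_simps)
        show "integral {0..} (\<lambda>x. (u (s n) e x)\<^sup>2) \<le> M" for n using hm[OF True] True by (simp add: em_def edom_simps)
      qed
      then show ?thesis using True unfolding P_def by (simp add: o_def edom_simps)
    next
      case False
      have "\<exists>r f g' m \<epsilon>. strict_mono (r :: nat \<Rightarrow> nat) \<and> edge_limit {0..len G e} ((\<lambda>n. u (s n) e) \<circ> r) ((\<lambda>n. g (s n) e) \<circ> r) f g' m \<epsilon>"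
      proof (rule interval_compactness)
        show "0 < len G e" using e False by (intro len_pos) auto
        show "H1_on {0..len G e} (u (s n) e) (g (s n) e)" for n using H1_edge[OF H e] False by (simp add: edom_simps)
        show "integral {0..len G e} (\<lambda>x. (g (s n) e x)\<^sup>2) \<le> K" for n using b(1) False by (simp add: em_def edom_simps)
        show "integral {0..len G e} (\<lambda>x. (u (s n) e x)\<^sup>2) \<le> m" for n using b(2) False by (simp add: em_def edom_simps)
      qed
      then show ?thesis using False unfolding P_def by (simp add: o_def edom_simps)
    qed
  next
    fix e and s r :: "nat \<Rightarrow> nat" assume "P e s" "strict_mono r"
    then show "P e (s \<circ> r)" using edge_limit_subseq unfolding P_def o_def by blast
  qed
  then obtain r where r: "strict_mono (r :: nat \<Rightarrow> nat)"
    and ex: "\<forall>e\<in>edges G. \<exists>f g' m \<epsilon>. edge_limit (edom G e) (\<lambda>n. u (r n) e) (\<lambda>n. g (r n) e) f g' m \<epsilon>"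
    unfolding P_def by blast
  obtain w w' \<nu> \<epsilon> where lim: "\<And>e. e \<in> edges G \<Longrightarrow> edge_limit (edom G e) (\<lambda>n. u (r n) e) (\<lambda>n. g (r n) e) (w e) (w' e) (\<nu> e) (\<epsilon> e)"
    using bchoice[OF ex] by metis
  have src: "(\<lambda>n. u (r n) e 0) \<longlonglongrightarrow> w e 0" if "e \<in> edges G" for e
    using lim[OF that] by (simp add: edge_limit_def)
  have unif: "uniform_limit (edom G e) (\<lambda>n. u (r n) e) (w e) sequentially" if "e \<in> bounded_edges" for e
    using lim[of e] that unfolding edge_limit_def by (auto simp: edom_simps)
  have tgt: "(\<lambda>n. u (r n) e (len G e)) \<longlonglongrightarrow> w e (len G e)" if "e \<in> bounded_edges" for e
    by (rule tendsto_uniform_limitI[OF unif[OF that]]) (use that len_pos[OF that] in \<open>auto simp: edom_simps\<close>)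
  have "\<forall>n. \<exists>\<phi>. \<forall>e\<in>edges G. u n e 0 = \<phi> (src G e) \<and> (e \<notin> hlines G \<longrightarrow> u n e (len G e) = \<phi> (tgt G e))"
    using H unfolding H1_def by blast
  then obtain \<phi> where phi: "\<And>n e. e \<in> edges G \<Longrightarrow> u n e 0 = \<phi> n (src G e)"
    "\<And>n e. e \<in> bounded_edges \<Longrightarrow> u n e (len G e) = \<phi> n (tgt G e)"
    by (metis DiffE)
  \<comment> \<open>The limit of the vertex values depends on the vertex alone, so the edgewise
    limits agree wherever edges meet.\<close>
  define \<psi> where "\<psi> v = Topological_Spaces.lim (\<lambda>n. \<phi> (r n) v)" for v
  have "w e 0 = \<psi> (src G e)" if "e \<in> edges G" for e
    unfolding \<psi>_def using src[OF that] phi(1)[OF that] by (simp add: limI)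
  moreover have "w e (len G e) = \<psi> (tgt G e)" if "e \<in> bounded_edges" for e
    unfolding \<psi>_def using tgt[OF that] phi(2)[OF that] by (simp add: limI)
  moreover have "H1_on (edom G e) (w e) (w' e)" if "e \<in> edges G" for e
    using lim[OF that] by (simp add: edge_limit_def)
  ultimately have Hw: "H1 G w w'" unfolding H1_def edge_H1_iff by blast
  have "mass G w \<le> \<mu>"
  proof -
    have "(\<lambda>n. mass G (u (r n))) \<longlonglongrightarrow> (\<Sum>e\<in>edges G. \<nu> e)"
      unfolding mass_eq[OF H] em_def using lim by (intro tendsto_sum) (simp add: edge_limit_def)
    moreover have "(\<lambda>n. mass G (u (r n))) \<longlonglongrightarrow> \<mu>" using LIMSEQ_subseq_LIMSEQ[OF ml r] by (simp add: o_def)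
    ultimately have "\<mu> = (\<Sum>e\<in>edges G. \<nu> e)" by (rule LIMSEQ_unique[THEN sym])
    moreover have "mass G w \<le> (\<Sum>e\<in>edges G. \<nu> e)"
      unfolding mass_eq[OF Hw] em_def using lim by (intro sum_mono) (simp add: edge_limit_def)
    ultimately show ?thesis by simp
  qed
  moreover have "energy G w w' \<le> E"
  proof -
    have "energy G w w' \<le> (\<Sum>e\<in>edges G. \<epsilon> e)"
      unfolding energy_eq[OF Hw] using lim by (intro sum_mono) (simp add: edge_limit_def)
    also have "\<dots> \<le> E"
    proof (rule LIMSEQ_le)
      show "(\<lambda>n. energy G (u (r n)) (g (r n))) \<longlonglongrightarrow> (\<Sum>e\<in>edges G. \<epsilon> e)"
        unfolding energy_eq[OF H] using lim by (intro tendsto_sum) (simp add: edge_limit_def)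
      show "(\<lambda>n. c (r n)) \<longlonglongrightarrow> E" using LIMSEQ_subseq_LIMSEQ[OF cl r] by (simp add: o_def)
    qed (use en in blast)
    finally show ?thesis .
  qed
  ultimately show ?thesis using r Hw src unif hlines_edges by blast
qed

text \<open>Coercivity bounds the kinetic energy once \<open>\<tau>\<close> stays away from 0.
  Either alternative ensures this: \<open>\<mu>\<close> < \<open>mu_R\<close> because
  \<open>\<tau>\<close> is at least the missing mass, E < 0 because the error C sqrt
  \<open>\<tau>\<close> must make up for the negative energy.\<close>

lemma limit_of_nonpositive_energies:
  assumes no_term: "\<forall>v. \<not> terminal_point G v"
    and H: "\<And>n. H1 G (u n) (g n)" and mass: "\<And>n. mass G (u n) < mu_R"
    and en: "\<And>n. energy G (u n) (g n) \<le> c n" "\<And>n. c n \<le> 0"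
    and ml: "(\<lambda>n. mass G (u n)) \<longlonglongrightarrow> \<mu>" and cl: "c \<longlonglongrightarrow> E" and alt: "E < 0 \<or> \<mu> < mu_R"
  shows "\<exists>r w w' K. strict_mono (r :: nat \<Rightarrow> nat) \<and> H1 G w w' \<and> mass G w \<le> \<mu> \<and> energy G w w' \<le> E \<and>
    (\<forall>n. kin G (g (r n)) \<le> K) \<and>
    (\<forall>h\<in>hlines G. (\<lambda>n. u (r n) h 0) \<longlonglongrightarrow> w h 0) \<and>
    (\<forall>e\<in>bounded_edges. uniform_limit (edom G e) (\<lambda>n. u (r n) e) (w e) sequentially)"
proof -
  obtain C where C: "0 \<le> C" and coer: "\<And>u g. H1 G u g \<Longrightarrow> mass G u < mu_R \<Longrightarrow> energy G u g \<le> 0 \<Longrightarrow>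
    \<exists>\<tau>. 0 < \<tau> \<and> mu_R - mass G u \<le> \<tau> \<and> \<tau> \<le> mu_R - (\<Sum>h\<in>hlines G. em u h) \<and> \<tau> / mu_R * kin G g - C * sqrt \<tau> \<le> 2 * energy G u g"
    using coercivity[OF no_term] by blast
  have "\<forall>n. \<exists>\<tau>. 0 < \<tau> \<and> mu_R - mass G (u n) \<le> \<tau> \<and> \<tau> \<le> mu_R - (\<Sum>h\<in>hlines G. em (u n) h) \<and>
      \<tau> / mu_R * kin G (g n) - C * sqrt \<tau> \<le> 2 * energy G (u n) (g n)"
    using coer[OF H mass] en order_trans by blast
  then obtain \<tau> where tau: "\<And>n. 0 < \<tau> n" "\<And>n. mu_R - mass G (u n) \<le> \<tau> n"
    "\<And>n. \<tau> n \<le> mu_R - (\<Sum>h\<in>hlines G. em (u n) h)"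
    "\<And>n. \<tau> n / mu_R * kin G (g n) - C * sqrt (\<tau> n) \<le> 2 * energy G (u n) (g n)"
    by metis
  have en0: "energy G (u n) (g n) \<le> 0" for n using en order_trans by blast
  have "\<exists>t>0. \<exists>N. \<forall>n\<ge>N. t \<le> \<tau> n"
  proof (cases "\<mu> < mu_R")
    case True
    have "\<forall>\<^sub>F n in sequentially. mass G (u n) < (\<mu> + mu_R) / 2" using ml True by (intro order_tendstoD(2)) auto
    then obtain N where N: "\<And>n. n \<ge> N \<Longrightarrow> mass G (u n) < (\<mu> + mu_R) / 2" by (auto simp: eventually_sequentially)
    have "(mu_R - \<mu>) / 2 \<le> \<tau> n" if "n \<ge> N" for n using N[OF that] tau(2)[of n] by (simp add: field_simps)
    then show ?thesis using True by (intro exI[of _ "(mu_R - \<mu>) / 2"]) auto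
  next
    case False
    then have E: "E < 0" using alt by simp
    have "\<forall>\<^sub>F n in sequentially. c n < E / 2" using cl E by (intro order_tendstoD(2)) auto
    then obtain N where N: "\<And>n. n \<ge> N \<Longrightarrow> c n < E / 2" by (auto simp: eventually_sequentially)
    have low: "- E \<le> C * sqrt (\<tau> n)" if n: "n \<ge> N" for n
    proof -
      have "0 \<le> \<tau> n / mu_R * kin G (g n)" using tau(1)[of n] nonneg(2)[OF H] mu_R_pos by simp
      then show ?thesis using tau(4)[of n] en(1)[of n] N[OF n] by linarith
    qed
    have C': "0 < C" using low[OF order_refl] E C by (cases "C = 0") auto
    have "((- E) / C)\<^sup>2 \<le> \<tau> n" if "n \<ge> N" for n
    proof -
      have "(- E) / C \<le> sqrt (\<tau> n)" using low[OF that] C' by (simp add: field_simps)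
      then have "((- E) / C)\<^sup>2 \<le> (sqrt (\<tau> n))\<^sup>2" using E C' by (intro power_mono divide_nonneg_nonneg) auto
      then show ?thesis using tau(1)[of n] by simp
    qed
    then show ?thesis using E C' by (intro exI[of _ "((- E) / C)\<^sup>2"]) auto
  qed
  then obtain t N where t: "0 < t" "\<And>n. n \<ge> N \<Longrightarrow> t \<le> \<tau> n" by blast
  define K where "K = mu_R * C / sqrt t"
  have kinK: "kin G (g n) \<le> K" if n: "n \<ge> N" for n
  proof -
    have "\<tau> n / mu_R * kin G (g n) \<le> C * sqrt (\<tau> n)" using tau(4)[of n] en0[of n] by linarith
    also have "\<dots> = \<tau> n / mu_R * (mu_R * C / sqrt (\<tau> n))"
    proof -
      have "sqrt (\<tau> n) * sqrt (\<tau> n) = \<tau> n" "0 < sqrt (\<tau> n)" using tau(1)[of n] by auto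
      then show ?thesis using mu_R_pos by (simp add: field_simps)
    qed
    finally have "kin G (g n) \<le> mu_R * C / sqrt (\<tau> n)"
      by (rule mult_left_le_imp_le) (use tau(1)[of n] mu_R_pos in simp)
    also have "\<dots> \<le> K" unfolding K_def using t(2)[OF n] t(1) C mu_R_pos by (intro divide_left_mono) auto
    finally show ?thesis .
  qed
  have hm: "em (u n) h \<le> mu_R - t" if n: "n \<ge> N" and h: "h \<in> hlines G" for n h
  proof -
    have "em (u n) h \<le> (\<Sum>h\<in>hlines G. em (u n) h)"
      using h finite_edges em_nonneg(1)[OF H] hlines_edges by (intro member_le_sum) auto
    then show ?thesis using tau(3)[of n] t(2)[OF n] by linarith
  qed
  define s where "s n = n + N" for n
  have s: "strict_mono s" by (simp add: s_def strict_mono_def)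
  have "\<exists>r w w'. strict_mono (r :: nat \<Rightarrow> nat) \<and> H1 G w w' \<and> mass G w \<le> \<mu> \<and> energy G w w' \<le> E \<and>
    (\<forall>h\<in>hlines G. (\<lambda>n. u (s (r n)) h 0) \<longlonglongrightarrow> w h 0) \<and>
    (\<forall>e\<in>bounded_edges. uniform_limit (edom G e) (\<lambda>n. u (s (r n)) e) (w e) sequentially)"
  proof (rule graph_compactness[where c = "\<lambda>n. c (s n)" and K = K and m = mu_R and M = "mu_R - t" and g = "\<lambda>n. g (s n)"])
    show "(\<lambda>n. mass G (u (s n))) \<longlonglongrightarrow> \<mu>" using LIMSEQ_subseq_LIMSEQ[OF ml s] by (simp add: o_def)
    show "(\<lambda>n. c (s n)) \<longlonglongrightarrow> E" using LIMSEQ_subseq_LIMSEQ[OF cl s] by (simp add: o_def)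
    show "mass G (u (s n)) \<le> mu_R" for n using mass[of "s n"] by simp
  qed (use H kinK hm en t in \<open>auto simp: s_def\<close>)
  then obtain r w w' where r: "strict_mono (r :: nat \<Rightarrow> nat)" "H1 G w w'" "mass G w \<le> \<mu>" "energy G w w' \<le> E"
    "\<forall>h\<in>hlines G. (\<lambda>n. u (s (r n)) h 0) \<longlonglongrightarrow> w h 0"
    "\<forall>e\<in>bounded_edges. uniform_limit (edom G e) (\<lambda>n. u (s (r n)) e) (w e) sequentially"
    by blast
  have "kin G (g ((s \<circ> r) n)) \<le> K" for n by (simp add: kinK s_def)
  then show ?thesis using strict_mono_o[OF s r(1)] r(2-6) by (intro exI[of _ "s \<circ> r"] exI[of _ w] exI[of _ w'] exI[of _ K]) auto
qed

section \<open>Bounds on the energy level\<close>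

lemma Elev_le: "H1 G u g \<Longrightarrow> mass G u = \<mu> \<Longrightarrow> Elev G \<mu> \<le> ereal (energy G u g)"
  unfolding Elev_def H1_mass_def by (rule INF_lower2[of "(u, g)"]) auto

lemma attainedI:
  assumes "H1 G u g" "mass G u = \<mu>" "ereal (energy G u g) \<le> Elev G \<mu>"
  shows "attained G \<mu>"
  using assms Elev_le[OF assms(1,2)] unfolding attained_def H1_mass_def by (intro bexI[of _ "(u, g)"]) auto

lemma attainedD:
  assumes "attained G \<mu>"
  shows "\<exists>u g. H1 G u g \<and> mass G u = \<mu> \<and> (\<forall>v k. H1 G v k \<longrightarrow> mass G v = \<mu> \<longrightarrow> energy G u g \<le> energy G v k)"
proof -
  obtain u g where ug: "H1 G u g" "mass G u = \<mu>" "ereal (energy G u g) = Elev G \<mu>"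
    using assms unfolding attained_def H1_mass_def by auto
  have "energy G u g \<le> energy G v k" if "H1 G v k" "mass G v = \<mu>" for v k
    using Elev_le[OF that] by (simp flip: ug(3))
  then show ?thesis using ug(1,2) by blast
qed

lemma energy_scale_tendsto:
  "((\<lambda>c. energy G (\<lambda>e x. c * u e x) (\<lambda>e x. c * g e x)) \<longlongrightarrow> energy G u g) (at_left 1)"
proof -
  have "((\<lambda>c. c\<^sup>2 * kin G g / 2 - c ^ 6 * L6 G u / 6) \<longlongrightarrow> 1\<^sup>2 * kin G g / 2 - 1 ^ 6 * L6 G u / 6) (at_left 1)"
    by (rule tendsto_diff tendsto_divide tendsto_mult tendsto_power tendsto_const tendsto_ident_at | simp)+
  then have "((\<lambda>c. c\<^sup>2 * kin G g / 2 - c ^ 6 * L6 G u / 6) \<longlongrightarrow> energy G u g) (at_left 1)" by (simp add: energy_def)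
  then show ?thesis by (simp only: scale_eqs(4))
qed

text \<open>Coercivity requires mass strictly below \<open>mu_R\<close>; the endpoint is reached by
  scaling with factors increasing to 1.\<close>

lemma Elev_lower_bound:
  assumes no_term: "\<forall>v. \<not> terminal_point G v" and mu: "\<mu> \<le> mu_R"
  shows "- \<infinity> < Elev G \<mu>"
proof -
  obtain C where C: "0 \<le> C" and coer: "\<And>u g. H1 G u g \<Longrightarrow> mass G u < mu_R \<Longrightarrow> energy G u g \<le> 0 \<Longrightarrow>
    \<exists>\<tau>. 0 < \<tau> \<and> mu_R - mass G u \<le> \<tau> \<and> \<tau> \<le> mu_R - (\<Sum>h\<in>hlines G. em u h) \<and> \<tau> / mu_R * kin G g - C * sqrt \<tau> \<le> 2 * energy G u g"
    using coercivity[OF no_term] by blast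
  define B where "B = - (C * sqrt mu_R)"
  have lt: "B \<le> energy G u g" if H: "H1 G u g" and m: "mass G u < mu_R" for u g
  proof (cases "energy G u g \<le> 0")
    case True
    obtain \<tau> where t: "0 < \<tau>" "\<tau> \<le> mu_R - (\<Sum>h\<in>hlines G. em u h)" "\<tau> / mu_R * kin G g - C * sqrt \<tau> \<le> 2 * energy G u g"
      using coer[OF H m True] by blast
    have "0 \<le> (\<Sum>h\<in>hlines G. em u h)" using em_nonneg(1)[OF H] hlines_edges by (intro sum_nonneg) auto
    then have "C * sqrt \<tau> \<le> C * sqrt mu_R" using t(2) C by (intro mult_left_mono real_sqrt_le_mono) auto
    moreover have "0 \<le> \<tau> / mu_R * kin G g" using t(1) mu_R_pos nonneg(2)[OF H] by simp
    ultimately show ?thesis using t(3) True unfolding B_def by linarith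
  next
    case False
    moreover have "B \<le> 0" using C mu_R_pos by (simp add: B_def)
    ultimately show ?thesis by linarith
  qed
  have "B \<le> energy G u g" if H: "H1 G u g" and m: "mass G u = \<mu>" for u g
  proof (rule tendsto_lowerbound[OF energy_scale_tendsto])
    have "B \<le> energy G (\<lambda>e x. c * u e x) (\<lambda>e x. c * g e x)" if c: "0 < c" "c < 1" for c
    proof (rule lt[OF H1_scale[OF H]])
      have "c\<^sup>2 * mass G u \<le> c\<^sup>2 * mu_R" using m mu by (intro mult_left_mono) auto
      also have "\<dots> < mu_R" using c mu_R_pos by (simp add: power_less_one_iff abs_square_less_1)
      finally show "mass G (\<lambda>e x. c * u e x) < mu_R" by (simp add: scale_eqs)
    qed
    then show "\<forall>\<^sub>F c in at_left 1. B \<le> energy G (\<lambda>e x. c * u e x) (\<lambda>e x. c * g e x)"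
      by (auto simp: eventually_at_left_field intro!: exI[of _ 0])
  qed simp
  then have "ereal B \<le> Elev G \<mu>" unfolding Elev_def H1_mass_def by (intro INF_greatest) auto
  then show ?thesis by (metis MInfty_neq_ereal(1) ereal_infty_less(2) ereal_infty_less_eq(2))
qed

text \<open>The tail takes a mass just below \<open>mu_R\<close>, where the cotangent is very
  negative, while the excess over \<open>mu_R\<close> keeps the boundary value bounded away from
  0.\<close>

lemma low_energy_above_mu_R:
  assumes two: "card (hlines G) > 1" and mu: "mu_R < \<mu>"
  shows "\<exists>u g. H1 G u g \<and> mass G u = \<mu> \<and> energy G u g < Z"
proof -
  obtain h where h: "h \<in> hlines G" using noncompact by (auto simp: noncompact_def)
  define R where "R = (\<Sum>e\<in>bounded_edges. len G e) + (real (card (hlines G)) - 1) / 2"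
  define Q where "Q = (real (card (hlines G)) - 1) / 4"
  have "0 \<le> (\<Sum>e\<in>bounded_edges. len G e)" using len_pos by (intro sum_nonneg) (auto intro: less_imp_le)
  then have R: "0 < R" using two by (auto simp: R_def intro: add_nonneg_pos)
  have Q: "0 \<le> Q" using two by (simp add: Q_def)
  define \<alpha> where "\<alpha> = (\<mu> - mu_R) / R"
  have al: "0 < \<alpha>" using mu R by (simp add: \<alpha>_def)
  \<comment> \<open>Large enough that om/8 * Y * \<open>\<alpha>\<close>^2 exceeds |Z| plus the
    energy allowed on the other halflines; \<open>Y\<close> becomes minus the cotangent.\<close>
  define Y where "Y = 1 + (\<bar>Z\<bar> + \<mu> / R * Q) * 8 / (om * \<alpha>\<^sup>2)"
  have mu0: "0 < \<mu>" using mu mu_R_pos by simp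
  have Y: "0 < Y" unfolding Y_def using mu0 R Q om_pos by (intro add_pos_nonneg divide_nonneg_nonneg mult_nonneg_nonneg add_nonneg_nonneg) auto
  define m where "m = (pi - arctan (1 / Y)) / om"
  have at: "0 < arctan (1 / Y)" "arctan (1 / Y) < pi / 2" using Y arctan_ubound[of "1 / Y"] by auto
  have omm: "om * m = pi - arctan (1 / Y)" using om_pos by (simp add: m_def)
  have m: "0 < m" "m < mu_R"
  proof -
    have "arctan (1 / Y) < pi" using at pi_gt_zero by linarith
    then show "0 < m" using om_pos by (simp add: m_def)
    have "om * m < om * mu_R" using omm at om_mu_R by simp
    then show "m < mu_R" using om_pos by simp
  qed
  have cotY: "cot (om * m) = - Y"
    unfolding omm cot_pi_minus using Y by (simp add: cot_altdef tan_arctan)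
  \<comment> \<open>The boundary value that distributes the remaining mass over the core and the
    other halflines.\<close>
  define a where "a = sqrt ((\<mu> - m) / R)"
  have a2: "a\<^sup>2 = (\<mu> - m) / R" using m mu R by (simp add: a_def)
  have a: "a \<noteq> 0" using m mu R by (simp add: a_def)
  obtain u g where ug: "H1 G u g" "mass G u = m + a\<^sup>2 * R" "energy G u g \<le> om / 8 * (cot (om * m) * a ^ 4) + a\<^sup>2 * Q"
    using test_function[OF h a m] unfolding R_def Q_def by blast
  have "mass G u = \<mu>" using ug(2) a2 R by simp
  moreover have "energy G u g < Z"
  proof -
    have "\<alpha> \<le> a\<^sup>2" unfolding a2 \<alpha>_def using m R by (intro divide_right_mono) auto
    then have "\<alpha>\<^sup>2 \<le> (a\<^sup>2)\<^sup>2" using al by (intro power_mono) auto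
    then have "om / 8 * (Y * \<alpha>\<^sup>2) \<le> om / 8 * (Y * a ^ 4)" using om_pos Y by (intro mult_left_mono) auto
    moreover have "a\<^sup>2 * Q \<le> \<mu> / R * Q" unfolding a2 using m R Q by (intro mult_right_mono divide_right_mono) auto
    moreover have "om / 8 * (Y * \<alpha>\<^sup>2) = om / 8 * \<alpha>\<^sup>2 + (\<bar>Z\<bar> + \<mu> / R * Q)"
    proof -
      have "om * \<alpha>\<^sup>2 \<noteq> 0" using om_pos al by simp
      then show ?thesis unfolding Y_def by (simp add: field_simps)
    qed
    moreover have "0 < om / 8 * \<alpha>\<^sup>2" using om_pos al by simp
    moreover have "energy G u g \<le> - (om / 8 * (Y * a ^ 4)) + a\<^sup>2 * Q" using ug(3) unfolding cotY by simp
    ultimately show ?thesis by linarith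
  qed
  ultimately show ?thesis using ug(1) by blast
qed

text \<open>Almost all the mass goes into a tail with tiny boundary value; cot x <= 1/x bounds its
  energy by a^4/(8 m). Thus no positive energy can be minimal.\<close>

lemma small_energy_below_mu_R:
  assumes two: "card (hlines G) > 1" and mu: "0 < \<mu>" "\<mu> < mu_R" and d: "0 < \<delta>"
  shows "\<exists>u g. H1 G u g \<and> mass G u = \<mu> \<and> energy G u g < \<delta>"
proof -
  obtain h where h: "h \<in> hlines G" using noncompact by (auto simp: noncompact_def)
  define R where "R = (\<Sum>e\<in>bounded_edges. len G e) + (real (card (hlines G)) - 1) / 2"
  define Q where "Q = (real (card (hlines G)) - 1) / 4"
  have "0 \<le> (\<Sum>e\<in>bounded_edges. len G e)" using len_pos by (intro sum_nonneg) (auto intro: less_imp_le)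
  then have R: "0 < R" using two by (auto simp: R_def intro: add_nonneg_pos)
  have "((\<lambda>a::real. a\<^sup>2 * R) \<longlongrightarrow> 0) (at_right 0)" by (auto intro!: tendsto_eq_intros)
  then have e1: "\<forall>\<^sub>F a in at_right 0. a\<^sup>2 * R < \<mu> / 2" using mu by (intro order_tendstoD(2)) auto
  have "((\<lambda>a::real. a ^ 4 / (4 * \<mu>) + a\<^sup>2 * Q) \<longlongrightarrow> 0) (at_right 0)" using mu by (auto intro!: tendsto_eq_intros)
  then have e2: "\<forall>\<^sub>F a in at_right 0. a ^ 4 / (4 * \<mu>) + a\<^sup>2 * Q < \<delta>" using d by (intro order_tendstoD(2)) auto
  have "\<forall>\<^sub>F a in at_right (0::real). 0 < a" by (rule eventually_at_right_less)
  from eventually_conj[OF this eventually_conj[OF e1 e2]]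
  obtain a where a: "0 < a" "a\<^sup>2 * R < \<mu> / 2" "a ^ 4 / (4 * \<mu>) + a\<^sup>2 * Q < \<delta>"
    using eventually_happens[of _ "at_right (0::real)"] trivial_limit_at_right_real by blast
  define m where "m = \<mu> - a\<^sup>2 * R"
  have "0 < a\<^sup>2 * R" using a R by simp
  then have m: "\<mu> / 2 < m" "m < mu_R" "0 < m" using a(2) mu unfolding m_def by linarith+
  obtain u g where ug: "H1 G u g" "mass G u = m + a\<^sup>2 * R" "energy G u g \<le> om / 8 * (cot (om * m) * a ^ 4) + a\<^sup>2 * Q"
    using test_function[OF h _ m(3,2), of a] a unfolding R_def Q_def by blast
  have "om * m < om * mu_R" using m om_pos by simp
  then have "cot (om * m) \<le> 1 / (om * m)" using m om_pos om_mu_R by (intro cot_le_inverse) auto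
  then have "om / 8 * (cot (om * m) * a ^ 4) \<le> om / 8 * (1 / (om * m) * a ^ 4)"
    using om_pos by (intro mult_left_mono mult_right_mono) auto
  also have "\<dots> = a ^ 4 / (8 * m)" using om_pos by simp
  also have "\<dots> \<le> a ^ 4 / (4 * \<mu>)" using m mu by (intro divide_left_mono) auto
  finally have "energy G u g < \<delta>" using ug(3) a(3) by linarith
  then show ?thesis using ug by (auto simp: m_def)
qed

text \<open>A function with Gagliardo-Nirenberg quotient above 3/\<open>\<mu>\<close>^2, rescaled to
  mass \<open>\<mu>\<close>.\<close>

lemma negative_energy_above_mu_crit:
  assumes two: "card (hlines G) > 1" and mu: "0 < \<mu>" "mu_crit G < \<mu>"
  shows "\<exists>u g. H1 G u g \<and> mass G u = \<mu> \<and> energy G u g < 0"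
proof -
  let ?S = "{(u, g). H1 G u g \<and> (\<exists>e\<in>edges G. \<exists>x\<in>edom G e. u e x \<noteq> 0)}"
  have pos: "0 < mass G u \<and> 0 < kin G g \<and> (u, g) \<in> ?S" if H: "H1 G u g" and L: "0 < L6 G u" for u g
  proof -
    have ex: "\<exists>e\<in>edges G. \<exists>x\<in>edom G e. u e x \<noteq> 0" using L6_zero[OF H] L by force
    then have "mass G u \<noteq> 0" "kin G g \<noteq> 0" using mass_zero[OF H] kin_zero[OF H] by blast+
    then show ?thesis using nonneg[OF H] ex H by auto
  qed
  have KGpos: "0 < KG G"
  proof -
    obtain u g where ug: "H1 G u g" "energy G u g < 0"
      using low_energy_above_mu_R[OF two, of "mu_R + 1" 0] by auto
    have L: "0 < L6 G u" using ug(2) nonneg(2)[OF ug(1)] by (simp add: energy_def)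
    have "ereal (L6 G u / ((mass G u)\<^sup>2 * kin G g)) \<le> KG G"
      unfolding KG_def using pos[OF ug(1) L] by (intro SUP_upper2[of "(u, g)"]) auto
    moreover have "0 < L6 G u / ((mass G u)\<^sup>2 * kin G g)" using pos[OF ug(1) L] L by simp
    ultimately show ?thesis by (metis ereal_less(2) less_le_trans)
  qed
  \<comment> \<open>If \<open>KG\<close> is infinite, so that \<open>mu_crit\<close> is 0 by default
    values, the inequality is immediate.\<close>
  have "ereal (3 / \<mu>\<^sup>2) < KG G"
  proof (cases "KG G")
    case (real K)
    then have K: "0 < K" using KGpos by simp
    have "sqrt (3 / K) < \<mu>" using mu(2) real by (simp add: mu_crit_def)
    then have "(sqrt (3 / K))\<^sup>2 < \<mu>\<^sup>2" using K by (intro power_strict_mono) auto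
    then have "3 / K < \<mu>\<^sup>2" using K by simp
    then show ?thesis using real K mu(1) by (simp add: field_simps)
  qed (use KGpos in auto)
  then obtain u g where ug: "(u, g) \<in> ?S" "3 / \<mu>\<^sup>2 < L6 G u / ((mass G u)\<^sup>2 * kin G g)"
    unfolding KG_def less_SUP_iff by auto
  have H: "H1 G u g" using ug(1) by auto
  have "0 < 3 / \<mu>\<^sup>2" using mu by simp
  \<comment> \<open>Beyond the sign of the quotient, this ensures positive mass and kinetic energy,
    so the quotient is genuine and not a division by 0.\<close>
  then have "L6 G u \<noteq> 0" using ug(2) by (intro notI) simp
  then have L: "0 < L6 G u" using nonneg(3)[OF H] by simp
  have p: "0 < mass G u" "0 < kin G g" using pos[OF H L] by auto
  define c where "c = sqrt (\<mu> / mass G u)"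
  have c2: "c\<^sup>2 = \<mu> / mass G u" using mu p by (simp add: c_def)
  have c0: "0 < c\<^sup>2" using mu p unfolding c2 by simp
  have "mass G (\<lambda>e x. c * u e x) = \<mu>" using p by (simp add: scale_eqs c2)
  moreover have "energy G (\<lambda>e x. c * u e x) (\<lambda>e x. c * g e x) < 0"
  proof -
    have "3 * kin G g < (\<mu> / mass G u)\<^sup>2 * L6 G u" using ug(2) p mu by (simp add: field_simps)
    then have "c\<^sup>2 * (3 * kin G g) < c\<^sup>2 * ((c\<^sup>2)\<^sup>2 * L6 G u)" using c0 unfolding c2 by (rule mult_strict_left_mono)
    moreover have "c\<^sup>2 * ((c\<^sup>2)\<^sup>2 * L6 G u) = c ^ 6 * L6 G u" by (simp flip: power_mult power_add mult.assoc)
    ultimately have "c\<^sup>2 * kin G g / 2 - c ^ 6 * L6 G u / 6 < 0" by linarith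
    then show ?thesis by (simp only: scale_eqs(4))
  qed
  ultimately show ?thesis using H1_scale[OF H] by blast
qed

end

section \<open>Ground states\<close>

context nls_graph
begin

text \<open>Negativity of the level serves three times: it gives compactness even at
  \<open>mu_R\<close>, prevents the limit from being zero, and makes upward scaling
  harmless.\<close>

lemma attained_if_negative:
  assumes no_term: "\<forall>v. \<not> terminal_point G v" and mu: "0 < \<mu>" "\<mu> \<le> mu_R" and neg: "Elev G \<mu> < 0"
  shows "attained G \<mu>"
proof -
  obtain E where E: "Elev G \<mu> = ereal E"
    using Elev_lower_bound[OF no_term mu(2)] neg by (cases "Elev G \<mu>") auto
  have E0: "E < 0" using neg E by simp
  define \<epsilon> where "\<epsilon> n = 1 / (real n + 1)" for n
  have eps: "0 < \<epsilon> n" "\<epsilon> n \<le> 1" for n by (auto simp: \<epsilon>_def)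
  have eps0: "\<epsilon> \<longlonglongrightarrow> 0" unfolding \<epsilon>_def using LIMSEQ_inverse_real_of_nat by (simp add: inverse_eq_divide add.commute)
  \<comment> \<open>Capped at 0 so that coercivity applies along the sequence, yet still strictly
    above the infimum.\<close>
  define c where "c n = min 0 (E + \<epsilon> n)" for n
  have cE: "E < c n" for n using E0 eps[of n] by (simp add: c_def)
  have "\<exists>p. H1 G (fst p) (snd p) \<and> mass G (fst p) < mu_R \<and> (1 - \<epsilon> n)\<^sup>2 * \<mu> \<le> mass G (fst p) \<and>
      mass G (fst p) \<le> \<mu> \<and> energy G (fst p) (snd p) \<le> c n" for n
  proof -
    have "Elev G \<mu> < ereal (c n)" using cE[of n] E by simp
    then obtain u g where ug: "H1 G u g" "mass G u = \<mu>" "energy G u g < c n"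
      unfolding Elev_def INF_less_iff H1_mass_def by auto
    \<comment> \<open>Shrinking slightly brings the mass strictly below \<open>mu_R\<close>, also
      when \<open>\<mu>\<close> equals \<open>mu_R\<close>.\<close>
    have "\<forall>\<^sub>F t in at_left 1. energy G (\<lambda>e x. t * u e x) (\<lambda>e x. t * g e x) < c n"
      by (rule order_tendstoD(2)[OF energy_scale_tendsto ug(3)])
    moreover have "\<forall>\<^sub>F t in at_left (1::real). 1 - \<epsilon> n < t \<and> t < 1"
      using eps[of n] by (auto simp: eventually_at_left_field intro!: exI[of _ "1 - \<epsilon> n"])
    ultimately have "\<forall>\<^sub>F t in at_left (1::real). energy G (\<lambda>e x. t * u e x) (\<lambda>e x. t * g e x) < c n \<and> 1 - \<epsilon> n < t \<and> t < 1"
      by (rule eventually_conj)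
    then obtain t where t: "energy G (\<lambda>e x. t * u e x) (\<lambda>e x. t * g e x) < c n" "1 - \<epsilon> n < t" "t < 1"
      using eventually_happens[of _ "at_left (1::real)"] trivial_limit_at_left_real by blast
    have t2: "0 < t" "t\<^sup>2 < 1" "(1 - \<epsilon> n)\<^sup>2 \<le> t\<^sup>2" using t eps[of n] by (auto simp: abs_square_less_1 intro!: power_mono)
    have "t\<^sup>2 * \<mu> < 1 * \<mu>" using t2 mu by (intro mult_strict_right_mono) auto
    moreover have "(1 - \<epsilon> n)\<^sup>2 * \<mu> \<le> t\<^sup>2 * \<mu>" using t2 mu by (intro mult_right_mono) auto
    moreover have "mass G (\<lambda>e x. t * u e x) = t\<^sup>2 * \<mu>" by (simp add: scale_eqs(1) ug(2))
    ultimately show ?thesis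
      using H1_scale[OF ug(1), of t] t(1) mu(2)
      by (intro exI[of _ "(\<lambda>e x. t * u e x, \<lambda>e x. t * g e x)"]) auto
  qed
  then obtain p where p: "\<And>n. H1 G (fst (p n)) (snd (p n))" "\<And>n. mass G (fst (p n)) < mu_R"
    "\<And>n. (1 - \<epsilon> n)\<^sup>2 * \<mu> \<le> mass G (fst (p n))" "\<And>n. mass G (fst (p n)) \<le> \<mu>" "\<And>n. energy G (fst (p n)) (snd (p n)) \<le> c n"
    by metis
  have ml: "(\<lambda>n. mass G (fst (p n))) \<longlonglongrightarrow> \<mu>"
  proof (rule tendsto_sandwich)
    have "(\<lambda>n. (1 - \<epsilon> n)\<^sup>2 * \<mu>) \<longlonglongrightarrow> (1 - 0)\<^sup>2 * \<mu>" by (intro tendsto_intros eps0)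
    then show "(\<lambda>n. (1 - \<epsilon> n)\<^sup>2 * \<mu>) \<longlonglongrightarrow> \<mu>" by simp
    show "(\<lambda>n. \<mu>) \<longlonglongrightarrow> \<mu>" by simp
  qed (use p in auto)
  have "c \<longlonglongrightarrow> min 0 (E + 0)" unfolding c_def by (intro tendsto_intros eps0)
  then have cl: "c \<longlonglongrightarrow> E" using E0 by simp
  obtain w w' where w: "H1 G w w'" "mass G w \<le> \<mu>" "energy G w w' \<le> E"
    using limit_of_nonpositive_energies[OF no_term p(1,2,5) _ ml cl] E0 by (auto simp: c_def)
  have L: "0 < L6 G w" using w(3) E0 nonneg(2)[OF w(1)] by (simp add: energy_def)
  have "mass G w \<noteq> 0"
  proof
    assume "mass G w = 0"
    then have "L6 G w = 0" by (intro L6_zero[OF w(1)] mass_zero[OF w(1)])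
    then show False using L by simp
  qed
  then have m: "0 < mass G w" using nonneg(1)[OF w(1)] by simp
  \<comment> \<open>The factor t >= 1 restores the lost mass; E(t w) <= t^2 E(w) <= E(w) because
    E(w) is negative.\<close>
  define t where "t = sqrt (\<mu> / mass G w)"
  have t2: "t\<^sup>2 = \<mu> / mass G w" "1 \<le> t\<^sup>2" using m w(2) mu by (auto simp: t_def)
  have "mass G (\<lambda>e x. t * w e x) = \<mu>" using m by (simp add: scale_eqs t2)
  moreover have "energy G (\<lambda>e x. t * w e x) (\<lambda>e x. t * w' e x) \<le> E"
  proof -
    have "1 * 1 \<le> (t\<^sup>2) * (t\<^sup>2)" using t2(2) by (intro mult_mono) auto
    then have "t\<^sup>2 * 1 * L6 G w \<le> t\<^sup>2 * ((t\<^sup>2) * (t\<^sup>2)) * L6 G w" using L by (intro mult_right_mono mult_left_mono) auto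
    also have "t\<^sup>2 * ((t\<^sup>2) * (t\<^sup>2)) = t ^ 6" by (simp flip: power_add)
    finally have "energy G (\<lambda>e x. t * w e x) (\<lambda>e x. t * w' e x) \<le> t\<^sup>2 * energy G w w'"
      unfolding scale_eqs(4) unfolding energy_def by (simp add: algebra_simps)
    also have "\<dots> \<le> 1 * energy G w w'" using t2(2) w(3) E0 by (intro mult_right_mono_neg) auto
    finally show ?thesis using w(3) by simp
  qed
  ultimately show ?thesis by (intro attainedI[OF H1_scale[OF w(1)]]) (simp_all add: E)
qed

lemma attained_at_mu_crit:
  assumes no_term: "\<forall>v. \<not> terminal_point G v" and two: "card (hlines G) > 1"
    and mu: "0 < mu_crit G" "mu_crit G < mu_R"
  shows "attained G (mu_crit G)"
proof -
  \<comment> \<open>Strictly between the two masses, so that \<open>vanishing\<close> holds with one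
    bound for the whole sequence.\<close>
  define M where "M = (mu_crit G + mu_R) / 2"
  have M: "mu_crit G < M" "M < mu_R" using mu by (auto simp: M_def)
  define \<mu> where "\<mu> n = mu_crit G + (M - mu_crit G) / (real n + 1)" for n
  have mun: "mu_crit G < \<mu> n" "\<mu> n \<le> M" for n
  proof -
    show "mu_crit G < \<mu> n" using M by (simp add: \<mu>_def)
    have "(M - mu_crit G) / (real n + 1) \<le> (M - mu_crit G) / 1" using M by (intro divide_left_mono) auto
    then show "\<mu> n \<le> M" by (simp add: \<mu>_def)
  qed
  have "(\<lambda>n. (M - mu_crit G) / (real n + 1)) \<longlonglongrightarrow> 0"
    using tendsto_mult[OF tendsto_const[of "M - mu_crit G"] LIMSEQ_inverse_real_of_nat] by (simp add: divide_inverse add.commute)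
  from tendsto_add[OF tendsto_const[of "mu_crit G"] this]
  have mul: "\<mu> \<longlonglongrightarrow> mu_crit G" unfolding \<mu>_def by simp
  have "\<forall>n. \<exists>u g. H1 G u g \<and> mass G u = \<mu> n \<and> energy G u g < 0"
    using negative_energy_above_mu_crit[OF two less_trans[OF mu(1) mun(1)] mun(1)] by blast
  then obtain u g where ug: "\<And>n. H1 G (u n) (g n)" "\<And>n. mass G (u n) = \<mu> n" "\<And>n. energy G (u n) (g n) < 0"
    by metis
  have "\<exists>r w w' K. strict_mono (r :: nat \<Rightarrow> nat) \<and> H1 G w w' \<and> mass G w \<le> mu_crit G \<and> energy G w w' \<le> 0 \<and>
    (\<forall>n. kin G (g (r n)) \<le> K) \<and> (\<forall>h\<in>hlines G. (\<lambda>n. u (r n) h 0) \<longlonglongrightarrow> w h 0) \<and>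
    (\<forall>e\<in>bounded_edges. uniform_limit (edom G e) (\<lambda>n. u (r n) e) (w e) sequentially)"
  proof (rule limit_of_nonpositive_energies[OF no_term ug(1), where c = "\<lambda>_. 0"])
    show "mass G (u n) < mu_R" for n using ug(2) mun(2)[of n] M by simp
    show "(\<lambda>n. mass G (u n)) \<longlonglongrightarrow> mu_crit G" using mul ug(2) by simp
    show "energy G (u n) (g n) \<le> 0" for n using ug(3)[of n] by simp
  qed (use mu in auto)
  then obtain r w w' K where r: "strict_mono (r :: nat \<Rightarrow> nat)" and w: "H1 G w w'" "mass G w \<le> mu_crit G" "energy G w w' \<le> 0"
    and K: "\<And>n. kin G (g (r n)) \<le> K" and lh: "\<And>h. h \<in> hlines G \<Longrightarrow> (\<lambda>n. u (r n) h 0) \<longlonglongrightarrow> w h 0"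
    and le: "\<And>e. e \<in> bounded_edges \<Longrightarrow> uniform_limit (edom G e) (\<lambda>n. u (r n) e) (w e) sequentially"
    by blast
  have K0: "0 \<le> K" by (rule order_trans[OF nonneg(2)[OF ug(1)] K[of 0]])
  \<comment> \<open>A zero limit would make the sequence uniformly small on the core and at the
    halfline vertices, where \<open>vanishing\<close> forbids its negative energies.\<close>
  have m: "0 < mass G w"
  proof (rule ccontr)
    assume "\<not> 0 < mass G w"
    then have m0: "mass G w = 0" using nonneg(1)[OF w(1)] by simp
    obtain b where b: "0 < b" "\<forall>u g. H1 G u g \<and> mass G u \<le> M \<and> kin G g \<le> K \<and>
       (\<forall>e\<in>bounded_edges. \<forall>x\<in>edom G e. \<bar>u e x\<bar> \<le> b) \<and> (\<forall>h\<in>hlines G. \<bar>u h 0\<bar> \<le> b) \<longrightarrow> 0 \<le> energy G u g"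
      using vanishing[OF two M(2) K0] by (elim exE conjE)
    have "\<forall>\<^sub>F n in sequentially. \<bar>u (r n) h 0\<bar> \<le> b" if h: "h \<in> hlines G" for h
    proof -
      have "w h 0 = 0" using mass_zero[OF w(1) m0 hlines_edges[OF h]] h by (simp add: edom_simps)
      then have "(\<lambda>n. \<bar>u (r n) h 0\<bar>) \<longlonglongrightarrow> 0" using tendsto_rabs[OF lh[OF h]] by simp
      then have "\<forall>\<^sub>F n in sequentially. \<bar>u (r n) h 0\<bar> < b" using b(1) by (rule order_tendstoD(2))
      then show ?thesis by (rule eventually_mono) simp
    qed
    then have e1: "\<forall>\<^sub>F n in sequentially. \<forall>h\<in>hlines G. \<bar>u (r n) h 0\<bar> \<le> b"
      using finite_edges by (simp add: eventually_ball_finite)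
    have "\<forall>\<^sub>F n in sequentially. \<forall>x\<in>edom G e. \<bar>u (r n) e x\<bar> \<le> b" if e: "e \<in> bounded_edges" for e
    proof -
      have "\<forall>\<^sub>F n in sequentially. \<forall>x\<in>edom G e. dist (u (r n) e x) (w e x) < b"
        using uniform_limitD[OF le[OF e] b(1)] .
      then show ?thesis
      proof eventually_elim
        case (elim n)
        show ?case
        proof
          fix x assume x: "x \<in> edom G e"
          have "w e x = 0" using mass_zero[OF w(1) m0 _ x] e by blast
          then show "\<bar>u (r n) e x\<bar> \<le> b" using bspec[OF elim x] by (simp add: dist_real_def)
        qed
      qed
    qed
    then have e2: "\<forall>\<^sub>F n in sequentially. \<forall>e\<in>bounded_edges. \<forall>x\<in>edom G e. \<bar>u (r n) e x\<bar> \<le> b"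
      using finite_edges by (simp add: eventually_ball_finite)
    obtain n where n: "\<forall>h\<in>hlines G. \<bar>u (r n) h 0\<bar> \<le> b" "\<forall>e\<in>bounded_edges. \<forall>x\<in>edom G e. \<bar>u (r n) e x\<bar> \<le> b"
      using eventually_happens[OF eventually_conj[OF e1 e2]] by auto
    have "mass G (u (r n)) \<le> M" by (simp add: ug(2) mun(2))
    then have "0 \<le> energy G (u (r n)) (g (r n))"
      using b(2)[rule_format, OF conjI[OF ug(1) conjI[OF _ conjI[OF K conjI[OF n(2,1)]]]]] by simp
    then show False using ug(3)[of "r n"] by simp
  qed
  have kin: "0 < kin G w'" by (rule kin_pos[OF w(1) m])
  \<comment> \<open>Mass below critical would force positive energy by \<open>GN_energy\<close>, but
    the limit has energy at most 0.\<close>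
  have "mass G w = mu_crit G"
  proof (rule ccontr)
    assume "mass G w \<noteq> mu_crit G"
    then have "mass G w / mu_crit G < 1" "0 \<le> mass G w / mu_crit G" using w(2) mu m by auto
    then have "(mass G w / mu_crit G)\<^sup>2 < 1" by (simp add: abs_square_less_1)
    then have "0 < kin G w' / 2 * (1 - (mass G w / mu_crit G)\<^sup>2)" using kin by simp
    then show False using GN_energy[OF mu(1) w(1)] w(3) by linarith
  qed
  moreover have "ereal (energy G w w') \<le> Elev G (mu_crit G)"
    unfolding Elev_def H1_mass_def
  proof (rule INF_greatest)
    fix p assume "p \<in> {(u, g). H1 G u g \<and> mass G u = mu_crit G}"
    then have "H1 G (fst p) (snd p)" "mass G (fst p) = mu_crit G" by auto
    then have "0 \<le> energy G (fst p) (snd p)" using GN_energy[OF mu(1), of "fst p" "snd p"] mu(1) by simp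
    then show "ereal (energy G w w') \<le> ereal (energy G (fst p) (snd p))" using w(3) by simp
  qed
  ultimately show ?thesis by (rule attainedI[OF w(1)])
qed

end

theorem theorem7p4:
  fixes G :: "('v, 'e) mgraph"
  assumes "metric_graph G"
    and "connected_mgraph G"
    and "noncompact G"
    and "\<forall>v. \<not> terminal_point G v"
    and "\<not> assumption_H G"
    and "card (hlines G) > 1"
    and "mu_crit G < mu_R"
  shows "(\<forall>\<mu>. mu_crit G < \<mu> \<and> \<mu> \<le> mu_R \<longrightarrow> - \<infinity> < Elev G \<mu> \<and> Elev G \<mu> < 0) \<and>
         (\<forall>\<mu>>0. attained G \<mu> \<longleftrightarrow> mu_crit G \<le> \<mu> \<and> \<mu> \<le> mu_R)"
proof -
  interpret nls_graph G by (rule nls_graph.intro[OF assms(1-3)])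
  note no_term = assms(4) and two = assms(6)
  have Elev_neg: "Elev G \<mu> < 0" if mu: "0 < \<mu>" "mu_crit G < \<mu>" for \<mu>
  proof -
    obtain u g where ug: "H1 G u g" "mass G u = \<mu>" "energy G u g < 0"
      using negative_energy_above_mu_crit[OF two mu] by blast
    have "ereal (energy G u g) < 0" using ug(3) by simp
    then show ?thesis using Elev_le[OF ug(1,2)] by (rule le_less_trans[rotated])
  qed
  \<comment> \<open>In HOL the square root of a negative number is negative, so this needs a
    nonnegative \<open>KG\<close>. It turns \<open>\<mu>\<close> > \<open>mu_crit\<close> into
    \<open>\<mu>\<close> > 0.\<close>
  have crit0: "0 \<le> mu_crit G"
  proof -
    have "0 \<le> KG G"
    proof -
      obtain u g where ug: "H1 G u g" "energy G u g < 0" using low_energy_above_mu_R[OF two, of "mu_R + 1" 0] by auto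
      have L: "0 < L6 G u" using ug(2) nonneg(2)[OF ug(1)] by (simp add: energy_def)
      then have "\<exists>e\<in>edges G. \<exists>x\<in>edom G e. u e x \<noteq> 0" using L6_zero[OF ug(1)] by force
      then have "ereal (L6 G u / ((mass G u)\<^sup>2 * kin G g)) \<le> KG G"
        unfolding KG_def using ug(1) by (intro SUP_upper2[of "(u, g)"]) auto
      moreover have "0 \<le> ereal (L6 G u / ((mass G u)\<^sup>2 * kin G g))" using nonneg[OF ug(1)] by simp
      ultimately show ?thesis by (rule order_trans[rotated])
    qed
    then show ?thesis by (simp add: mu_crit_def real_of_ereal_pos)
  qed
  have "attained G \<mu> \<longleftrightarrow> mu_crit G \<le> \<mu> \<and> \<mu> \<le> mu_R" if mu: "0 < \<mu>" for \<mu>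
  proof
    assume "mu_crit G \<le> \<mu> \<and> \<mu> \<le> mu_R"
    then consider "\<mu> = mu_crit G" | "mu_crit G < \<mu>" "\<mu> \<le> mu_R" by force
    then show "attained G \<mu>"
    proof cases
      case 1
      \<comment> \<open>Since \<open>\<mu>\<close> is positive, \<open>mu_crit\<close> is positive
        here, as \<open>attained_at_mu_crit\<close> requires.\<close>
      then show ?thesis using attained_at_mu_crit[OF no_term two] mu assms(7) by simp
    next
      case 2
      then show ?thesis using attained_if_negative[OF no_term mu 2(2) Elev_neg[OF mu 2(1)]] by simp
    qed
  next
    assume "attained G \<mu>"
    then obtain u g where ug: "H1 G u g" "mass G u = \<mu>"
      "\<And>v k. H1 G v k \<Longrightarrow> mass G v = \<mu> \<Longrightarrow> energy G u g \<le> energy G v k"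
      using attainedD by blast
    have "\<mu> \<le> mu_R"
    proof (rule ccontr)
      assume "\<not> \<mu> \<le> mu_R"
      then obtain v k where "H1 G v k" "mass G v = \<mu>" "energy G v k < energy G u g"
        using low_energy_above_mu_R[OF two, of \<mu> "energy G u g"] by auto
      then show False using ug(3)[of v k] by simp
    qed
    moreover have "mu_crit G \<le> \<mu>"
    proof (rule ccontr)
      assume "\<not> mu_crit G \<le> \<mu>"
      then have lt: "\<mu> < mu_crit G" by simp
      have kin: "0 < kin G g" by (rule kin_pos[OF ug(1)]) (simp add: ug(2) mu)
      have "\<mu> / mu_crit G < 1" "0 \<le> \<mu> / mu_crit G" using lt mu by auto
      then have "(\<mu> / mu_crit G)\<^sup>2 < 1" by (simp add: abs_square_less_1)
      then have "0 < kin G g / 2 * (1 - (mass G u / mu_crit G)\<^sup>2)" using kin ug(2) by simp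
      \<comment> \<open>Below the critical mass every energy is positive, while test functions have
        energies as small as desired.\<close>
      then have pos: "0 < energy G u g" using GN_energy[OF less_trans[OF mu lt] ug(1)] by linarith
      have "\<mu> < mu_R" using lt assms(7) by simp
      then obtain v k where "H1 G v k" "mass G v = \<mu>" "energy G v k < energy G u g"
        using small_energy_below_mu_R[OF two mu _ pos] by blast
      then show False using ug(3)[of v k] by simp
    qed
    ultimately show "mu_crit G \<le> \<mu> \<and> \<mu> \<le> mu_R" by simp
  qed
  moreover have "- \<infinity> < Elev G \<mu> \<and> Elev G \<mu> < 0" if "mu_crit G < \<mu>" "\<mu> \<le> mu_R" for \<mu>
    using Elev_lower_bound[OF no_term that(2)] Elev_neg[OF le_less_trans[OF crit0 that(1)] that(1)] by simp
  ultimately show ?thesis by blast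
qed

end
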